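(* Let $k\ge 0$ be an integer and $a\in\mathbb{C}$. Define \[ n_{a,k}=\begin{cases}2, & \text{if } (a,k)=(1,0) \text{ or } (a=0 \text{ and } k\ge 1),\\ 1, & \text{otherwise}.\end{cases} \] Let $c$ be a sufficiently large real constant and let $f$ satisfy the following six conditions: \begin{enumerate} \item[(C1)] $f(t)$ is a real-valued $C^2$ function on $(c,\infty)$; \item[(C2)] $t f'(t)^2$ is monotonic on $[c,\infty)$ and is either strictly positive throughout or strictly negative throughout; \item[(C3)] $\dfrac{f'(t)^3}{f''(t)\,\log\bigl(t/(2n_{a,k}\pi)\bigr)}$ is monotonic on $[c,\infty)$ and is either strictly positive throughout or strictly negative throughout; \item[(C4)] $f'(T)^{-1}=o(T)$ as $T\to\infty$; \item[(C5)] $\dfrac{f''(T)}{f'(T)^3}=o(T)$ as $T\to\infty$; \item[(C6)] $\displaystyle\int_c^T |f'(t)|\log t\,dt=o(T\log T)$ as $T\to\infty$. \end{enumerate} Then the sequence $\{f(\gamma_a^{(k)})\}_{\gamma_a^{(k)}>1}$ is uniformly distributed modulo $1$, where $\gamma_a^{(k)}$ runs over the imaginary parts of the $a$-points of $\zeta^{(k)}$.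
   Context: $\zeta^{(k)}(s)$ denotes the $k$-th derivative of the Riemann zeta function ($\zeta^{(0)}=\zeta$). An $a$-point of $\zeta^{(k)}$ is a solution $\rho_a^{(k)}=\beta_a^{(k)}+i\gamma_a^{(k)}$ of $\zeta^{(k)}(s)=a$; these are counted with multiplicity. The sequence $\{f(\gamma_a^{(k)})\}_{\gamma_a^{(k)}>1}$ consists of the values $f(\gamma_a^{(k)})$ over all $a$-points with $\gamma_a^{(k)}>1$ (with multiplicity), arranged in order of nondecreasing $\gamma_a^{(k)}$. A real sequence $(x_n)$ is uniformly distributed modulo $1$ if for every $0\le \alpha<\beta\le 1$ the proportion of $n\le N$ with fractional part of $x_n$ in $[\alpha,\beta)$ tends to $\beta-\alpha$ as $N\to\infty$. *)

theory Defs
  imports "HOL-Complex_Analysis.Complex_Analysis" "HOL-Library.Landau_Symbols"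
begin

text \<open>The Riemann zeta function: the unique function holomorphic on the complex plane
  minus the point 1 which agrees with the Dirichlet series for Re s > 1 (analytic
  continuation). The value at the pole s = 1 is fixed to 0 by convention only to make the
  description unique; it plays no role (all a-points considered have imaginary part > 1).\<close>
definition riemann_zeta :: "complex \<Rightarrow> complex" where
  "riemann_zeta = (THE f. f holomorphic_on (UNIV - {1}) \<and> f 1 = 0 \<and>
      (\<forall>s. 1 < Re s \<longrightarrow> f s = (\<Sum>n. 1 / (of_nat (Suc n)) powr s)))"

definition zeta_deriv :: "nat \<Rightarrow> complex \<Rightarrow> complex" where
  "zeta_deriv k = (deriv ^^ k) riemann_zeta"

definition a_point_mult :: "nat \<Rightarrow> complex \<Rightarrow> complex \<Rightarrow> nat" where
  "a_point_mult k a \<rho> =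
     (if zeta_deriv k \<rho> = a then nat (zorder (\<lambda>s. zeta_deriv k s - a) \<rho>) else 0)"

definition enumerates_a_points :: "nat \<Rightarrow> complex \<Rightarrow> (nat \<Rightarrow> complex) \<Rightarrow> bool" where
  "enumerates_a_points k a x \<longleftrightarrow>
     (\<forall>n. zeta_deriv k (x n) = a \<and> 1 < Im (x n)) \<and>
     (\<forall>\<rho>. 1 < Im \<rho> \<longrightarrow> card {n. x n = \<rho>} = a_point_mult k a \<rho>) \<and>
     mono (\<lambda>n. Im (x n))"

definition unif_distrib_mod1 :: "(nat \<Rightarrow> real) \<Rightarrow> bool" where
  "unif_distrib_mod1 x \<longleftrightarrow>
     (\<forall>\<alpha> \<beta>. 0 \<le> \<alpha> \<and> \<alpha> < \<beta> \<and> \<beta> \<le> 1 \<longrightarrow>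
        (\<lambda>N. real (card {n. n < N \<and> frac (x n) \<in> {\<alpha>..<\<beta>}}) / real N) \<longlonglongrightarrow> \<beta> - \<alpha>)"

definition n_ak :: "complex \<Rightarrow> nat \<Rightarrow> nat" where
  "n_ak a k = (if (a = 1 \<and> k = 0) \<or> (a = 0 \<and> k \<ge> 1) then 2 else 1)"

end

theory Submission
  imports Defs "HOL-Real_Asymp.Real_Asymp"
begin

text \<open>
  Both sides of the functional equation, for real x in (-1,0), are the Mellin transform of
  1/2 + 1/(exp y - 1) - 1/y evaluated in two ways: through the partial fractions of coth, and
  through geometric series and the trapezoidal rule for powers of integers. Write N(T) for the number of
  a-points with ordinate in (1,T] and n for n_{a,k}. Then N(T) = T/(2 pi) (log(T/(2 pi n)) - 1) +
  O(log T) by the argument principle on a rectangle: on the left edge the k-th derivative of zeta is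
  chi times (chi'/chi)^k up to a factor close to 1, on the right edge its difference to a is close to
  a multiple of n^(-s), and the top edge contributes O(log T) by Backlund's argument.

  The hypotheses on f make, up to the sign, h = f increasing with decreasing derivative,
  h(t) = o(t) and 1/h'(t) = o(t). Hence W(u) = V(h^{-1}(u)), with V the main term of N, is convex. For
  convex W the sum of W(j + theta) - W(j) over j < m is theta W(m) up to o(W(m)), and
  the total of m error terms O(log h^{-1}(m)) is also o(W(m)). Counting the a-points
  with h(gamma) in [j + alpha, j + beta) for all j < m gives the claim.
\<close>

section \<open>Analytic continuation to a half plane\<close>

text \<open>Zeta is given by a definite description, so its continuation and the functional equation
  have to be built from the Dirichlet series. The interval -1 < x < 0 is exactly where y^(x-1)
  (coth(y/2)/2 - 1/y) is integrable over the positive axis: the second factor behaves like y/12 at 0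
  and tends to 1/2 at infinity. All terms of both evaluations are nonnegative there, so with
  extended nonnegative integrals sums and integrals may be interchanged without integrability
  conditions. The identity theorem then passes from the real interval to the strip.

  The half plane reached by the trapezoidal series overlaps with the reflected one in that strip,
  which is why a continuation to Re s > -1 suffices.

  About the a-points nothing but the asymptotic count enters the last part; equidistribution comes
  from the shape of W alone, with no exponential sums.\<close>

text \<open>By the Euler-Maclaurin formula this is (s - 1) times the error of the trapezoidal rule for the
  integral of x powr (-s) over [n, n + 1], so its sum over n converges for Re s > -1.\<close>
definition trap :: "nat \<Rightarrow> complex \<Rightarrow> complex" where
  "trap n s = (s - 1) * (of_nat n powr (-s) + of_nat (Suc n) powr (-s)) / 2
     + of_nat (Suc n) powr (1 - s) - of_nat n powr (1 - s)"

lemma has_vector_derivative_of_real_powr: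
  assumes "a + u > 0"
  shows "((\<lambda>u. of_real (a + u) powr (w::complex)) has_vector_derivative w * of_real (a + u) powr (w - 1)) (at u within S)"
proof -
  have 1: "((\<lambda>z. z powr w) has_field_derivative w * of_real (a+u) powr (w - 1)) (at (of_real (a + u)))"
    using assms by (intro has_field_derivative_powr) (auto simp: complex_nonpos_Reals_iff)
  have 2: "((\<lambda>u. of_real (a + u) :: complex) has_vector_derivative 1) (at u within S)"
    by (auto intro!: derivative_eq_intros)
  show ?thesis
    using field_vector_diff_chain_within[OF 2 has_field_derivative_at_within[OF 1]]
    by (simp add: o_def)
qed

text \<open>Peano kernel of the trapezoidal rule: the error for a function F on a unit interval is
  the integral of u (1 - u) / 2 times F''. Here F is the power with exponent -s, and the extra
  factor s - 1 removes the pole of zeta.\<close>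

lemma trap_has_integral:
  assumes "n > 0"
  shows "((\<lambda>u. of_real (u * (1 - u) / 2) * ((s - 1) * s * (s + 1)) * of_real (real n + u) powr (- s - 2))
           has_integral trap n s) {0..1}"
proof -
  \<comment> \<open>Primitive found by two integrations by parts. At u = 0 and u = 1 the part with u
    (1 - u) / 2 vanishes, which leaves the two halves of the trapezoid and the powers with exponent
    1 - s.\<close>
  define A where "A = (\<lambda>u::real. (s - 1) * (of_real (u * (1 - u) / 2) * (- s) * of_real (real n + u) powr (- s - 1)
      - of_real (1/2 - u) * of_real (real n + u) powr (- s)) + of_real (real n + u) powr (1 - s))"
  have "((\<lambda>u. of_real (u * (1 - u) / 2) * ((s - 1) * s * (s + 1)) * of_real (real n + u) powr (- s - 2))
           has_integral A 1 - A 0) {0..1}"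
  proof (rule fundamental_theorem_of_calculus)
    fix u :: real assume u: "u \<in> {0..1}"
    have pos: "real n + u > 0" using assms u by auto
    have d1: "((\<lambda>u. of_real (u * (1 - u) / 2) :: complex) has_vector_derivative of_real (1/2 - u)) (at u within {0..1})"
      by (auto intro!: derivative_eq_intros has_vector_derivative_of_real simp: field_simps)
    have d2: "((\<lambda>u. of_real (1/2 - u) :: complex) has_vector_derivative - 1) (at u within {0..1})"
      by (auto intro!: derivative_eq_intros)
    note d3 = has_vector_derivative_of_real_powr[OF pos, of _ "{0..1}"]
    show "(A has_vector_derivative
        of_real (u * (1 - u) / 2) * ((s - 1) * s * (s + 1)) * of_real (real n + u) powr (- s - 2)) (at u within {0..1})"
      unfolding A_def
      by (rule has_vector_derivative_eq_rhs[OF has_vector_derivative_add[OF has_vector_derivative_mult[OF has_vector_derivative_const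
          has_vector_derivative_diff[OF has_vector_derivative_mult[OF has_vector_derivative_mult[OF d1 has_vector_derivative_const] d3]
          has_vector_derivative_mult[OF d2 d3]]] d3]]) (simp add: field_simps)
  qed auto
  also have "A 1 - A 0 = trap n s"
    by (simp add: A_def trap_def algebra_simps add_divide_distrib diff_divide_distrib)
  finally show ?thesis .
qed

lemma norm_trap_le:
  assumes "n > 0" "Re s \<ge> -2"
  shows "norm (trap n s) \<le> norm ((s - 1) * s * (s + 1)) * real n powr (- Re s - 2)"
proof -
  have "norm (trap n s) \<le> norm ((s - 1) * s * (s + 1)) * real n powr (- Re s - 2) * measure lborel (cbox 0 (1::real))"
  proof (rule has_integral_bound)
    show "((\<lambda>u. of_real (u * (1 - u) / 2) * ((s - 1) * s * (s + 1)) * of_real (real n + u) powr (- s - 2))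
           has_integral trap n s) (cbox 0 1)"
      using trap_has_integral[OF assms(1)] by simp
    fix u :: real assume "u \<in> cbox 0 1"
    hence u: "0 \<le> u" "u \<le> 1" by auto
    have "u * (1 - u) \<le> 1 * 1" using u by (intro mult_mono) auto
    hence 1: "\<bar>u * (1 - u) / 2\<bar> \<le> 1" using u by (simp add: abs_mult)
    have 2: "norm (of_real (real n + u) powr (- s - 2)) \<le> real n powr (- Re s - 2)"
      using assms u by (subst norm_powr_real_powr) (auto intro!: powr_mono2')
    have "norm (of_real (u * (1 - u) / 2) * ((s - 1) * s * (s + 1)) * of_real (real n + u) powr (- s - 2))
      = \<bar>u * (1 - u) / 2\<bar> * norm ((s - 1) * s * (s + 1)) * norm (of_real (real n + u) powr (- s - 2))"
      by (simp add: norm_mult del: of_real_mult of_real_diff of_real_divide of_real_add)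
    also have "\<dots> \<le> 1 * norm ((s - 1) * s * (s + 1)) * real n powr (- Re s - 2)"
      using 1 2 by (intro mult_mono) auto
    finally show "norm (of_real (u * (1 - u) / 2) * ((s - 1) * s * (s + 1)) * of_real (real n + u) powr (- s - 2))
      \<le> norm ((s - 1) * s * (s + 1)) * real n powr (- Re s - 2)" by simp
  qed auto
  thus ?thesis by simp
qed

lemma summable_Suc_powr: "p < -1 \<Longrightarrow> summable (\<lambda>n. real (Suc n) powr p)"
  using summable_real_powr_iff[of p] summable_Suc_iff[of "\<lambda>n. real n powr p"] by simp

lemma summable_trap:
  assumes "Re s > -1"
  shows "summable (\<lambda>n. trap (Suc n) s)"
proof (rule summable_comparison_test')
  show "summable (\<lambda>n. norm ((s - 1) * s * (s + 1)) * real (Suc n) powr (- Re s - 2))"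
    using assms by (intro summable_mult summable_Suc_powr) auto
  show "norm (trap (Suc n) s) \<le> norm ((s - 1) * s * (s + 1)) * real (Suc n) powr (- Re s - 2)" for n
    using assms by (intro norm_trap_le) auto
qed

text \<open>The continuation of (s - 1) times zeta.\<close>
definition zeta_half :: "complex \<Rightarrow> complex" where
  "zeta_half s = 1 + (s - 1) / 2 + (\<Sum>n. trap (Suc n) s)"

lemma holomorphic_on_trap: "trap (Suc n) holomorphic_on A"
  unfolding trap_def by (intro holomorphic_intros) (auto simp: of_nat_Suc simp del: of_nat_Suc)

lemma holomorphic_on_zeta_half: "zeta_half holomorphic_on {s. Re s > -1}"
proof -
  have "(\<lambda>s. \<Sum>n. trap (Suc n) s) holomorphic_on {s. Re s > -1}"
  proof (rule holomorphic_uniform_sequence[of _ "\<lambda>N s. \<Sum>n<N. trap (Suc n) s"])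
    show "open {s. -1 < Re s}" by (rule open_halfspace_Re_gt)
    show "(\<lambda>s. \<Sum>n<N. trap (Suc n) s) holomorphic_on {s. Re s > -1}" for N
      by (intro holomorphic_on_sum holomorphic_on_trap)
    fix x :: complex assume x: "x \<in> {s. - 1 < Re s}"
    \<comment> \<open>Half the distance to the line Re s = -1: on this disc the exponents stay at
      most -d - 1 < -1, so one convergent majorant serves all its points.\<close>
    define d where "d = (Re x + 1) / 2"
    have d: "d > 0" using x by (simp add: d_def)
    have re: "Re s \<ge> d - 1" if "s \<in> cball x d" for s
      using abs_Re_le_cmod[of "x - s"] that by (auto simp: dist_norm d_def field_simps)
    have cont: "compact ((\<lambda>s. (s - 1) * s * (s + 1)) ` cball x d)"
      by (intro compact_continuous_image continuous_intros compact_cball)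
    have "bounded ((\<lambda>s. (s - 1) * s * (s + 1)) ` cball x d)" by (rule compact_imp_bounded[OF cont])
    then obtain B where B': "\<forall>y\<in>(\<lambda>s. (s - 1) * s * (s + 1)) ` cball x d. norm y \<le> B"
      unfolding bounded_iff by blast
    have B: "norm ((s - 1) * s * (s + 1)) \<le> B" if "s \<in> cball x d" for s
      using B' that by blast
    have "uniform_limit (cball x d) (\<lambda>N s. \<Sum>n<N. trap (Suc n) s) (\<lambda>s. \<Sum>n. trap (Suc n) s) sequentially"
    proof (rule Weierstrass_m_test)
      show "summable (\<lambda>n. B * real (Suc n) powr (- d - 1))"
        using d by (intro summable_mult summable_Suc_powr) auto
      fix n s assume s: "s \<in> cball x d"
      have "norm (trap (Suc n) s) \<le> norm ((s - 1) * s * (s + 1)) * real (Suc n) powr (- Re s - 2)"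
        using re[OF s] d by (intro norm_trap_le) auto
      also have "\<dots> \<le> B * real (Suc n) powr (- d - 1)"
        using B[OF s] re[OF s] order_trans[OF norm_ge_zero B[OF s]] by (intro mult_mono powr_mono) auto
      finally show "norm (trap (Suc n) s) \<le> B * real (Suc n) powr (- d - 1)" .
    qed
    moreover have "cball x d \<subseteq> {s. - 1 < Re s}" using re d by fastforce
    ultimately show "\<exists>d>0. cball x d \<subseteq> {s. - 1 < Re s} \<and>
        uniform_limit (cball x d) (\<lambda>N s. \<Sum>n<N. trap (Suc n) s) (\<lambda>s. \<Sum>n. trap (Suc n) s) sequentially"
      using d by auto
  qed
  thus ?thesis unfolding zeta_half_def[abs_def] by (intro holomorphic_intros) auto
qed

text \<open>Polynomial growth is what Backlund's argument will ask for. The cube comes from (s - 1)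
  s (s + 1), and the line -1/2 keeps every exponent at most -3/2, so that the sum is bounded
  uniformly in s.\<close>

lemma zeta_half_bound:
  obtains C where "C > 0" "\<And>s. Re s \<ge> - 1/2 \<Longrightarrow> norm (zeta_half s) \<le> C * (1 + norm s) ^ 3"
proof -
  define S where "S = (\<Sum>n. real (Suc n) powr (-3/2))"
  have sm: "summable (\<lambda>n. real (Suc n) powr (-3/2))" by (rule summable_Suc_powr) auto
  have S0: "S \<ge> 0" unfolding S_def by (intro suminf_nonneg sm) auto
  have "norm (zeta_half s) \<le> (2 + S) * (1 + norm s) ^ 3" if s: "Re s \<ge> - 1/2" for s
  proof -
    have p: "norm ((s - 1) * s * (s + 1)) \<le> (1 + norm s) ^ 3"
    proof -
      have "norm (s - 1) \<le> 1 + norm s" "norm (s + 1) \<le> 1 + norm s"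
        using norm_triangle_ineq4[of s 1] norm_triangle_ineq[of s 1] by auto
      hence "norm (s - 1) * norm s * norm (s + 1) \<le> (1 + norm s) * (1 + norm s) * (1 + norm s)"
        by (intro mult_mono) auto
      thus ?thesis by (simp add: norm_mult power3_eq_cube)
    qed
    have le: "norm (trap (Suc n) s) \<le> (1 + norm s) ^ 3 * real (Suc n) powr (-3/2)" for n
    proof -
      have "norm (trap (Suc n) s) \<le> norm ((s - 1) * s * (s + 1)) * real (Suc n) powr (- Re s - 2)"
        using s by (intro norm_trap_le) auto
      also have "\<dots> \<le> (1 + norm s) ^ 3 * real (Suc n) powr (-3/2)"
      proof (intro mult_mono powr_mono p)
        show "- Re s - 2 \<le> - 3 / 2" using s by argo
      qed auto
      finally show ?thesis .
    qed
    have sum2: "summable (\<lambda>n. (1 + norm s) ^ 3 * real (Suc n) powr (-3/2))" by (intro summable_mult sm)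
    have "norm (\<Sum>n. trap (Suc n) s) \<le> (\<Sum>n. (1 + norm s) ^ 3 * real (Suc n) powr (-3/2))"
      by (rule norm_suminf_le[OF le sum2])
    also have "\<dots> = (1 + norm s) ^ 3 * S" unfolding S_def by (rule suminf_mult[OF sm])
    finally have 1: "norm (\<Sum>n. trap (Suc n) s) \<le> (1 + norm s) ^ 3 * S" .
    have 2: "norm (1 + (s - 1) / 2) \<le> 1 + norm s"
      using norm_triangle_ineq[of 1 "s"] norm_triangle_ineq[of "1/2" "s/2"] norm_ge_zero[of s]
      by (simp add: field_simps norm_divide del: norm_ge_zero)
    have 3: "1 + norm s \<le> (1 + norm s) ^ 3" by (rule self_le_power) auto
    have "norm (zeta_half s) \<le> norm (1 + (s - 1) / 2) + norm (\<Sum>n. trap (Suc n) s)"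
      unfolding zeta_half_def by (rule norm_triangle_ineq)
    also have "\<dots> \<le> 2 * (1 + norm s) ^ 3 + (1 + norm s) ^ 3 * S"
      using 1 2 3 norm_ge_zero[of "1 + (s - 1) / 2"] by linarith
    finally show ?thesis by (simp add: algebra_simps)
  qed
  thus ?thesis using that[of "2 + S"] S0 by auto
qed

lemma norm_of_nat_powr: "n > 0 \<Longrightarrow> norm (of_nat n powr w :: complex) = real n powr Re w"
  using norm_powr_real_powr[of "of_nat n" w] by simp

lemma summable_dirichlet:
  assumes "Re s > 1"
  shows "summable (\<lambda>n. of_nat (Suc n) powr (- s) :: complex)"
proof (rule summable_norm_cancel)
  have "(\<lambda>n. norm (of_nat (Suc n) powr (- s) :: complex)) = (\<lambda>n. real (Suc n) powr (- Re s))"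
    by (simp add: norm_of_nat_powr del: of_nat_Suc)
  thus "summable (\<lambda>n. norm (of_nat (Suc n) powr (- s) :: complex))"
    using summable_Suc_powr[of "- Re s"] assms by simp
qed

lemma tendsto_Suc_powr_0:
  assumes "Re w < 0"
  shows "(\<lambda>N. of_nat (Suc N) powr w :: complex) \<longlonglongrightarrow> 0"
proof (rule tendsto_norm_zero_cancel)
  have "(\<lambda>N. real (Suc N) powr (Re w)) \<longlonglongrightarrow> 0"
    by (rule tendsto_neg_powr[OF assms]) (rule filterlim_compose[OF filterlim_real_sequentially filterlim_Suc])
  thus "(\<lambda>N. norm (of_nat (Suc N) powr w :: complex)) \<longlonglongrightarrow> 0"
    by (simp add: norm_of_nat_powr del: of_nat_Suc)
qed

lemma zeta_half_eq:
  assumes "Re s > 1"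
  shows "zeta_half s = (s - 1) * (\<Sum>n. 1 / of_nat (Suc n) powr s)"
proof -
  define Z where "Z = (\<Sum>n. of_nat (Suc n) powr (- s) :: complex)"
  \<comment> \<open>Neighbouring trapezoids share a power with exponent -s, so whole powers appear
    inside and halves only at the ends, while the powers with exponent 1 - s telescope.\<close>
  have part: "(\<Sum>n<N. trap (Suc n) s) = (s - 1) * (\<Sum>n<N. of_nat (Suc n) powr (- s))
      + (s - 1) / 2 * (of_nat (Suc N) powr (- s) - 1) + of_nat (Suc N) powr (1 - s) - 1" for N
  proof (induction N)
    case (Suc N)
    have tr: "trap (Suc N) s = (s - 1) * of_nat (Suc N) powr (-s) + (s - 1) / 2 * (of_nat (Suc (Suc N)) powr (-s) - of_nat (Suc N) powr (-s))
      + of_nat (Suc (Suc N)) powr (1 - s) - of_nat (Suc N) powr (1 - s)"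
    proof -
      have "t * (a + b) / 2 + q - p = t * a + t / 2 * (b - a) + q - p" for t a b p q :: complex
        by (simp add: field_simps)
      thus ?thesis unfolding trap_def .
    qed
    have "t * S + h * (a - 1) + p - 1 + (t * a + h * (b - a) + q - p) = t * (S + a) + h * (b - 1) + q - 1"
      for t S h a b p q :: complex by (simp add: algebra_simps)
    thus ?case unfolding sum.lessThan_Suc Suc.IH tr .
  next
    case 0
    show ?case by simp
  qed
  have lim1: "(\<lambda>N. \<Sum>n<N. of_nat (Suc n) powr (- s)) \<longlonglongrightarrow> Z"
    unfolding Z_def by (rule summable_LIMSEQ[OF summable_dirichlet[OF assms]])
  have lim2: "(\<lambda>N. of_nat (Suc N) powr (- s) :: complex) \<longlonglongrightarrow> 0" 
    and lim3: "(\<lambda>N. of_nat (Suc N) powr (1 - s) :: complex) \<longlonglongrightarrow> 0"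
    using assms by (auto intro!: tendsto_Suc_powr_0 simp del: of_nat_Suc)
  have "(\<lambda>N. \<Sum>n<N. trap (Suc n) s) \<longlonglongrightarrow> (s - 1) * Z + (s - 1) / 2 * (0 - 1) + 0 - 1"
    unfolding part
    by (intro tendsto_add tendsto_diff tendsto_mult tendsto_const lim1 lim2 lim3)
  moreover have "(\<lambda>N. \<Sum>n<N. trap (Suc n) s) \<longlonglongrightarrow> (\<Sum>n. trap (Suc n) s)"
    by (rule summable_LIMSEQ[OF summable_trap]) (use assms in auto)
  ultimately have "(\<Sum>n. trap (Suc n) s) = (s - 1) * Z + (s - 1) / 2 * (0 - 1) + 0 - 1"
    by (rule LIMSEQ_unique[rotated])
  hence "zeta_half s = (s - 1) * Z" by (simp add: zeta_half_def)
  thus ?thesis unfolding Z_def by (simp only: powr_minus inverse_eq_divide)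
qed

section \<open>The functional equation\<close>

text \<open>Logarithmic derivative of the reflection formula for Gamma.\<close>

lemma Digamma_reflection:
  fixes z :: complex
  assumes "z \<notin> \<int>"
  shows "Digamma z - Digamma (1 - z) = - of_real pi * cot (of_real pi * z)"
proof -
  have sinz: "sin (of_real pi * z) \<noteq> 0" using assms by (simp add: sin_eq_0 Ints_def) (metis mult.commute mult_cancel_left of_real_eq_0_iff pi_neq_zero assms Ints_of_int of_real_of_int_eq)
  have nz: "z \<notin> \<int>\<^sub>\<le>\<^sub>0" "1 - z \<notin> \<int>\<^sub>\<le>\<^sub>0" using assms
    by (auto elim!: nonpos_Ints_cases simp: diff_eq_eq) (metis Ints_1 Ints_diff Ints_of_int add_diff_cancel_left' )
  have d1: "((\<lambda>z. Gamma z * Gamma (1 - z)) has_field_derivative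
     Gamma z * Gamma (1 - z) * (Digamma z - Digamma (1 - z))) (at z)"
    using nz by (auto intro!: derivative_eq_intros simp: algebra_simps)
  have d2: "((\<lambda>z. of_real pi / sin (of_real pi * z)) has_field_derivative
     - of_real pi * (of_real pi * cos (of_real pi * z)) / (sin (of_real pi * z))^2) (at z)"
    using sinz by (auto intro!: derivative_eq_intros simp: power2_eq_square)
  have "(\<lambda>z. Gamma z * Gamma (1 - z)) = (\<lambda>z::complex. of_real pi / sin (of_real pi * z))"
    by (rule ext) (rule Gamma_reflection_complex)
  with d1 d2 have "Gamma z * Gamma (1 - z) * (Digamma z - Digamma (1 - z)) = 
     - of_real pi * (of_real pi * cos (of_real pi * z)) / (sin (of_real pi * z))^2"
    using DERIV_unique by metis
  hence "of_real pi / sin (of_real pi * z) * (Digamma z - Digamma (1 - z)) = 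
     of_real pi / sin (of_real pi * z) * (- of_real pi * cot (of_real pi * z))"
    unfolding Gamma_reflection_complex by (simp add: cot_def power2_eq_square)
  moreover have "of_real pi / sin (of_real pi * z) \<noteq> 0" using sinz by simp
  ultimately show ?thesis by (metis mult_cancel_left)
qed

text \<open>This is coth (y / 2) / 2 - 1 / y.\<close>
definition coth_rem :: "real \<Rightarrow> real" where
  "coth_rem y = 1 / 2 + 1 / (exp y - 1) - 1 / y"

text \<open>Taken from \<open>Digamma_reflection\<close> at w = i y / (2 pi): there the cotangent
  becomes coth(y/2), while the series of \<open>Digamma\<close> supplies the partial
  fractions.\<close>

lemma coth_rem_sums:
  assumes y: "y > 0"
  shows "(\<lambda>n. 2 * y / (y\<^sup>2 + (2 * pi * real (Suc n))\<^sup>2)) sums coth_rem y"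
proof -
  define w where "w = \<i> * of_real (y / (2 * pi))"
  have w2: "w * w = - of_real ((y / (2 * pi))\<^sup>2)" by (simp add: w_def power2_eq_square field_simps)
  have w0: "w \<noteq> 0" using y by (simp add: w_def)
  have imw: "Im w \<noteq> 0" using y by (simp add: w_def)
  have nint: "w \<notin> \<int>" using imw by (auto elim!: Ints_cases)
  have nz1: "w + of_nat n \<noteq> 0" "1 - w + of_nat n \<noteq> 0" for n
    using imw by (auto simp: complex_eq_iff)
  have cot: "cot (of_real pi * w) = - \<i> * of_real (1 + 2 / (exp y - 1))"
  proof -
    have a: "\<i> * (of_real pi * w) = - of_real (y/2)" by (simp add: w_def)
    have e: "exp y = exp (y/2) * exp (y/2)" by (simp flip: exp_add)
    have e1: "exp (y/2) > 1" using y by simp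
    have "exp (y/2) * exp (y/2) > 1" using y e by (metis exp_gt_one)
    hence ne: "exp (y/2) * exp (y/2) - 1 \<noteq> 0" by simp
    have alg: "(a + b) / 2 / ((a - b) / (2 * \<i>)) = \<i> * ((a + b) / (a - b))" for a b :: complex by (simp only: divide_divide_eq_right) simp
    have "cot (of_real pi * w) = \<i> * ((exp (- of_real (y/2)) + exp (-(- of_real (y/2)))) / (exp (- of_real (y/2)) - exp (-(- of_real (y/2)))))"
      unfolding cot_def sin_exp_eq cos_exp_eq a by (rule alg)
    also have "\<dots> = \<i> * of_real ((exp (- (y/2)) + exp (y/2)) / (exp (-(y/2)) - exp (y/2)))"
    proof -
      have "exp (- of_real (y/2) :: complex) = of_real (exp (- (y/2)))" "exp (-(- of_real (y/2)) :: complex) = of_real (exp (y/2))"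
        by (simp_all only: minus_minus exp_of_real of_real_minus[symmetric])
      thus ?thesis by (simp only: of_real_add of_real_diff of_real_divide)
    qed
    also have "(exp (- (y/2)) + exp (y/2)) / (exp (-(y/2)) - exp (y/2)) = - (1 + 2 / (exp y - 1))"
      unfolding e exp_minus using ne by (simp add: divide_simps) (simp add: algebra_simps)?
    finally show ?thesis by (simp add: algebra_simps)
  qed
  have s1: "(\<lambda>n. inverse (1 - w + of_nat n) - inverse (w + of_nat n)) sums (Digamma w - Digamma (1 - w))"
  proof -
    have "(\<lambda>n. (inverse (of_nat (Suc n)) - inverse (w + of_nat n)) - (inverse (of_nat (Suc n)) - inverse (1 - w + of_nat n)))
        sums ((Digamma w + euler_mascheroni) - (Digamma (1 - w) + euler_mascheroni))"
      unfolding Digamma_def using w0 nz1(2)[of 0]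
      by (intro sums_diff) (auto intro!: summable_sums summable_Digamma simp del: of_nat_Suc)
    thus ?thesis by simp
  qed
  \<comment> \<open>Shifting the index of one series pairs 1/(m - w) with 1/(m + w), whose
    difference is i times a real number. The shift leaves 1/w over, which becomes the term 1/y of
    \<open>coth_rem\<close>.\<close>
  have s2: "(\<lambda>n. inverse (w + of_nat (Suc n)) - inverse (w + of_nat n)) sums (0 - inverse (w + of_nat 0))"
    by (intro telescope_sums filterlim_compose[OF tendsto_inverse_0]
              tendsto_add_filterlim_at_infinity[OF tendsto_const] tendsto_of_nat)
  have s3: "(\<lambda>n. inverse (1 - w + of_nat n) - inverse (w + of_nat (Suc n))) sums 
      (Digamma w - Digamma (1 - w) + inverse w)"
    using sums_diff[OF s1 s2] by simp
  have tm: "inverse (1 - w + of_nat n) - inverse (w + of_nat (Suc n)) = 2 * of_real pi * \<i> * of_real (2 * y / (y\<^sup>2 + (2 * pi * real (Suc n))\<^sup>2))" for n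
  proof -
    define m where "m = real (Suc n)"
    have pos: "y\<^sup>2 + (2 * pi * m)\<^sup>2 > 0" using y by (simp add: add_pos_nonneg)
    have n1: "of_real m - w \<noteq> 0" "of_real m + w \<noteq> 0" using nz1[of n] nz1(1)[of "Suc n"] by (auto simp: m_def algebra_simps)
    have "inverse (1 - w + of_nat n) - inverse (w + of_nat (Suc n)) = inverse (of_real m - w) - inverse (of_real m + w)"
      by (simp add: m_def algebra_simps)
    also have "\<dots> = 2 * w / ((of_real m - w) * (of_real m + w))"
      using n1 by (simp add: field_simps)
    also have "(of_real m - w) * (of_real m + w) = of_real (m\<^sup>2 + (y / (2 * pi))\<^sup>2)"
      using w2 by (simp add: algebra_simps power2_eq_square)
    also have "m\<^sup>2 + (y / (2 * pi))\<^sup>2 = (y\<^sup>2 + (2 * pi * m)\<^sup>2) / (2 * pi)\<^sup>2"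
      by (simp add: field_simps)
    also have "2 * w / of_real \<dots> = 2 * \<i> * of_real ((y / (2 * pi)) / ((y\<^sup>2 + (2 * pi * m)\<^sup>2) / (2 * pi)\<^sup>2))"
      unfolding w_def by simp
    also have "(y / (2 * pi)) / ((y\<^sup>2 + (2 * pi * m)\<^sup>2) / (2 * pi)\<^sup>2) = pi * (2 * y / (y\<^sup>2 + (2 * pi * m)\<^sup>2))"
      using pos by (simp add: power2_eq_square)
    finally show ?thesis unfolding m_def by (simp only: of_real_mult mult_ac)
  qed
  have iw: "inverse w = - \<i> * of_real (2 * pi / y)" using y by (simp add: w_def field_simps)
  have val: "Digamma w - Digamma (1 - w) + inverse w = 2 * of_real pi * \<i> * of_real (coth_rem y)"
    unfolding Digamma_reflection[OF nint] cot iw coth_rem_def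
    by (simp add: algebra_simps)
  have "(\<lambda>n. 2 * of_real pi * \<i> * (of_real (2 * y / (y\<^sup>2 + (2 * pi * real (Suc n))\<^sup>2)) :: complex)) sums (2 * of_real pi * \<i> * of_real (coth_rem y))"
    using s3 unfolding tm val .
  hence "(\<lambda>n. (of_real (2 * y / (y\<^sup>2 + (2 * pi * real (Suc n))\<^sup>2)) :: complex)) sums (of_real (coth_rem y))"
    by (subst (asm) sums_mult_iff) simp_all
  thus ?thesis by (simp only: sums_of_real_iff)
qed

section \<open>Mellin transforms of the two expansions\<close>

lemma nn_integral_Gamma_kernel:
  fixes a p :: real
  assumes a: "a > 0" and p: "p > 0"
  shows "(\<integral>\<^sup>+y. ennreal (indicator {0<..} y * (y powr (p - 1) * exp (- a * y))) \<partial>lborel) = ennreal (Gamma p * a powr (- p))"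
proof -
  have "ennreal (Gamma p) = (\<integral>\<^sup>+t. ennreal (indicator {0..} t * t powr (p - 1) / exp t) \<partial>lborel)"
    by (rule Gamma_conv_nn_integral_real[OF p])
  also have "\<dots> = \<bar>a\<bar> * (\<integral>\<^sup>+t. ennreal (indicator {0..} (0 + a * t) * (0 + a * t) powr (p - 1) / exp (0 + a * t)) \<partial>lborel)"
    using a by (intro nn_integral_real_affine) auto
  also have "\<dots> = a * (\<integral>\<^sup>+t. ennreal (a powr (p - 1)) * ennreal (indicator {0<..} t * (t powr (p - 1) * exp (- a * t))) \<partial>lborel)"
    using a by (intro arg_cong2[where f = "(*)"] nn_integral_cong refl)
      (auto simp: indicator_def powr_mult exp_minus field_simps zero_le_mult_iff simp flip: ennreal_mult')
  also have "\<dots> = ennreal (a * a powr (p - 1)) * (\<integral>\<^sup>+t. ennreal (indicator {0<..} t * (t powr (p - 1) * exp (- a * t))) \<partial>lborel)"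
    using a by (subst nn_integral_cmult) (auto simp: ennreal_mult' mult.assoc)
  also have "a * a powr (p - 1) = a powr p" using a by (simp add: powr_diff)
  finally have eq: "ennreal (Gamma p) = ennreal (a powr p) * (\<integral>\<^sup>+t. ennreal (indicator {0<..} t * (t powr (p - 1) * exp (- a * t))) \<partial>lborel)" .
  have "ennreal (Gamma p * a powr (- p)) = ennreal (a powr (-p)) * ennreal (Gamma p)"
    using p by (simp add: ennreal_mult' mult.commute)
  also have "\<dots> = ennreal (a powr (-p) * a powr p) * (\<integral>\<^sup>+t. ennreal (indicator {0<..} t * (t powr (p - 1) * exp (- a * t))) \<partial>lborel)"
    unfolding eq by (simp add: ennreal_mult' mult.assoc)
  also have "a powr (-p) * a powr p = 1" using a by (simp flip: powr_add)
  finally show ?thesis by simp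
qed

text \<open>The substitution u = sqrt(t / (1 - t)) gives half the Beta integral at p = (s + 1)/2 and
  1 - p. The reflection formula evaluates it, with sin(pi p) = cos(pi s / 2).\<close>

lemma nn_integral_powr_over_square:
  fixes s :: real
  assumes s: "-1 < s" "s < 1"
  shows "(\<integral>\<^sup>+u. ennreal (indicator {0<..} u * (u powr s / (1 + u\<^sup>2))) \<partial>lborel) = ennreal (pi / (2 * cos (pi * s / 2)))"
proof -
  define f where "f = (\<lambda>u::real. u powr s / (1 + u\<^sup>2))"
  define g where "g = (\<lambda>t::real. sqrt (t / (1 - t)))"
  define g' where "g' = (\<lambda>t::real. 1 / (2 * sqrt (t / (1 - t)) * (1 - t)\<^sup>2))"
  define p where "p = (s + 1) / 2"
  have p: "0 < p" "p < 1" using s by (auto simp: p_def)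
  have fg: "f (g t) * g' t = 1 / 2 * (t powr (p - 1) * (1 - t) powr ((1 - p) - 1))" if t: "0 < t" "t < 1" for t
  proof -
    define r where "r = t / (1 - t)"
    have r: "r > 0" using t by (simp add: r_def)
    have "1 + r = 1 / (1 - t)" using t by (simp add: r_def field_simps)
    hence "f (g t) = (sqrt r) powr s * (1 - t)" using r t by (simp add: f_def g_def flip: r_def)
    hence "f (g t) * g' t = 1/2 * ((sqrt r) powr s / sqrt r) / (1 - t)"
      using t by (simp add: g'_def power2_eq_square flip: r_def)
    also have "(sqrt r) powr s / sqrt r = r powr (p - 1)"
      using r by (simp add: powr_half_sqrt[symmetric] powr_powr powr_diff[symmetric] p_def field_simps)
    also have "r powr (p - 1) = t powr (p - 1) / (1 - t) powr (p - 1)" using t by (simp add: r_def powr_divide)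
    also have "1 / 2 * (t powr (p - 1) / (1 - t) powr (p - 1)) / (1 - t) = 1/2 * (t powr (p - 1) * ((1 - t) powr (- (p - 1)) * (1 - t) powr (-1)))"
    proof -
      have "1 / 2 * (a / b) / c = 1 / 2 * (a * (inverse b * inverse c))" for a b c :: real by (simp add: field_simps)
      moreover have "(1 - t) powr (- (p - 1)) = inverse ((1 - t) powr (p - 1))" by (rule powr_minus)
      moreover have "(1 - t) powr (-1) = inverse (1 - t)" using t by (simp add: powr_minus)
      ultimately show ?thesis by (simp only:)
    qed
    also have "(1 - t) powr (- (p - 1)) * (1 - t) powr (-1) = (1 - t) powr ((1 - p) - 1)"
      by (simp only: powr_add[symmetric]) (simp add: algebra_simps)
    finally show ?thesis .
  qed
  have beta: "((\<lambda>t. t powr (p - 1) * (1 - t) powr ((1 - p) - 1)) has_integral Beta p (1 - p)) {0..1}"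
    using p by (intro has_integral_Beta_real) auto
  have int1: "set_integrable lborel {0..1} (\<lambda>t. t powr (p - 1) * (1 - t) powr ((1 - p) - 1))"
    using p by (intro integrable_Beta) auto
  have int2: "set_integrable lborel {0<..<1} (\<lambda>t. t powr (p - 1) * (1 - t) powr ((1 - p) - 1))"
    by (rule set_integrable_subset[OF int1]) auto
  have int3: "set_integrable lborel {0<..<1} (\<lambda>t. f (g t) * g' t)"
  proof -
    have "set_integrable lborel {0<..<1} (\<lambda>t. 1/2 * (t powr (p - 1) * (1 - t) powr ((1 - p) - 1)))"
      by (intro set_integrable_mult_right int2)
    also have "?this \<longleftrightarrow> ?thesis" by (intro set_integrable_cong refl) (auto simp: fg)
    finally show ?thesis .
  qed
  have ei: "einterval 0 1 = {0<..<1::real}" "einterval 0 \<infinity> = ({0<..} :: real set)"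
    by (auto simp: einterval_def zero_ereal_def one_ereal_def)
  have lim0: "((ereal \<circ> g \<circ> real_of_ereal) \<longlongrightarrow> 0) (at_right 0)"
  proof -
    have "(g \<longlongrightarrow> sqrt (0 / (1 - 0))) (at_right 0)" unfolding g_def by (intro tendsto_intros) auto
    hence "((\<lambda>x. ereal (g x)) \<longlongrightarrow> 0) (at_right 0)" by (simp add: zero_ereal_def)
    hence "(((\<lambda>x. ereal (g x)) \<circ> real_of_ereal) \<longlongrightarrow> 0) (at_right (ereal 0))"
      by (subst ereal_tendsto_simps(2))
    thus ?thesis by (simp add: o_def zero_ereal_def)
  qed
  have lim1: "((ereal \<circ> g \<circ> real_of_ereal) \<longlongrightarrow> \<infinity>) (at_left 1)"
  proof -
    have "filterlim g at_top (at_left 1)" unfolding g_def by real_asymp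
    hence "((\<lambda>x. ereal (g x)) \<longlongrightarrow> \<infinity>) (at_left 1)" by (simp add: tendsto_PInfty_eq_at_top)
    hence "(((\<lambda>x. ereal (g x)) \<circ> real_of_ereal) \<longlongrightarrow> \<infinity>) (at_left (ereal 1))"
      by (subst ereal_tendsto_simps(1))
    thus ?thesis by (simp add: o_def one_ereal_def)
  qed
  have gpos: "g x > 0" if "0 < x" "x < 1" for x using that by (simp add: g_def)
  have sq: "1 + u\<^sup>2 \<noteq> 0" for u :: real using zero_le_power2[of u] by linarith
  have h1: "DERIV g x :> g' x" if "0 < ereal x" "ereal x < 1" for x
  proof -
    have x: "0 < x" "x < 1" using that by (auto simp: zero_ereal_def one_ereal_def)
    have d1: "((\<lambda>t. t / (1 - t)) has_real_derivative 1 / (1 - x)\<^sup>2) (at x)"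
      using x by (auto intro!: derivative_eq_intros simp: power2_eq_square)
    have d2: "(sqrt has_real_derivative inverse (sqrt (x / (1 - x))) / 2) (at (x / (1 - x)))"
      using x by (intro DERIV_real_sqrt) auto
    have "((\<lambda>t. sqrt (t / (1 - t))) has_real_derivative inverse (sqrt (x / (1 - x))) / 2 * (1 / (1 - x)\<^sup>2)) (at x)"
      by (rule DERIV_chain2[OF d2 d1])
    moreover have "inverse q / 2 * (1 / w) = 1 / (2 * q * w)" for q w :: real by (simp add: field_simps)
    ultimately show ?thesis unfolding g_def g'_def by simp
  qed
  have h2: "isCont f (g x)" if "0 < ereal x" "ereal x < 1" for x
  proof -
    have x: "0 < x" "x < 1" using that by (auto simp: zero_ereal_def one_ereal_def)
    show ?thesis unfolding f_def using gpos[OF x] sq by (auto intro!: continuous_intros)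
  qed
  have h3: "isCont g' x" if "0 < ereal x" "ereal x < 1" for x
  proof -
    have x: "0 < x" "x < 1" using that by (auto simp: zero_ereal_def one_ereal_def)
    show ?thesis unfolding g'_def using x by (auto intro!: continuous_intros)
  qed
  have h4: "0 \<le> f (g x)" if "0 < ereal x" "ereal x < 1" for x by (simp add: f_def)
  \<comment> \<open>At t = 0 and t = 1 the denominator is 0 and the quotient has the default value
    0, so the sign condition also holds on the closed interval.\<close>
  have h5: "0 \<le> g' x" if "0 \<le> ereal x" "ereal x \<le> 1" for x
    using that by (auto simp: g'_def zero_ereal_def one_ereal_def)
  have h6: "set_integrable lborel (einterval 0 1) (\<lambda>x. f (g x) * g' x)" using int3 by (simp only: ei)
  have e01: "(0::ereal) < 1" by simp
  note sub = interval_integral_substitution_nonneg[of 0 1 g g' f 0 \<infinity>, OF e01 h1 h2 h3 h4 h5 lim0 lim1 h6]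
  have "(LBINT x=0..\<infinity>. f x) = (LBINT x:{0<..<1}. (f (g x) * g' x))"
  proof -
    have "(LBINT x=0..1. f (g x) * g' x) = (LBINT x:{0<..<1}. (f (g x) * g' x))"
      by (simp add: interval_lebesgue_integral_def ei)
    with sub(2) show ?thesis by (rule trans)
  qed
  also have "\<dots> = (LBINT x:{0<..<1}. 1/2 * (x powr (p - 1) * (1 - x) powr ((1 - p) - 1)))"
    by (rule set_lebesgue_integral_cong) (auto simp: fg)
  also have "\<dots> = 1/2 * (LBINT x:{0<..<1}. (x powr (p - 1) * (1 - x) powr ((1 - p) - 1)))" by simp
  also have "(LBINT x:{0<..<1}. (x powr (p - 1) * (1 - x) powr ((1 - p) - 1))) = integral {0<..<1} (\<lambda>x. x powr (p - 1) * (1 - x) powr ((1 - p) - 1))"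
    by (rule set_borel_integral_eq_integral(2)[OF int2])
  also have "\<dots> = Beta p (1 - p)"
    by (rule integral_unique[OF beta[unfolded has_integral_Icc_iff_Ioo]])
  also have "Beta p (1 - p) = pi / cos (pi * s / 2)"
  proof -
    have "complex_of_real (Gamma p * Gamma (1 - p)) = Gamma (of_real p) * Gamma (1 - of_real p)"
      using Gamma_complex_of_real[of p] Gamma_complex_of_real[of "1 - p"] by simp
    also have "\<dots> = of_real (pi / sin (pi * p))"
      by (subst Gamma_reflection_complex) (simp only: sin_of_real of_real_mult[symmetric] of_real_divide)
    finally have "Gamma p * Gamma (1 - p) = pi / sin (pi * p)" by (simp only: of_real_eq_iff)
    moreover have "sin (pi * p) = cos (pi * s / 2)"
    proof -
      have "pi * p = pi / 2 + pi * s / 2" by (simp add: p_def field_simps)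
      thus ?thesis by (simp add: sin_add)
    qed
    ultimately show ?thesis by (simp add: Beta_def)
  qed
  finally have "(LBINT x=0..\<infinity>. f x) = 1 / 2 * (pi / cos (pi * s / 2))" .
  hence val: "(LBINT x:{0<..}. f x) = pi / (2 * cos (pi * s / 2))"
    unfolding zero_ereal_def interval_integral_to_infinity_eq by simp
  have "integrable lborel (\<lambda>u. indicator {0<..} u * f u)" 
    using sub(1) by (simp add: set_integrable_def ei)
  hence "(\<integral>\<^sup>+u. ennreal (indicator {0<..} u * f u) \<partial>lborel) = ennreal (\<integral>u. indicator {0<..} u * f u \<partial>lborel)"
    by (rule nn_integral_eq_integral) (auto simp: f_def)
  also have "(\<integral>u. indicator {0<..} u * f u \<partial>lborel) = pi / (2 * cos (pi * s / 2))"
    using val by (simp add: set_lebesgue_integral_def)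
  finally show ?thesis by (simp add: f_def)
qed

text \<open>Scaling by c reduces this to the previous integral. Summed over c = 2 pi (n + 1), the
  values produce the Dirichlet series at 1 - s.\<close>

lemma nn_integral_coth_term:
  fixes s c :: real
  assumes s: "-1 < s" "s < 1" and c: "c > 0"
  shows "(\<integral>\<^sup>+y. ennreal (indicator {0<..} y * (y powr (s - 1) * (2 * y / (y\<^sup>2 + c\<^sup>2)))) \<partial>lborel) = ennreal (c powr (s - 1) * (pi / cos (pi * s / 2)))"
proof -
  have "(\<integral>\<^sup>+y. ennreal (indicator {0<..} y * (y powr (s - 1) * (2 * y / (y\<^sup>2 + c\<^sup>2)))) \<partial>lborel)
    = ennreal \<bar>c\<bar> * (\<integral>\<^sup>+y. ennreal (indicator {0<..} (0 + c * y) * ((0 + c * y) powr (s - 1) * (2 * (0 + c * y) / ((0 + c * y)\<^sup>2 + c\<^sup>2)))) \<partial>lborel)"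
    by (rule nn_integral_real_affine[where t = 0 and c = c]) (measurable, use c in simp)
  also have "\<dots> = ennreal c * (\<integral>\<^sup>+y. ennreal (2 * c powr (s - 2)) * ennreal (indicator {0<..} y * (y powr s / (1 + y\<^sup>2))) \<partial>lborel)"
  proof (intro arg_cong2[where f = "(*)"] nn_integral_cong)
    fix y :: real
    show "ennreal (indicator {0<..} (0 + c * y) * ((0 + c * y) powr (s - 1) * (2 * (0 + c * y) / ((0 + c * y)\<^sup>2 + c\<^sup>2))))
      = ennreal (2 * c powr (s - 2)) * ennreal (indicator {0<..} y * (y powr s / (1 + y\<^sup>2)))"
    proof (cases "y > 0")
      case True
      have "(c * y) powr (s - 1) * (2 * (c * y) / ((c * y)\<^sup>2 + c\<^sup>2)) = 2 * c powr (s - 2) * (y powr s / (1 + y\<^sup>2))"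
      proof -
        have 1: "(c * y) powr (s - 1) * (c * y) = c powr s * y powr s"
          using True c by (simp add: powr_diff powr_mult)
        have 2: "(c * y)\<^sup>2 + c\<^sup>2 = c\<^sup>2 * (1 + y\<^sup>2)" by (simp add: algebra_simps power_mult_distrib)
        have 3: "c powr (s - 2) = c powr s / c\<^sup>2" using c by (simp add: powr_diff)
        have alg1: "p * (2 * q / r) = (p * q) * (2 / r)" for p q r :: real by simp
        have alg2: "p * q * (2 / (r * t)) = 2 * (p / r) * (q / t)" for p q r t :: real by simp
        show ?thesis unfolding 2 3 alg1 1 alg2 ..
      qed
      moreover have "ennreal (2 * c powr (s - 2) * (y powr s / (1 + y\<^sup>2))) = ennreal (2 * c powr (s - 2)) * ennreal (y powr s / (1 + y\<^sup>2))"
        by (rule ennreal_mult') simp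
      ultimately show ?thesis using True c by simp
    qed (use c in \<open>auto simp: indicator_def zero_less_mult_iff\<close>)
  qed (use c in auto)
  also have "\<dots> = ennreal (c * (2 * c powr (s - 2))) * (\<integral>\<^sup>+y. ennreal (indicator {0<..} y * (y powr s / (1 + y\<^sup>2))) \<partial>lborel)"
    using c by (subst nn_integral_cmult) (auto simp: ennreal_mult' mult.assoc)
  also have "\<dots> = ennreal (c * (2 * c powr (s - 2)) * (pi / (2 * cos (pi * s / 2))))"
    by (subst nn_integral_powr_over_square[OF s], rule ennreal_mult'[symmetric]) (use c in simp)
  also have "c * (2 * c powr (s - 2)) * (pi / (2 * cos (pi * s / 2))) = (c * c powr (s - 2)) * (pi / cos (pi * s / 2))" by simp
  also have "c * c powr (s - 2) = c powr (s - 1)" using c powr_add[of c 1 "s - 2"] by simp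
  finally show ?thesis .
qed

text \<open>Real copy of \<open>trap\<close>: the two Mellin evaluations are compared in
  \<open>ennreal\<close>, so real terms with a sign are required.\<close>

definition rtrap :: "nat \<Rightarrow> real \<Rightarrow> real" where
  "rtrap n x = (x - 1) * (real n powr (-x) + real (Suc n) powr (-x)) / 2
     + real (Suc n) powr (1 - x) - real n powr (1 - x)"

lemma trap_of_real: "trap n (of_real x) = of_real (rtrap n x)"
proof -
  have "of_nat m powr of_real y = (of_real (real m powr y) :: complex)" for m y
    using powr_of_real[of "real m" y] by simp
  from this[of _ "-x"] this[of _ "1-x"] show ?thesis
    unfolding trap_def rtrap_def by (simp del: of_nat_Suc)
qed

text \<open>Continued with period 1, the weight u (1 - u) / 2 is minus half the second Bernoulli
  polynomial plus a constant. For n = 0 the power is singular at u = 0 and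
  \<open>trap_has_integral\<close> does not apply; the integrand then splits into two powers that
  are integrable because x < 0.\<close>

lemma bernoulli_integral:
  assumes x: "-1 < x" "x < 0"
  shows "((\<lambda>u. u * (1 - u) / 2 * (real n + u) powr (- x - 2)) has_integral
     (if n = 0 then 1 / (2 * x * (x - 1)) else rtrap n x / ((x - 1) * x * (x + 1)))) {0..1}"
proof (cases "n = 0")
  case True
  have "((\<lambda>u. 1/2 * (u powr (- x - 1) - u powr (- x))) has_integral
      1/2 * (1 powr (- x - 1 + 1) / (- x - 1 + 1) - 1 powr (- x + 1) / (- x + 1))) {0..1}"
    using x by (intro has_integral_mult_right has_integral_diff has_integral_powr_from_0) auto
  moreover have "1/2 * (1 powr (- x - 1 + 1) / (- x - 1 + 1) - 1 powr (- x + 1) / (- x + 1)) = 1 / (2 * x * (x - 1))"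
    using x by (simp add: divide_simps) (simp add: algebra_simps)?
  ultimately have "((\<lambda>u. 1/2 * (u powr (- x - 1) - u powr (- x))) has_integral 1 / (2 * x * (x - 1))) {0..1}" by (simp only:)
  also have "?this \<longleftrightarrow> ((\<lambda>u. u * (1 - u) / 2 * (real n + u) powr (- x - 2)) has_integral 1 / (2 * x * (x - 1))) {0..1}"
  proof (rule has_integral_cong)
    fix u :: real assume u: "u \<in> {0..1}"
    show "1/2 * (u powr (- x - 1) - u powr (- x)) = u * (1 - u) / 2 * (real n + u) powr (- x - 2)"
    proof (cases "u = 0")
      case False
      hence "u powr (- x - 1) = u powr (- x - 2) * u" "u powr (- x) = u powr (- x - 2) * u * u"
      proof -
        have e: "- x - 2 + 1 = - x - 1" "- x - 1 + 1 = - x" by simp_all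
        show 1: "u powr (- x - 1) = u powr (- x - 2) * u" using u powr_add[of u "-x-2" 1, unfolded e] by simp
        show "u powr (- x) = u powr (- x - 2) * u * u" using u powr_add[of u "-x-1" 1, unfolded e] 1 by simp
      qed
      thus ?thesis using True by (simp add: algebra_simps diff_divide_distrib)
    qed (use True in auto)
  qed
  finally show ?thesis using True by simp
next
  case False
  hence n: "n > 0" by simp
  have ne: "(x - 1) * x * (x + 1) \<noteq> 0" using x by simp
  from has_integral_linear[OF trap_has_integral[OF n, of "of_real x"] bounded_linear_Re]
  have "((\<lambda>u. Re (of_real (u * (1 - u) / 2) * ((of_real x - 1) * of_real x * (of_real x + 1)) * of_real (real n + u) powr (- of_real x - 2)))
     has_integral rtrap n x) {0..1}" by (simp add: o_def trap_of_real)
  also have "?this \<longleftrightarrow> ((\<lambda>u. ((x - 1) * x * (x + 1)) * (u * (1 - u) / 2 * (real n + u) powr (- x - 2))) has_integral rtrap n x) {0..1}"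
  proof (rule has_integral_cong)
    fix u :: real assume u: "u \<in> {0..1}"
    have "of_real (real n + u) powr (- of_real x - 2) = (of_real ((real n + u) powr (- x - 2)) :: complex)"
      using powr_of_real[of "real n + u" "- x - 2"] u by simp
    hence "of_real (u * (1 - u) / 2) * ((of_real x - 1) * of_real x * (of_real x + 1)) * of_real (real n + u) powr (- of_real x - 2)
      = (of_real (((x - 1) * x * (x + 1)) * (u * (1 - u) / 2 * (real n + u) powr (- x - 2))) :: complex)"
      by (simp only: of_real_mult of_real_add of_real_diff of_real_divide of_real_1 mult_ac)
    thus "Re (of_real (u * (1 - u) / 2) * ((of_real x - 1) * of_real x * (of_real x + 1)) * of_real (real n + u) powr (- of_real x - 2))
      = ((x - 1) * x * (x + 1)) * (u * (1 - u) / 2 * (real n + u) powr (- x - 2))"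
      by (simp only: Re_complex_of_real)
  qed
  finally have "((\<lambda>u. ((x - 1) * x * (x + 1)) * (u * (1 - u) / 2 * (real n + u) powr (- x - 2)) / ((x - 1) * x * (x + 1))) has_integral rtrap n x / ((x - 1) * x * (x + 1))) {0..1}"
    by (rule has_integral_divide)
  hence "((\<lambda>u. u * (1 - u) / 2 * (real n + u) powr (- x - 2)) has_integral rtrap n x / ((x - 1) * x * (x + 1))) {0..1}"
    by (simp only: nonzero_mult_div_cancel_left[OF ne])
  thus ?thesis using False by (simp only: if_False)
qed

lemma nn_integral_exp_kernel:
  assumes y: "y > 0"
  shows "(\<integral>\<^sup>+u. ennreal (indicator {0..1} u * (u * (1 - u) / 2 * exp (- u * y))) \<partial>lborel)
    = ennreal (((1 + exp (-y)) / 2 - (1 - exp (-y)) / y) / y\<^sup>2)"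
proof -
  \<comment> \<open>Primitive of the quadratic weight against the exponential, again by repeated
    integration by parts.\<close>
  define B where "B = (\<lambda>u. - exp (- u * y) * (u * (1 - u) / 2 / y + (1/2 - u) / y^2 - 1 / y^3))"
  have "((\<lambda>u. u * (1 - u) / 2 * exp (- u * y)) has_integral B 1 - B 0) {0..1}"
  proof (rule fundamental_theorem_of_calculus)
    fix u :: real
    have "(B has_real_derivative u * (1 - u) / 2 * exp (- u * y)) (at u within {0..1})"
      unfolding B_def using y
      by (auto intro!: derivative_eq_intros simp: field_simps power2_eq_square power3_eq_cube)
    thus "(B has_vector_derivative u * (1 - u) / 2 * exp (- u * y)) (at u within {0..1})"
      by (simp add: has_real_derivative_iff_has_vector_derivative)
  qed simp
  moreover have "B 1 - B 0 = ((1 + exp (-y)) / 2 - (1 - exp (-y)) / y) / y\<^sup>2"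
    using y by (simp add: B_def field_simps power2_eq_square power3_eq_cube)
  ultimately show ?thesis
    using nn_integral_has_integral_lebesgue[of "{0..1}" "\<lambda>u. u * (1 - u) / 2 * exp (- u * y)" "B 1 - B 0"] by simp
qed

text \<open>Each term is the Laplace transform of the weight u (1 - u) / 2 on one period, shifted by
  n. The geometric factor 1/(1 - exp(-y)) turns the single period into coth.\<close>

lemma coth_rem_geometric:
  assumes y: "y > 0"
  shows "(\<lambda>n. exp (- real n * y) * (((1 + exp (-y)) / 2 - (1 - exp (-y)) / y) / y\<^sup>2)) sums (coth_rem y / y\<^sup>2)"
proof -
  have "(\<lambda>n. exp (- y) ^ n) sums (1 / (1 - exp (- y)))" using y by (intro geometric_sums) auto
  hence "(\<lambda>n. exp (- real n * y)) sums (1 / (1 - exp (- y)))" by (simp add: exp_of_nat_mult[symmetric])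
  hence "(\<lambda>n. exp (- real n * y) * (((1 + exp (-y)) / 2 - (1 - exp (-y)) / y) / y\<^sup>2)) sums
     (1 / (1 - exp (- y)) * (((1 + exp (-y)) / 2 - (1 - exp (-y)) / y) / y\<^sup>2))"
    by (rule sums_mult2)
  also have "1 / (1 - exp (- y)) * (((1 + exp (-y)) / 2 - (1 - exp (-y)) / y) / y\<^sup>2) = coth_rem y / y\<^sup>2"
  proof -
    have E: "exp y > 1" using y by simp
    hence "1 / (1 - exp (- y)) * ((1 + exp (-y)) / 2 - (1 - exp (-y)) / y) = coth_rem y"
      using y unfolding coth_rem_def exp_minus by (simp add: divide_simps) (simp add: algebra_simps)?
    thus ?thesis by simp
  qed
  finally show ?thesis .
qed

lemma nn_integral_coth_rem_1:
  assumes x: "-1 < x" "x < 0"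
  shows "(\<integral>\<^sup>+y. ennreal (indicator {0<..} y * (y powr (x - 1) * coth_rem y)) \<partial>lborel) =
     (\<Sum>n. ennreal ((2 * pi * real (Suc n)) powr (x - 1) * (pi / cos (pi * x / 2))))"
proof -
  have "(\<integral>\<^sup>+y. ennreal (indicator {0<..} y * (y powr (x - 1) * coth_rem y)) \<partial>lborel) =
    (\<integral>\<^sup>+y. (\<Sum>n. ennreal (indicator {0<..} y * (y powr (x - 1) * (2 * y / (y\<^sup>2 + (2 * pi * real (Suc n))\<^sup>2))))) \<partial>lborel)"
  proof (rule nn_integral_cong)
    fix y :: real
    show "ennreal (indicator {0<..} y * (y powr (x - 1) * coth_rem y)) = (\<Sum>n. ennreal (indicator {0<..} y * (y powr (x - 1) * (2 * y / (y\<^sup>2 + (2 * pi * real (Suc n))\<^sup>2)))))"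
    proof (cases "y > 0")
      case True
      show ?thesis
        by (rule suminf_ennreal_eq[symmetric], use True in force)
          (intro sums_mult coth_rem_sums True)
    qed (auto simp: indicator_def)
  qed
  also have "\<dots> = (\<Sum>n. \<integral>\<^sup>+y. ennreal (indicator {0<..} y * (y powr (x - 1) * (2 * y / (y\<^sup>2 + (2 * pi * real (Suc n))\<^sup>2)))) \<partial>lborel)"
    by (rule nn_integral_suminf) measurable
  also have "\<dots> = (\<Sum>n. ennreal ((2 * pi * real (Suc n)) powr (x - 1) * (pi / cos (pi * x / 2))))"
    using x by (intro arg_cong[where f = suminf] ext nn_integral_coth_term) auto
  finally show ?thesis .
qed

text \<open>Two powers of y are moved from the monomial to \<open>coth_rem\<close>, which makes the
  latter a Laplace transform of the periodic weight. After Fubini the Gamma integral at x + 2 turns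
  exp(-(n + u) y) into the power of n + u that \<open>bernoulli_integral\<close> handles.\<close>

lemma nn_integral_coth_rem_2:
  assumes x: "-1 < x" "x < 0"
  shows "(\<integral>\<^sup>+y. ennreal (indicator {0<..} y * (y powr (x - 1) * coth_rem y)) \<partial>lborel) =
     (\<Sum>n. ennreal (Gamma (x + 2) * (if n = 0 then 1 / (2 * x * (x - 1)) else rtrap n x / ((x - 1) * x * (x + 1)))))"
proof -
  define K where "K = (\<lambda>y::real. ((1 + exp (-y)) / 2 - (1 - exp (-y)) / y) / y\<^sup>2)"
  define F where "F = (\<lambda>n u y. indicator {0<..} y * (y powr (x + 1) * exp (- real n * y)) * (indicator {0..1} u * (u * (1 - u) / 2 * exp (- u * y))) :: real)"
  have Fmeas: "(\<lambda>(u, y). ennreal (F n u y)) \<in> borel_measurable (lborel \<Otimes>\<^sub>M lborel)" for n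
    unfolding F_def by measurable
  \<comment> \<open>\<open>ennreal\<close> sends negative numbers to 0, so the sign of the kernel
    must be known before the series is moved there.\<close>
  have K0: "K y \<ge> 0" if y: "y > 0" for y
  proof -
    have "coth_rem y \<ge> 0" 
      by (rule sums_le[OF _ sums_zero coth_rem_sums[OF y]]) (use y in auto)
    moreover have "K y = (1 - exp (-y)) * (coth_rem y / y\<^sup>2)"
    proof -
      have "(\<lambda>n. exp (- y) ^ n) sums (1 / (1 - exp (- y)))" using y by (intro geometric_sums) auto
      hence "(\<lambda>n. exp (- real n * y)) sums (1 / (1 - exp (- y)))" by (simp add: exp_of_nat_mult[symmetric])
      hence "(\<lambda>n. exp (- real n * y) * K y) sums (1 / (1 - exp (- y)) * K y)" by (rule sums_mult2)
      hence "1 / (1 - exp (- y)) * K y = coth_rem y / y\<^sup>2"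
        using coth_rem_geometric[OF y] unfolding K_def by (rule sums_unique2)
      moreover have "1 - exp (-y) \<noteq> 0" using y by simp
      ultimately show ?thesis by (simp add: field_simps)
    qed
    ultimately show ?thesis using y by simp
  qed
  have "(\<integral>\<^sup>+y. ennreal (indicator {0<..} y * (y powr (x - 1) * coth_rem y)) \<partial>lborel) =
    (\<integral>\<^sup>+y. (\<Sum>n. ennreal (indicator {0<..} y * (y powr (x + 1) * (exp (- real n * y) * K y)))) \<partial>lborel)"
  proof (rule nn_integral_cong)
    fix y :: real
    show "ennreal (indicator {0<..} y * (y powr (x - 1) * coth_rem y)) = (\<Sum>n. ennreal (indicator {0<..} y * (y powr (x + 1) * (exp (- real n * y) * K y))))"
    proof (cases "y > 0")
      case True
      have eq: "y powr (x - 1) * coth_rem y = y powr (x + 1) * (coth_rem y / y\<^sup>2)"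
      proof -
        have e: "x - 1 + 2 = x + 1" by simp
        show ?thesis using True powr_add[of y "x - 1" 2, unfolded e] by simp
      qed
      show ?thesis unfolding eq
        by (rule suminf_ennreal_eq[symmetric], use True K0 in force)
          (unfold K_def, intro sums_mult coth_rem_geometric[OF True])
    qed (auto simp: indicator_def)
  qed
  also have "\<dots> = (\<Sum>n. \<integral>\<^sup>+y. ennreal (indicator {0<..} y * (y powr (x + 1) * (exp (- real n * y) * K y))) \<partial>lborel)"
    unfolding K_def by (rule nn_integral_suminf) measurable
  also have "\<dots> = (\<Sum>n. ennreal (Gamma (x + 2) * (if n = 0 then 1 / (2 * x * (x - 1)) else rtrap n x / ((x - 1) * x * (x + 1)))))"
  proof (intro arg_cong[where f = suminf] ext)
    fix n :: nat
    have "(\<integral>\<^sup>+y. ennreal (indicator {0<..} y * (y powr (x + 1) * (exp (- real n * y) * K y))) \<partial>lborel)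
      = (\<integral>\<^sup>+y. (\<integral>\<^sup>+u. ennreal (F n u y) \<partial>lborel) \<partial>lborel)"
    proof (rule nn_integral_cong)
      fix y :: real
      show "ennreal (indicator {0<..} y * (y powr (x + 1) * (exp (- real n * y) * K y))) = (\<integral>\<^sup>+u. ennreal (F n u y) \<partial>lborel)"
      proof (cases "y > 0")
        case True
        have "(\<integral>\<^sup>+u. ennreal (F n u y) \<partial>lborel) = (\<integral>\<^sup>+u. ennreal (indicator {0<..} y * (y powr (x + 1) * exp (- real n * y))) * ennreal (indicator {0..1} u * (u * (1 - u) / 2 * exp (- u * y))) \<partial>lborel)"
          unfolding F_def by (intro nn_integral_cong ennreal_mult') simp
        also have "\<dots> = ennreal (indicator {0<..} y * (y powr (x + 1) * exp (- real n * y))) * ennreal (K y)"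
          by (subst nn_integral_cmult, measurable) (simp only: nn_integral_exp_kernel[OF True] K_def)
        finally show ?thesis using True by (simp add: ennreal_mult'[symmetric] mult.assoc)
      qed (simp add: F_def)
    qed
    also have "\<dots> = (\<integral>\<^sup>+u. (\<integral>\<^sup>+y. ennreal (F n u y) \<partial>lborel) \<partial>lborel)"
      by (rule lborel_pair.Fubini'[OF Fmeas])
    also have "\<dots> = (\<integral>\<^sup>+u. ennreal (Gamma (x + 2)) * ennreal (indicator {0..1} u * (u * (1 - u) / 2 * (real n + u) powr (- x - 2))) \<partial>lborel)"
    proof (rule nn_integral_cong)
      fix u :: real
      show "(\<integral>\<^sup>+y. ennreal (F n u y) \<partial>lborel) = ennreal (Gamma (x + 2)) * ennreal (indicator {0..1} u * (u * (1 - u) / 2 * (real n + u) powr (- x - 2)))"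
      proof (cases "0 < u \<and> u \<le> 1")
        case True
        have "(\<integral>\<^sup>+y. ennreal (F n u y) \<partial>lborel) = (\<integral>\<^sup>+y. ennreal (u * (1 - u) / 2) * ennreal (indicator {0<..} y * (y powr ((x + 2) - 1) * exp (- (real n + u) * y))) \<partial>lborel)"
          unfolding F_def using True
          by (intro nn_integral_cong) (auto simp: indicator_def algebra_simps exp_add[symmetric] exp_diff ennreal_mult'[symmetric] exp_minus inverse_eq_divide)
        also have "\<dots> = ennreal (u * (1 - u) / 2) * ennreal (Gamma (x + 2) * (real n + u) powr (- (x + 2)))"
          using True x by (subst nn_integral_cmult, measurable, subst nn_integral_Gamma_kernel) auto
        finally show ?thesis using True x by (simp add: ennreal_mult'[symmetric] mult_ac)
      next
        case False
        hence "u = 0 \<or> u \<notin> {0..1}" by auto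
        hence "F n u y = 0" for y by (auto simp: F_def)
        thus ?thesis using False by (auto simp: indicator_def)
      qed
    qed
    also have "\<dots> = ennreal (Gamma (x + 2)) * ennreal (if n = 0 then 1 / (2 * x * (x - 1)) else rtrap n x / ((x - 1) * x * (x + 1)))"
      by (subst nn_integral_cmult, measurable)
        (subst nn_integral_has_integral_lebesgue[OF _ bernoulli_integral[OF x]], auto)
    also have "\<dots> = ennreal (Gamma (x + 2) * (if n = 0 then 1 / (2 * x * (x - 1)) else rtrap n x / ((x - 1) * x * (x + 1))))"
      using x by (intro ennreal_mult'[symmetric]) (simp add: Gamma_real_pos less_imp_le)
    finally show "(\<integral>\<^sup>+y. ennreal (indicator {0<..} y * (y powr (x + 1) * (exp (- real n * y) * K y))) \<partial>lborel)
      = ennreal (Gamma (x + 2) * (if n = 0 then 1 / (2 * x * (x - 1)) else rtrap n x / ((x - 1) * x * (x + 1))))" .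
  qed
  finally show ?thesis .
qed

lemma zeta_half_of_real:
  assumes x: "-1 < x"
  shows "zeta_half (of_real x) = of_real (1 + (x - 1) / 2 + (\<Sum>n. rtrap (Suc n) x))"
    and "summable (\<lambda>n. rtrap (Suc n) x)"
proof -
  have "summable (\<lambda>n. of_real (rtrap (Suc n) x) :: complex)"
    using summable_trap[of "of_real x"] x by (simp add: trap_of_real)
  thus sm: "summable (\<lambda>n. rtrap (Suc n) x)" by (simp only: summable_complex_of_real)
  show "zeta_half (of_real x) = of_real (1 + (x - 1) / 2 + (\<Sum>n. rtrap (Suc n) x))"
    unfolding zeta_half_def trap_of_real using suminf_of_real[OF sm, where 'a = complex] by simp
qed

text \<open>The two evaluations are equated. Gamma(x + 2) absorbs the factors x and x + 1 of D and
  leaves Gamma x; the reflection formula with the double angle formula for sin(pi x) then trades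
  Gamma x and the cosine for Gamma(1 - x) and the sine.\<close>

lemma zeta_functional_real:
  assumes x: "-1 < x" "x < 0"
  shows "zeta_half (of_real x) / (of_real x - 1) = of_real (2 * (2 * pi) powr (x - 1) * sin (pi * x / 2) * Gamma (1 - x) * (\<Sum>n. real (Suc n) powr (x - 1)))"
proof -
  define Z where "Z = (\<Sum>n. real (Suc n) powr (x - 1))"
  define D where "D = (x - 1) * x * (x + 1)"
  define h where "h = 1 + (x - 1) / 2 + (\<Sum>n. rtrap (Suc n) x)"
  define T where "T = (\<lambda>n. if n = 0 then 1 / (2 * x * (x - 1)) else rtrap n x / D)"
  have D0: "D \<noteq> 0" using x by (simp add: D_def)
  note sm = zeta_half_of_real(2)[OF x(1)]
  have smZ: "summable (\<lambda>n. real (Suc n) powr (x - 1))" using x by (intro summable_Suc_powr) auto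
  have cospos: "cos (pi * x / 2) > 0"
  proof (rule cos_gt_zero_pi)
    have "pi * x > pi * (-1)" using x by (intro mult_strict_left_mono) auto
    thus "- (pi / 2) < pi * x / 2" by simp
    have "pi * x < pi * 1" using x by (intro mult_strict_left_mono) auto
    thus "pi * x / 2 < pi / 2" by simp
  qed
  have T0: "T n \<ge> 0" for n
  proof -
    have "((\<lambda>u. u * (1 - u) / 2 * (real n + u) powr (- x - 2)) has_integral T n) {0..1}"
      using bernoulli_integral[OF x, of n] unfolding T_def D_def .
    thus ?thesis by (rule has_integral_nonneg) auto
  qed
  have Gpos: "Gamma (x + 2) > 0" using x by (intro Gamma_real_pos) auto
  have "(\<lambda>n. rtrap (Suc n) x / D) sums ((\<Sum>n. rtrap (Suc n) x) / D)"
    by (intro sums_divide summable_sums sm)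
  hence "(\<lambda>n. T (Suc n)) sums ((\<Sum>n. rtrap (Suc n) x) / D)" by (simp add: T_def)
  hence "T sums ((\<Sum>n. rtrap (Suc n) x) / D + T 0)" by (simp only: sums_Suc_iff)
  \<comment> \<open>The integral over the singular first interval supplies exactly the terms 1 + (x
    - 1)/2 that stand outside the sum in \<open>zeta_half\<close>.\<close>
  also have "(\<Sum>n. rtrap (Suc n) x) / D + T 0 = h / D"
  proof -
    have "T 0 = (1 + (x - 1) / 2) / D" using x by (simp add: T_def D_def divide_simps) (simp add: algebra_simps)?
    thus ?thesis by (simp add: h_def add_divide_distrib)
  qed
  finally have Ts: "T sums (h / D)" .
  hence "(\<lambda>n. Gamma (x + 2) * T n) sums (Gamma (x + 2) * (h / D))" by (rule sums_mult)
  hence e1: "(\<Sum>n. ennreal (Gamma (x + 2) * T n)) = ennreal (Gamma (x + 2) * (h / D))"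
    using T0 Gpos by (intro suminf_ennreal_eq) auto
  have hD: "h / D \<ge> 0"
    using sums_le[OF _ sums_zero Ts] T0 by auto
  have powm: "(2 * pi * real (Suc n)) powr (x - 1) = (2 * pi) powr (x - 1) * real (Suc n) powr (x - 1)" for n
    by (rule powr_mult)
  have "(\<lambda>n. (2 * pi * real (Suc n)) powr (x - 1) * (pi / cos (pi * x / 2))) sums ((2 * pi) powr (x - 1) * Z * (pi / cos (pi * x / 2)))"
    unfolding powm Z_def by (intro sums_mult sums_mult2 summable_sums smZ)
  hence e2: "(\<Sum>n. ennreal ((2 * pi * real (Suc n)) powr (x - 1) * (pi / cos (pi * x / 2)))) = ennreal ((2 * pi) powr (x - 1) * Z * (pi / cos (pi * x / 2)))"
    using cospos by (intro suminf_ennreal_eq) auto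
  have Z0: "Z \<ge> 0" unfolding Z_def by (intro suminf_nonneg smZ) auto
  have "ennreal (Gamma (x + 2) * (h / D)) = ennreal ((2 * pi) powr (x - 1) * Z * (pi / cos (pi * x / 2)))"
    using nn_integral_coth_rem_1[OF x] nn_integral_coth_rem_2[OF x] e1 e2 unfolding T_def D_def by simp
  moreover have "Gamma (x + 2) * (h / D) \<ge> 0" using Gpos hD by (intro mult_nonneg_nonneg) auto
  moreover have "(2 * pi) powr (x - 1) * Z * (pi / cos (pi * x / 2)) \<ge> 0" using Z0 cospos by simp
  ultimately have eq: "Gamma (x + 2) * (h / D) = (2 * pi) powr (x - 1) * Z * (pi / cos (pi * x / 2))"
    by (subst (asm) ennreal_inj)
  have Gx: "Gamma (x + 2) = (x + 1) * (x * Gamma x)"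
  proof -
    have ni: "x \<notin> \<int>\<^sub>\<le>\<^sub>0" "x + 1 \<notin> \<int>\<^sub>\<le>\<^sub>0"
    proof -
      have no: False if "-1 < y" "y < 0" "y = of_int k" for k :: int and y :: real
      proof -
        have "real_of_int (-1) < of_int k" "real_of_int k < of_int 0" using that by simp_all
        hence "-1 < k" "k < 0" by (simp_all only: of_int_less_iff)
        thus False by simp
      qed
      have False if "x = of_int k" for k :: int using no[OF x that] .
      moreover have False if "x + 1 = of_int k" for k :: int using no[of x "k - 1"] x that by simp
      ultimately show "x \<notin> \<int>\<^sub>\<le>\<^sub>0" "x + 1 \<notin> \<int>\<^sub>\<le>\<^sub>0" by (auto elim!: nonpos_Ints_cases)
    qed
    have "Gamma (x + 2) = Gamma ((x + 1) + 1)" by (simp add: algebra_simps)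
    thus ?thesis using Gamma_plus1[OF ni(2)] Gamma_plus1[OF ni(1)] by simp
  qed
  have refl: "Gamma x * Gamma (1 - x) = pi / sin (pi * x)"
  proof -
    have "complex_of_real (Gamma x * Gamma (1 - x)) = Gamma (of_real x) * Gamma (1 - of_real x)"
      using Gamma_complex_of_real[of x] Gamma_complex_of_real[of "1 - x"] by simp
    also have "\<dots> = of_real (pi / sin (pi * x))"
      by (subst Gamma_reflection_complex) (simp only: sin_of_real of_real_mult[symmetric] of_real_divide)
    finally show ?thesis by (simp only: of_real_eq_iff)
  qed
  have sin2: "sin (pi * x) = 2 * sin (pi * x / 2) * cos (pi * x / 2)"
    using sin_double[of "pi * x / 2"] by simp
  have G1: "Gamma (1 - x) > 0" using x by (intro Gamma_real_pos) auto
  have sneg: "sin (pi * x / 2) \<noteq> 0"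
  proof -
    have "sin (- (pi * x / 2)) > 0"
    proof (rule sin_gt_zero)
      have "pi * x < pi * 0" using x by (intro mult_strict_left_mono) auto
      thus "0 < - (pi * x / 2)" by simp
      have "pi * x > pi * (-2)" using x by (intro mult_strict_left_mono) auto
      thus "- (pi * x / 2) < pi" by simp
    qed
    thus ?thesis by simp
  qed
  have xs: "x \<noteq> 0" "x + 1 \<noteq> 0" "x - 1 \<noteq> 0" using x by auto
  have Gx0: "Gamma x \<noteq> 0"
    using refl sin2 sneg cospos by auto
  have "Gamma x * (h / (x - 1)) = Gamma (x + 2) * (h / D)"
  proof -
    have "c * (b * G) * (h / (a * b * c)) = G * (h / a)" if "b \<noteq> 0" "c \<noteq> 0" for a b c G :: real
      using that by (simp add: field_simps)
    thus ?thesis unfolding Gx D_def using xs by metis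
  qed
  hence "Gamma x * (h / (x - 1)) = (2 * pi) powr (x - 1) * Z * (pi / cos (pi * x / 2))" using eq by simp
  moreover have "pi / cos (pi * x / 2) = 2 * sin (pi * x / 2) * (Gamma x * Gamma (1 - x))"
    unfolding refl sin2 using sneg by simp
  ultimately have "Gamma x * (h / (x - 1)) = Gamma x * (2 * (2 * pi) powr (x - 1) * sin (pi * x / 2) * Gamma (1 - x) * Z)"
    by (simp only: mult_ac)
  hence "h / (x - 1) = 2 * (2 * pi) powr (x - 1) * sin (pi * x / 2) * Gamma (1 - x) * Z"
    using Gx0 by (simp only: mult_cancel_left simp_thms)
  thus ?thesis unfolding zeta_half_of_real(1)[OF x(1)] Z_def[symmetric] h_def[symmetric]
    by (metis of_real_1 of_real_diff of_real_divide)
qed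

section \<open>The factor chi and the continuation to the punctured plane\<close>

definition chi :: "complex \<Rightarrow> complex" where
  "chi s = 2 * (of_real (2 * pi)) powr (s - 1) * sin (of_real pi * s / 2) * Gamma (1 - s)"

lemma holomorphic_on_chi: "chi holomorphic_on {s. Re s < 1}"
proof -
  have "1 - s \<notin> \<int>\<^sub>\<le>\<^sub>0" if "Re s < 1" for s
    using that by (auto elim!: nonpos_Ints_cases simp: complex_eq_iff)
  thus ?thesis unfolding chi_def[abs_def]
    by (intro holomorphic_intros) auto
qed

lemma chi_of_real:
  "chi (of_real x) = of_real (2 * (2 * pi) powr (x - 1) * sin (pi * x / 2) * Gamma (1 - x))"
proof -
  have "of_real (2 * pi) powr (of_real x - 1) = (of_real ((2 * pi) powr (x - 1)) :: complex)"
    using powr_of_real[of "2 * pi" "x - 1"] by simp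
  moreover have "sin (of_real pi * of_real x / 2) = (of_real (sin (pi * x / 2)) :: complex)"
    by (simp flip: sin_of_real)
  moreover have "Gamma (1 - of_real x) = (of_real (Gamma (1 - x)) :: complex)"
    using Gamma_complex_of_real[of "1 - x"] by simp
  ultimately show ?thesis unfolding chi_def by simp
qed

text \<open>Identity theorem: both sides are holomorphic in the strip and agree on its real segment,
  which accumulates at -1/2.\<close>

lemma zeta_functional_strip:
  assumes s: "-1 < Re s" "Re s < 0"
  shows "zeta_half s / (s - 1) = chi s * (zeta_half (1 - s) / (- s))"
proof -
  define S where "S = {s::complex. -1 < Re s} \<inter> {s. Re s < 0}"
  have S: "open S" "connected S"
    unfolding S_def by (auto intro!: open_Int convex_connected convex_Int
        open_halfspace_Re_lt open_halfspace_Re_gt convex_halfspace_Re_lt convex_halfspace_Re_gt)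
  have lp: "complex_of_real (-1/2) islimpt complex_of_real ` {-1<..<0}"
  proof (rule islimpt_isCont_image)
    show "(-1/2::real) islimpt {-1<..<0}"
      by (rule interior_limit_point) (simp add: interior_open)
    show "isCont complex_of_real (-1/2)" by (intro continuous_intros)
    show "\<forall>\<^sub>F y in at (-1/2). complex_of_real y \<noteq> complex_of_real (-1/2)"
      by (simp only: of_real_eq_iff eventually_neq_at_within)
  qed
  have "zeta_half s / (s - 1) - chi s * (zeta_half (1 - s) / (- s)) = 0"
  proof (rule analytic_continuation[OF _ S, of _ "complex_of_real ` {-1<..<0}" "complex_of_real (-1/2)" s])
    have h1: "zeta_half holomorphic_on S" by (rule holomorphic_on_subset[OF holomorphic_on_zeta_half]) (auto simp: S_def)
    have h2: "chi holomorphic_on S" by (rule holomorphic_on_subset[OF holomorphic_on_chi]) (auto simp: S_def)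
    have h3: "(zeta_half \<circ> (\<lambda>s. 1 - s)) holomorphic_on S"
      by (intro holomorphic_on_compose holomorphic_intros holomorphic_on_subset[OF holomorphic_on_zeta_half]) (auto simp: S_def)
    show "(\<lambda>s. zeta_half s / (s - 1) - chi s * (zeta_half (1 - s) / (- s))) holomorphic_on S"
      using h3 by (intro holomorphic_intros h1 h2) (auto simp: S_def o_def)
    show "complex_of_real ` {-1<..<0} \<subseteq> S" "complex_of_real (-1/2) \<in> S" "s \<in> S"
      using s by (auto simp: S_def)
    show "complex_of_real (-1/2) islimpt complex_of_real ` {-1<..<0}" by (rule lp)
    fix z assume "z \<in> complex_of_real ` {-1<..<0}"
    then obtain x where x: "z = of_real x" "-1 < x" "x < 0" by auto
    define Z where "Z = (\<Sum>n. real (Suc n) powr (x - 1))"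
    have smZ: "summable (\<lambda>n. real (Suc n) powr (x - 1))" using x by (intro summable_Suc_powr) auto
    have "zeta_half (1 - z) = - z * (\<Sum>n. 1 / of_nat (Suc n) powr (1 - z))"
      using x by (subst zeta_half_eq) auto
    also have "(\<lambda>n. 1 / of_nat (Suc n) powr (1 - z)) = (\<lambda>n. of_real (real (Suc n) powr (x - 1)))"
    proof
      fix n
      have "of_nat (Suc n) powr (1 - z) = of_real (real (Suc n) powr (1 - x))"
        using powr_of_real[of "real (Suc n)" "1 - x"] x(1) by (simp del: of_nat_Suc)
      moreover have "real (Suc n) powr (x - 1) = 1 / real (Suc n) powr (1 - x)"
        using powr_minus_divide[of "real (Suc n)" "1 - x"] by simp
      ultimately show "1 / of_nat (Suc n) powr (1 - z) = of_real (real (Suc n) powr (x - 1))" by simp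
    qed
    also have "(\<Sum>n. complex_of_real (real (Suc n) powr (x - 1))) = of_real Z"
      unfolding Z_def by (rule suminf_of_real[OF smZ, symmetric])
    finally have "zeta_half (1 - z) / (- z) = of_real Z" using x by simp
    moreover have "zeta_half z / (z - 1) = chi z * of_real Z"
      unfolding x(1) zeta_functional_real[OF x(2,3)] chi_of_real Z_def by simp
    ultimately show "zeta_half z / (z - 1) - chi z * (zeta_half (1 - z) / (- z)) = 0" by simp
  qed
  thus ?thesis by (rule right_minus_eq[THEN iffD1])
qed

text \<open>The two formulas overlap in -1 < Re s < 0, where \<open>zeta_functional_strip\<close>
  reconciles them. The value at 1 follows the convention built into
  \<open>riemann_zeta\<close>.\<close>

definition zeta_glued :: "complex \<Rightarrow> complex" where
  "zeta_glued s = (if Re s > -1 then if s = 1 then 0 else zeta_half s / (s - 1) else chi s * (zeta_half (1 - s) / (- s)))"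

lemma zeta_glued_left:
  assumes "Re s < 0" 
  shows "zeta_glued s = chi s * (zeta_half (1 - s) / (- s))"
  using assms zeta_functional_strip[of s] by (auto simp: zeta_glued_def)

lemma holomorphic_on_zeta_glued: "zeta_glued holomorphic_on (UNIV - {1})"
proof -
  have "zeta_glued holomorphic_on ({s. Re s > -1} - {1}) \<union> {s. Re s < 0}"
  proof (rule holomorphic_on_Un)
    have "(\<lambda>s. zeta_half s / (s - 1)) holomorphic_on {s. Re s > -1} - {1}"
      by (intro holomorphic_intros holomorphic_on_subset[OF holomorphic_on_zeta_half]) auto
    thus "zeta_glued holomorphic_on {s. Re s > -1} - {1}"
      by (rule holomorphic_transform) (auto simp: zeta_glued_def)
    have "(zeta_half \<circ> (\<lambda>s. 1 - s)) holomorphic_on {s. Re s < 0}"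
      by (intro holomorphic_on_compose holomorphic_intros holomorphic_on_subset[OF holomorphic_on_zeta_half]) auto
    hence "(\<lambda>s. chi s * (zeta_half (1 - s) / (- s))) holomorphic_on {s. Re s < 0}"
      by (intro holomorphic_intros holomorphic_on_subset[OF holomorphic_on_chi]) (auto simp: o_def)
    thus "zeta_glued holomorphic_on {s. Re s < 0}"
      by (rule holomorphic_transform) (auto simp: zeta_glued_left)
    show "open ({s. Re s > -1} - {1::complex})" "open {s. Re s < 0}"
      by (auto intro!: open_Diff open_halfspace_Re_lt open_halfspace_Re_gt)
  qed
  moreover have "({s. Re s > -1} - {1}) \<union> {s. Re s < 0} = UNIV - {1::complex}" by auto
  ultimately show ?thesis by metis
qed

text \<open>The description is unique because any candidate agrees with the glued function on the
  open half plane of the Dirichlet series, and the punctured plane is connected.\<close>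

lemma riemann_zeta_eq: "riemann_zeta = zeta_glued"
  unfolding riemann_zeta_def
proof (rule the_equality)
  show *: "zeta_glued holomorphic_on UNIV - {1} \<and> zeta_glued 1 = 0 \<and>
    (\<forall>s. 1 < Re s \<longrightarrow> zeta_glued s = (\<Sum>n. 1 / of_nat (Suc n) powr s))"
  proof (intro conjI allI impI)
    fix s assume "1 < Re s"
    moreover from this have "s \<noteq> 1" by auto
    ultimately show "zeta_glued s = (\<Sum>n. 1 / of_nat (Suc n) powr s)"
      by (simp add: zeta_glued_def zeta_half_eq del: of_nat_Suc)
  qed (use holomorphic_on_zeta_glued in \<open>auto simp: zeta_glued_def\<close>)
  fix f :: "complex \<Rightarrow> complex"
  assume f: "f holomorphic_on UNIV - {1} \<and> f 1 = 0 \<and> (\<forall>s. 1 < Re s \<longrightarrow> f s = (\<Sum>n. 1 / of_nat (Suc n) powr s))"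
  show "f = zeta_glued"
  proof
    fix s show "f s = zeta_glued s"
    proof (cases "s = 1")
      case True thus ?thesis using f * by simp
    next
      case False
      show ?thesis
      proof (rule analytic_continuation_open[of "{s. Re s > 1}" "UNIV - {1}" f zeta_glued s])
        show "open {s. 1 < Re s}" by (rule open_halfspace_Re_gt)
        show "{s. 1 < Re s} \<noteq> {}" by (auto intro!: exI[of _ "of_real 2"])
        have "connected (- {1::complex})" by (rule connected_punctured_universe) simp
        thus "connected (UNIV - {1::complex})" by (simp add: Compl_eq_Diff_UNIV)
        show "f z = zeta_glued z" if "z \<in> {s. 1 < Re s}" for z using f * that by simp
      qed (use f * False in auto)
    qed
  qed
qed

lemma holomorphic_on_riemann_zeta: "riemann_zeta holomorphic_on (UNIV - {1})"
  unfolding riemann_zeta_eq by (rule holomorphic_on_zeta_glued)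

lemma riemann_zeta_dirichlet: "1 < Re s \<Longrightarrow> riemann_zeta s = (\<Sum>n. 1 / of_nat (Suc n) powr s)"
proof -
  assume s: "1 < Re s"
  hence "s \<noteq> 1" by auto
  with s show ?thesis by (simp add: riemann_zeta_eq zeta_glued_def zeta_half_eq del: of_nat_Suc)
qed

lemma riemann_zeta_half: "-1 < Re s \<Longrightarrow> s \<noteq> 1 \<Longrightarrow> riemann_zeta s = zeta_half s / (s - 1)"
  by (simp add: riemann_zeta_eq zeta_glued_def)

lemma riemann_zeta_functional: "Re s < 0 \<Longrightarrow> riemann_zeta s = chi s * riemann_zeta (1 - s)"
proof -
  assume s: "Re s < 0"
  hence "s \<noteq> 0" by auto
  with s show ?thesis using zeta_glued_left[OF s] riemann_zeta_half[of "1 - s"]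
    by (simp add: riemann_zeta_eq)
qed

section \<open>The factor of the functional equation\<close>

text \<open>First order Taylor expansion along the segment from w to w + 1. Moving right from a
  point with positive real part increases the modulus, so the second derivative is largest at
  w.\<close>

lemma norm_Ln_succ_le:
  assumes w: "Re w > 0"
  shows "norm (Ln (w + 1) - Ln w - 1 / w) \<le> 1 / (norm w)\<^sup>2"
proof -
  define f where "f = (\<lambda>(k::nat) v::complex. if k = 0 then Ln v else if k = 1 then 1 / v else - 1 / v\<^sup>2)"
  define S where "S = closed_segment w (w + 1)"
  have S: "Re v \<ge> Re w \<and> Im v = Im w" if "v \<in> S" for v
    using that by (auto simp: S_def closed_segment_def algebra_simps)
  have nv: "norm v \<ge> norm w" if "v \<in> S" for v
  proof -
    have "(Re w)\<^sup>2 \<le> (Re v)\<^sup>2" using S[OF that] w by (intro power_mono) auto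
    thus ?thesis using S[OF that] by (simp add: cmod_def)
  qed
  have "norm (f 0 (w + 1) - (\<Sum>i\<le>1. f i w * (w + 1 - w) ^ i / fact i)) \<le> 1 / (norm w)\<^sup>2 * norm (w + 1 - w) ^ Suc 1 / fact 1"
  proof (rule complex_Taylor[of S])
    show "convex S" by (simp add: S_def)
    show "w \<in> S" "w + 1 \<in> S" by (auto simp: S_def)
    fix v assume v: "v \<in> S"
    have v0: "v \<noteq> 0" and vn: "v \<notin> \<real>\<^sub>\<le>\<^sub>0" using S[OF v] w by (auto simp: complex_nonpos_Reals_iff)
    show "(f i has_field_derivative f (Suc i) v) (at v within S)" if "i \<le> 1" for i
    proof -
      have "i = 0 \<or> i = 1" using that by auto
      thus ?thesis
      proof
        assume "i = 0" thus ?thesis using vn v0 by (auto simp: f_def intro!: derivative_eq_intros has_field_derivative_at_within[OF has_field_derivative_Ln] simp: inverse_eq_divide)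
      next
        assume "i = 1" thus ?thesis using v0 by (auto simp: f_def intro!: derivative_eq_intros simp: power2_eq_square)
      qed
    qed
    have "(norm w)\<^sup>2 \<le> (norm v)\<^sup>2" using nv[OF v] by (intro power_mono) auto
    moreover have "(norm w)\<^sup>2 > 0" using w by (auto simp: complex_eq_iff)
    ultimately show "norm (f (Suc 1) v) \<le> 1 / (norm w)\<^sup>2"
      using v0 by (simp add: f_def norm_divide norm_power frac_le)
  qed
  thus ?thesis by (simp add: f_def diff_diff_eq)
qed

text \<open>\<open>Digamma\<close> is a limit of ln m minus a sum of reciprocals, and the
  differences of \<open>Ln\<close> telescope to the same logarithm. With A = Re z + |Im z| the
  modulus of z + n is at least (A + n) / sqrt 2, and (A + n)^2 >= (A + n - 1/2)(A + n + 1/2) makes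
  the error terms telescope as well.\<close>

lemma norm_Digamma_minus_Ln_le:
  assumes z: "Re z \<ge> 1/2" "Im z \<noteq> 0"
  shows "norm (Digamma z - Ln z) \<le> 2 / (Re z + \<bar>Im z\<bar> - 1/2)"
proof -
  define A where "A = Re z + \<bar>Im z\<bar>"
  have A: "A > 1/2" using z by (simp add: A_def)
  have z0: "z \<noteq> 0" using z by auto
  have term_le: "norm (Ln (z + of_nat (Suc n)) - Ln (z + of_nat n) - 1 / (z + of_nat n)) \<le> 2 * (1 / (A + real n - 1/2) - 1 / (A + real (Suc n) - 1/2))" for n
  proof -
    define w where "w = z + of_nat n"
    have w: "Re w = Re z + real n" "Im w = Im z" by (auto simp: w_def)
    have "(A + real n)\<^sup>2 \<le> 2 * (norm w)\<^sup>2"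
    proof -
      have "2 * (norm w)\<^sup>2 - (A + real n)\<^sup>2 = (Re w - \<bar>Im w\<bar>)\<^sup>2"
        unfolding cmod_power2 A_def w by (simp add: power2_eq_square algebra_simps)
      thus ?thesis using zero_le_power2[of "Re w - \<bar>Im w\<bar>"] by linarith
    qed
    moreover have "(A + real n)\<^sup>2 > 0" using A by simp
    ultimately have "1 / (norm w)\<^sup>2 \<le> 2 / (A + real n)\<^sup>2" 
      by (simp add: divide_simps mult.commute split: if_splits)
    also have "\<dots> \<le> 2 / ((A + real n - 1/2) * (A + real n + 1/2))"
    proof (rule divide_left_mono)
      show "(A + real n - 1/2) * (A + real n + 1/2) \<le> (A + real n)\<^sup>2" by (simp add: power2_eq_square algebra_simps)
      show "0 < (A + real n)\<^sup>2 * ((A + real n - 1 / 2) * (A + real n + 1 / 2))" using A by simp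
    qed simp
    also have "\<dots> = 2 * (1 / (A + real n - 1/2) - 1 / (A + real n + 1/2))"
    proof -
      have "2 / (p * (p + 1)) = 2 * (1 / p - 1 / (p + 1))" if "p > 0" for p :: real
        using that by (simp add: field_simps)
      moreover have "A + real n - 1/2 + 1 = A + real n + 1/2" by simp
      moreover have "A + real n - 1/2 > 0" using A by simp
      ultimately show ?thesis by metis
    qed
    also have "A + real n + 1/2 = A + real (Suc n) - 1/2" by simp
    finally have "1 / (norm w)\<^sup>2 \<le> 2 * (1 / (A + real n - 1/2) - 1 / (A + real (Suc n) - 1/2))" .
    moreover have "norm (Ln (w + 1) - Ln w - 1 / w) \<le> 1 / (norm w)\<^sup>2"
      using z w by (intro norm_Ln_succ_le) auto
    ultimately show ?thesis by (simp add: w_def add_ac)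
  qed
  define d where "d = (\<lambda>m. Ln (z + of_nat m) - Ln z - (\<Sum>n<m. 1 / (z + of_nat n)))"
  have dle: "norm (d m) \<le> 2 / (A - 1/2)" for m
  proof -
    have "d m = (\<Sum>n<m. Ln (z + of_nat (Suc n)) - Ln (z + of_nat n) - 1 / (z + of_nat n))"
      unfolding sum_subtractf[of _ "\<lambda>n. 1 / (z + of_nat n)"] sum_lessThan_telescope[of "\<lambda>n. Ln (z + of_nat n)"]
      by (simp add: d_def)
    also have "norm \<dots> \<le> (\<Sum>n<m. 2 * (1 / (A + real n - 1/2) - 1 / (A + real (Suc n) - 1/2)))"
      by (intro sum_norm_le term_le)
    also have "\<dots> = 2 * (1 / (A - 1/2) - 1 / (A + real m - 1/2))"
      by (induction m) (auto simp: algebra_simps)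
    also have "\<dots> \<le> 2 / (A - 1/2)" using A by simp
    finally show ?thesis .
  qed
  have lim1: "(\<lambda>m. of_real (ln (real m)) - Ln (z + of_nat m)) \<longlonglongrightarrow> 0"
  proof -
    have "(\<lambda>m. 1 + z / of_nat m) \<longlonglongrightarrow> 1 + 0"
      by (intro tendsto_intros tendsto_divide_0[OF tendsto_const] tendsto_of_nat)
    hence "(\<lambda>m. - Ln (1 + z / of_nat m)) \<longlonglongrightarrow> - Ln (1 + 0)"
      by (intro tendsto_intros) auto
    moreover have "eventually (\<lambda>m. - Ln (1 + z / of_nat m) = of_real (ln (real m)) - Ln (z + of_nat m)) sequentially"
    proof (rule eventually_mono[OF eventually_gt_at_top[of 0]])
      fix m :: nat assume m: "m > 0"
      have "1 + z / of_nat m \<noteq> 0" using z m by (auto simp: complex_eq_iff)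
      hence "Ln (of_real (real m) * (1 + z / of_nat m)) = of_real (ln (real m)) + Ln (1 + z / of_nat m)"
        using m Ln_times_of_real[of "real m" "1 + z / of_nat m"] by simp
      moreover have "of_real (real m) * (1 + z / of_nat m) = z + of_nat m" using m by (simp add: field_simps)
      ultimately show "- Ln (1 + z / of_nat m) = of_real (ln (real m)) - Ln (z + of_nat m)" by simp
    qed
    ultimately show ?thesis using tendsto_cong by fastforce
  qed
  have "(\<lambda>m. (of_real (ln (real m)) - (\<Sum>n<m. inverse (z + of_nat n))) - (of_real (ln (real m)) - Ln (z + of_nat m)) - Ln z) \<longlonglongrightarrow> Digamma z - 0 - Ln z"
    by (intro tendsto_intros Digamma_LIMSEQ z0 lim1)
  hence "d \<longlonglongrightarrow> Digamma z - Ln z"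
    by (simp add: d_def[abs_def] inverse_eq_divide algebra_simps)
  hence "(\<lambda>m. norm (d m)) \<longlonglongrightarrow> norm (Digamma z - Ln z)" by (rule tendsto_norm)
  thus ?thesis unfolding A_def[symmetric] by (rule Lim_bounded) (use dle in auto)
qed

text \<open>With a = exp(i w) and b = 1/a the left side is the modulus of 2 i a / (a - b). It decays
  exponentially; 1 + x <= exp x already gives the weaker bound that is wanted.\<close>

lemma norm_cot_add_ii_le:
  assumes t: "Im w > 0"
  shows "norm (cot w + \<i>) \<le> 1 / Im w"
proof -
  define a where "a = exp (\<i> * w)"
  define b where "b = exp (- (\<i> * w))"
  define v where "v = Im w"
  have na: "norm a = exp (- v)" and nb: "norm b = exp v" by (auto simp: a_def b_def v_def)
  have ab: "a * b = 1" by (simp add: a_def b_def flip: exp_add)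
  have v: "v > 0" using t by (simp add: v_def)
  have gt: "exp v - exp (- v) \<ge> 2 * v * exp (- v)"
  proof -
    have "1 + 2 * v \<le> exp (2 * v)" by (rule exp_ge_add_one_self)
    hence "(1 + 2 * v) * exp (- v) \<le> exp (2 * v) * exp (- v)" by (intro mult_right_mono) auto
    also have "\<dots> = exp v" by (simp flip: exp_add)
    finally show ?thesis by (simp add: algebra_simps)
  qed
  have ge: "norm (a - b) \<ge> 2 * v * exp (- v)"
    using norm_triangle_ineq2[of b a] gt unfolding na nb by (simp add: norm_minus_commute)
  have pos: "2 * v * exp (- v) > 0" using v by simp
  have ne: "a - b \<noteq> 0" using ge pos by auto
  have "cot w + \<i> = 2 * \<i> * a / (a - b)"
  proof -
    have "cot w = \<i> * (a + b) / (a - b)"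
    proof -
      have "(a + b) / 2 / ((a - b) / (2*\<i>)) = \<i> * (a + b) / (a - b)" using ne by (simp only: divide_divide_eq_right) simp
      thus ?thesis unfolding cot_def sin_exp_eq cos_exp_eq a_def b_def .
    qed
    thus ?thesis using ne by (simp add: field_simps)
  qed
  hence "norm (cot w + \<i>) = 2 * exp (- v) / norm (a - b)" by (simp add: norm_divide norm_mult na)
  also have "\<dots> \<le> 2 * exp (- v) / (2 * v * exp (- v))"
    using ge pos v less_le_trans[OF pos ge] by (intro divide_left_mono mult_pos_pos) auto
  also have "\<dots> = 1 / v" by simp
  finally show ?thesis by (simp add: v_def)
qed

text \<open>The logarithmic derivative of \<open>chi\<close>.\<close>
definition chi_ld :: "complex \<Rightarrow> complex" where
  "chi_ld s = of_real (ln (2 * pi)) + of_real (pi / 2) * cot (of_real pi * s / 2) - Digamma (1 - s)"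

lemma sin_half_pi_nonzero: "Im s > 0 \<Longrightarrow> sin (of_real pi * s / 2) \<noteq> 0"
proof
  assume s: "Im s > 0" and "sin (of_real pi * s / 2) = 0"
  then obtain n :: int where n: "of_real pi * s / 2 = of_real (of_int n * pi)" by (auto simp: sin_eq_0)
  from arg_cong[OF n, of Im] have "pi * Im s / 2 = 0" by simp
  thus False using s by simp
qed

lemma one_minus_notin_nonpos_Ints: "Re s < 1 \<Longrightarrow> 1 - s \<notin> \<int>\<^sub>\<le>\<^sub>0"
  by (auto elim!: nonpos_Ints_cases simp: complex_eq_iff)

lemma chi_nonzero: "Re s < 1 \<Longrightarrow> Im s > 0 \<Longrightarrow> chi s \<noteq> 0"
  using one_minus_notin_nonpos_Ints[of s] sin_half_pi_nonzero[of s]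
  by (auto simp: chi_def Gamma_eq_zero_iff)

lemma has_field_derivative_chi:
  assumes "Re s < 1" "Im s > 0"
  shows "(chi has_field_derivative chi s * chi_ld s) (at s)"
proof -
  have nz: "sin (of_real pi * s / 2) \<noteq> 0" and ni: "1 - s \<notin> \<int>\<^sub>\<le>\<^sub>0"
    using assms sin_half_pi_nonzero one_minus_notin_nonpos_Ints by auto
  define P where "P = (of_real (2 * pi) powr (s - 1) :: complex)"
  define G where "G = Gamma (1 - s)"
  define S where "S = sin (of_real pi * s / 2)"
  define C where "C = cos (of_real pi * s / 2)"
  have Ln2pi: "Ln (of_real (2 * pi)) = of_real (ln (2 * pi))" by (rule Ln_of_real) simp
  have d1: "((\<lambda>s. of_real (2 * pi) powr (s - 1)) has_field_derivative P * of_real (ln (2 * pi))) (at s)"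
  proof -
    have "((\<lambda>s. exp ((s - 1) * a)) has_field_derivative exp ((s - 1) * a) * a) (at s)" for a :: complex
      by (auto intro!: derivative_eq_intros)
    moreover have "of_real (2 * pi) powr z = exp (z * of_real (ln (2 * pi)))" for z :: complex
      unfolding Ln2pi[symmetric] by (simp add: powr_def)
    ultimately show ?thesis unfolding P_def by simp
  qed
  have d2: "((\<lambda>s. sin (of_real pi * s / 2)) has_field_derivative C * of_real (pi / 2)) (at s)"
    unfolding C_def by (auto intro!: derivative_eq_intros)
  have d3: "((\<lambda>s. Gamma (1 - s)) has_field_derivative G * Digamma (1 - s) * (- 1)) (at s)"
    unfolding G_def by (rule DERIV_chain2[where f = Gamma and g = "\<lambda>s. 1 - s", OF has_field_derivative_Gamma[OF ni]]) (auto intro!: derivative_eq_intros)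
  have "(chi has_field_derivative
     ((2 * (P * of_real (ln (2 * pi)))) * S + (C * of_real (pi / 2)) * (2 * P)) * G + (G * Digamma (1 - s) * (- 1)) * (2 * P * S)) (at s)"
    unfolding chi_def[abs_def] unfolding P_def S_def G_def
    by (intro DERIV_mult DERIV_cmult d1[unfolded P_def] d2 d3[unfolded G_def])
  moreover have "((2 * (P * l)) * S + (C * h) * (2 * P)) * G + (G * D * (- 1)) * (2 * P * S) = 2 * P * S * G * (l + h * (C / S) - D)" if "S \<noteq> 0" for l h D
    using that by (simp add: field_simps)
  moreover have "chi s * chi_ld s = 2 * P * S * G * (of_real (ln (2 * pi)) + of_real (pi / 2) * (C / S) - Digamma (1 - s))"
    unfolding chi_def chi_ld_def cot_def P_def S_def G_def C_def ..
  ultimately show ?thesis using nz unfolding S_def[symmetric] by metis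
qed

text \<open>Stirling's formula for chi'/chi. The constant - i pi / 2 is the limit of the cotangent
  term, whose error is 1/t; comparing \<open>Digamma\<close> with \<open>Ln\<close> costs the other
  2/t.\<close>

lemma norm_chi_ld:
  assumes s: "Re s \<le> 1/2" "Im s > 0"
  shows "norm (chi_ld s + Ln (1 - s) - (of_real (ln (2 * pi)) - \<i> * of_real (pi / 2))) \<le> 3 / Im s"
proof -
  define t where "t = Im s"
  have t: "t > 0" using s by (simp add: t_def)
  have 1: "norm (cot (of_real pi * s / 2) + \<i>) \<le> 1 / (pi * t / 2)"
    using norm_cot_add_ii_le[of "of_real pi * s / 2"] t by (simp add: t_def)
  have "norm (of_real (pi / 2) * (cot (of_real pi * s / 2) + \<i>)) \<le> pi / 2 * (1 / (pi * t / 2))"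
    unfolding norm_mult using 1 by (intro mult_mono) auto
  also have "\<dots> = 1 / t" by simp
  finally have 2: "norm (of_real (pi / 2) * (cot (of_real pi * s / 2) + \<i>)) \<le> 1 / t" .
  have "norm (Digamma (1 - s) - Ln (1 - s)) \<le> 2 / (Re (1 - s) + \<bar>Im (1 - s)\<bar> - 1/2)"
    using s by (intro norm_Digamma_minus_Ln_le) auto
  also have "\<dots> \<le> 2 / t" using s t by (intro divide_left_mono) (auto simp: t_def)
  finally have 3: "norm (Digamma (1 - s) - Ln (1 - s)) \<le> 2 / t" .
  have "chi_ld s + Ln (1 - s) - (of_real (ln (2 * pi)) - \<i> * of_real (pi / 2)) =
     of_real (pi / 2) * (cot (of_real pi * s / 2) + \<i>) - (Digamma (1 - s) - Ln (1 - s))"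
    by (simp add: chi_ld_def algebra_simps)
  also have "norm \<dots> \<le> 1 / t + 2 / t"
    using norm_triangle_ineq4[of "of_real (pi / 2) * (cot (of_real pi * s / 2) + \<i>)" "Digamma (1 - s) - Ln (1 - s)"] 2 3 by linarith
  finally show ?thesis by (simp add: t_def)
qed

lemma Re_chi_ld:
  assumes s: "Re s \<le> 1/2" "Im s > 0"
  shows "\<bar>Re (chi_ld s) + ln (norm (1 - s)) - ln (2 * pi)\<bar> \<le> 3 / Im s"
proof -
  have "1 - s \<noteq> 0" using s by auto
  hence "Re (chi_ld s + Ln (1 - s) - (of_real (ln (2 * pi)) - \<i> * of_real (pi / 2))) = Re (chi_ld s) + ln (norm (1 - s)) - ln (2 * pi)"
    by simp
  thus ?thesis using abs_Re_le_cmod norm_chi_ld[OF s] by (metis order_trans)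
qed

lemma norm_chi_critical:
  assumes "Re s = 1/2" "Im s > 0"
  shows "norm (chi s) = 1"
proof -
  have cs: "1 - s = cnj s" using assms by (simp add: complex_eq_iff)
  have nz: "sin (of_real pi * s / 2) \<noteq> 0" by (rule sin_half_pi_nonzero[OF assms(2)])
  have ni: "s \<notin> \<int>" using assms by (auto elim!: Ints_cases)
  have sinpi: "sin (of_real pi * s) = 2 * sin (of_real pi * s / 2) * cos (of_real pi * s / 2)"
    using sin_double[of "of_real pi * s / 2"] by simp
  have snz: "sin (of_real pi * s) \<noteq> 0"
  proof
    assume "sin (of_real pi * s) = 0"
    then obtain n :: int where n: "of_real pi * s = of_real (of_int n * pi)" by (auto simp: sin_eq_0)
    from arg_cong[OF n, of Im] have "pi * Im s = 0" by simp
    thus False using assms by simp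
  qed
  have cnjchi: "cnj (chi s) = 2 * of_real (2 * pi) powr (cnj s - 1) * sin (of_real pi * cnj s / 2) * Gamma (1 - cnj s)"
    unfolding chi_def by (simp add: cnj_powr cnj_sin cnj_Gamma)
  have sc: "sin (of_real pi * cnj s / 2) = cos (of_real pi * s / 2)"
  proof -
    have eq: "of_real pi * cnj s / 2 = of_real pi / 2 - of_real pi * s / 2"
      unfolding cs[symmetric] by (simp add: field_simps)
    show ?thesis unfolding eq by (simp add: sin_diff)
  qed
  have "chi s * cnj (chi s) = 4 * (of_real (2 * pi) powr (s - 1) * of_real (2 * pi) powr (cnj s - 1)) * (sin (of_real pi * s / 2) * cos (of_real pi * s / 2)) * (Gamma s * Gamma (1 - s))"
    unfolding cnjchi sc unfolding chi_def cs[symmetric] by simp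
  also have "of_real (2 * pi) powr (s - 1) * of_real (2 * pi) powr (cnj s - 1) = (1 / of_real (2 * pi) :: complex)"
  proof -
    have "of_real (2 * pi) powr (s - 1) * of_real (2 * pi) powr (cnj s - 1) = (of_real (2 * pi) powr ((s - 1) + (cnj s - 1)) :: complex)"
      by (rule powr_add[symmetric])
    also have "(s - 1) + (cnj s - 1) = - 1" unfolding cs[symmetric] by simp
    also have "of_real (2 * pi) powr (- 1) = (1 / of_real (2 * pi) :: complex)"
      using powr_minus_divide[of "of_real (2*pi) :: complex" 1] by simp
    finally show ?thesis .
  qed
  also have "4 * (1 / of_real (2 * pi)) * (sin (of_real pi * s / 2) * cos (of_real pi * s / 2)) * (Gamma s * Gamma (1 - s)) = 1"
    unfolding Gamma_reflection_complex using snz unfolding sinpi by simp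
  finally have "(norm (chi s))\<^sup>2 = 1" unfolding complex_norm_square[symmetric] by (simp add: complex_eq_iff)
  thus ?thesis by (simp add: power2_eq_1_iff) (metis norm_ge_zero neg_0_le_iff_le not_one_le_zero)
qed

text \<open>A convex region without zeros or poles of \<open>chi\<close>, so one holomorphic
  logarithm of \<open>chi\<close> exists on all of it.\<close>

definition quadrant :: "complex set" where
  "quadrant = {s. Re s < 1} \<inter> {s. Im s > 0}"

lemma quadrant: "open quadrant" "convex quadrant" "s \<in> quadrant \<longleftrightarrow> Re s < 1 \<and> Im s > 0"
  unfolding quadrant_def
  by (auto intro!: open_Int convex_Int open_halfspace_Re_lt open_halfspace_Im_gt convex_halfspace_Re_lt convex_halfspace_Im_gt)

lemma holomorphic_on_chi_ld: "chi_ld holomorphic_on quadrant"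
proof -
  have "Digamma \<circ> (\<lambda>s. 1 - s) holomorphic_on quadrant"
    by (intro holomorphic_on_compose holomorphic_intros holomorphic_on_Polygamma)
       (use one_minus_notin_nonpos_Ints in \<open>auto simp: quadrant\<close>)
  thus ?thesis unfolding chi_ld_def[abs_def] cot_def
    by (intro holomorphic_intros) (auto simp: o_def quadrant sin_half_pi_nonzero)
qed

lemma chi_logarithm:
  obtains g where "\<And>s. s \<in> quadrant \<Longrightarrow> exp (g s) = chi s"
    "\<And>s. s \<in> quadrant \<Longrightarrow> (g has_field_derivative chi_ld s) (at s)"
proof -
  have hol: "chi holomorphic_on quadrant"
    by (rule holomorphic_on_subset[OF holomorphic_on_chi]) (auto simp: quadrant)
  have nz: "chi s \<noteq> 0" if "s \<in> quadrant" for s using that chi_nonzero by (auto simp: quadrant)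
  have i: "\<i> \<in> quadrant" by (simp add: quadrant)
  obtain g where g: "g holomorphic_on quadrant" "\<And>s. s \<in> quadrant \<Longrightarrow> exp (g s) = chi s"
    using holomorphic_logarithm_exists[OF quadrant(2,1) hol nz i] by blast
  have "(g has_field_derivative chi_ld s) (at s)" if s: "s \<in> quadrant" for s
  proof -
    have d: "(g has_field_derivative deriv g s) (at s)"
      using g(1) quadrant(1) s holomorphic_derivI by blast
    hence "((\<lambda>s. exp (g s)) has_field_derivative exp (g s) * deriv g s) (at s)"
      by (rule DERIV_fun_exp)
    hence "(chi has_field_derivative chi s * deriv g s) (at s)"
      using has_field_derivative_transform_within_open[OF _ quadrant(1) s, of "\<lambda>s. exp (g s)" _ chi] g(2) s by simp
    hence "chi s * deriv g s = chi s * chi_ld s"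
      using s by (intro DERIV_unique[OF _ has_field_derivative_chi]) (auto simp: quadrant)
    thus ?thesis using d nz[OF s] by simp
  qed
  thus ?thesis using that g(2) by blast
qed

lemma ln_norm_chi_MVT:
  assumes "a < b" "b < 1" "t > 0"
  obtains x where "a < x" "x < b"
    "ln (norm (chi (Complex a t))) = ln (norm (chi (Complex b t))) - (b - a) * Re (chi_ld (Complex x t))"
proof -
  obtain g where g: "\<And>s. s \<in> quadrant \<Longrightarrow> exp (g s) = chi s"
    "\<And>s. s \<in> quadrant \<Longrightarrow> (g has_field_derivative chi_ld s) (at s)" using chi_logarithm by blast
  have lng: "Re (g s) = ln (norm (chi s))" if "s \<in> quadrant" for s
    using g(1)[OF that, symmetric] by simp
  have D: "((\<lambda>x. Re (g (Complex x t))) has_real_derivative Re (chi_ld (Complex x t))) (at x)" if x: "x < 1" for x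
  proof -
    have "((\<lambda>x. Complex x t) has_vector_derivative 1) (at x)"
      unfolding Complex_eq by (auto intro!: derivative_eq_intros)
    hence "((\<lambda>x. g (Complex x t)) has_vector_derivative 1 * chi_ld (Complex x t)) (at x)"
      using field_vector_diff_chain_at[of "\<lambda>x. Complex x t" 1 x g "chi_ld (Complex x t)"] g(2)[of "Complex x t"] x assms
      by (simp add: quadrant o_def)
    hence "((\<lambda>x. Re (g (Complex x t))) has_vector_derivative Re (1 * chi_ld (Complex x t))) (at x)"
      by (rule bounded_linear.has_vector_derivative[OF bounded_linear_Re])
    thus ?thesis by (simp add: has_real_derivative_iff_has_vector_derivative)
  qed
  have "\<exists>x>a. x < b \<and> Re (g (Complex b t)) - Re (g (Complex a t)) = (b - a) * Re (chi_ld (Complex x t))"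
    using assms by (intro MVT2 D) auto
  then obtain x where x: "a < x" "x < b" "Re (g (Complex b t)) - Re (g (Complex a t)) = (b - a) * Re (chi_ld (Complex x t))" by blast
  show ?thesis
    by (rule that[OF x(1,2)]) (use x(3) assms in \<open>simp add: lng quadrant\<close>)
qed

text \<open>Starting from modulus 1 on the critical line, the mean value theorem is applied to ln
  |chi| with slope bounded by 3 + ln |1 - s|. The 3 is the Stirling error 3 / Im s for Im s >=
  1.\<close>

lemma norm_chi_le:
  assumes s: "Re s \<le> 1/2" "Im s \<ge> 1"
  shows "norm (chi s) \<le> (exp 3 * norm (1 - s)) powr (1/2 - Re s)"
proof (cases "Re s = 1/2")
  case True
  have "1 - s \<noteq> 0" using s by auto
  moreover have "1/2 - Re s = 0" using True by simp
  ultimately show ?thesis using norm_chi_critical[of s] s True by (simp only:) simp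
next
  case False
  define t where "t = Im s"
  have sC: "s = Complex (Re s) t" by (simp add: t_def)
  obtain x where x: "Re s < x" "x < 1/2"
    "ln (norm (chi (Complex (Re s) t))) = ln (norm (chi (Complex (1/2) t))) - (1/2 - Re s) * Re (chi_ld (Complex x t))"
    using ln_norm_chi_MVT[of "Re s" "1/2" t] s False by (auto simp: t_def)
  have 1: "ln (norm (chi s)) = (1/2 - Re s) * (- Re (chi_ld (Complex x t)))"
    using x(3) norm_chi_critical[of "Complex (1/2) t"] s unfolding sC[symmetric] by (simp add: t_def)
  have nn: "norm (1 - Complex x t) \<le> norm (1 - s)"
  proof -
    have "(1 - x)\<^sup>2 \<le> (1 - Re s)\<^sup>2" using x by (intro power_mono) auto
    thus ?thesis by (simp add: cmod_def t_def)
  qed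
  have pos: "norm (1 - Complex x t) > 0" using x by (auto simp: complex_eq_iff)
  have "3 / t \<le> 3" using s by (simp add: t_def divide_simps)
  moreover have "\<bar>Re (chi_ld (Complex x t)) + ln (norm (1 - Complex x t)) - ln (2 * pi)\<bar> \<le> 3 / t"
    using Re_chi_ld[of "Complex x t"] x s by (simp add: t_def)
  moreover have "ln (norm (1 - Complex x t)) \<le> ln (norm (1 - s))" using nn pos by (subst ln_le_cancel_iff) auto
  moreover have "ln (2 * pi) \<ge> 0" using pi_ge_two by (intro ln_ge_zero) auto
  ultimately have 2: "- Re (chi_ld (Complex x t)) \<le> 3 + ln (norm (1 - s))" by linarith
  have np: "norm (1 - s) > 0" using pos nn by linarith
  note 1
  also have "(1/2 - Re s) * (- Re (chi_ld (Complex x t))) \<le> (1/2 - Re s) * (3 + ln (norm (1 - s)))"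
    using 2 s by (intro mult_left_mono) auto
  also have "3 + ln (norm (1 - s)) = ln (exp 3 * norm (1 - s))" using np by (simp add: ln_mult)
  finally have "exp (ln (norm (chi s))) \<le> exp ((1/2 - Re s) * ln (exp 3 * norm (1 - s)))" by simp
  moreover have "exp (ln (norm (chi s))) = norm (chi s)" using chi_nonzero[of s] s by simp
  moreover have "exp 3 * norm (1 - s) \<noteq> 0" using np by auto
  ultimately show ?thesis unfolding powr_def by (simp only: if_False)
qed

lemma chi_ld_large:
  assumes d: "d > 0"
  obtains E where "E \<ge> 0" "\<And>s. Re s \<le> - E \<Longrightarrow> Im s \<ge> d \<Longrightarrow> - Re (chi_ld s) \<ge> B"
proof
  \<comment> \<open>Chosen so that ln |1 - s| outweighs B, ln(2 pi) and the Stirling error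
    together.\<close>
  show "exp (B + ln (2 * pi) + 3 / d) \<ge> 0" by simp
  fix s assume s: "Re s \<le> - exp (B + ln (2 * pi) + 3 / d)" "Im s \<ge> d"
  have neg: "Re s < 0" using s(1) exp_gt_zero[of "B + ln (2 * pi) + 3 / d"] by linarith
  have "exp (B + ln (2 * pi) + 3 / d) \<le> norm (1 - s)"
    using complex_Re_le_cmod[of "1 - s"] s by simp
  hence "ln (exp (B + ln (2 * pi) + 3 / d)) \<le> ln (norm (1 - s))"
    by (intro ln_mono) auto
  moreover have "\<bar>Re (chi_ld s) + ln (norm (1 - s)) - ln (2 * pi)\<bar> \<le> 3 / Im s"
    using neg s d by (intro Re_chi_ld) auto
  moreover have "3 / Im s \<le> 3 / d" using s d by (intro divide_left_mono) auto
  ultimately show "- Re (chi_ld s) \<ge> B" by simp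
qed

text \<open>The horizontal line is walked in two stretches. From 1/2 to -E the logarithm of |chi|
  loses at most (E + 1/2) C; left of -E it gains at least the distance travelled, because -
  Re(chi'/chi) >= 1 there.\<close>

lemma chi_large:
  assumes d: "d > 0"
  obtains E where "E \<ge> 0" "\<And>s. Re s \<le> - E \<Longrightarrow> Im s \<ge> d \<Longrightarrow> norm (chi s) \<ge> B"
proof -
  obtain E where E: "E \<ge> 0" "\<And>s. Re s \<le> - E \<Longrightarrow> Im s \<ge> d \<Longrightarrow> - Re (chi_ld s) \<ge> 1"
    using chi_ld_large[OF d] by blast
  define C where "C = ln 2 + ln (2 * pi) + 3 / d"
  define B' where "B' = max B 1"
  define E' where "E' = E + (E + 1/2) * C + ln B' + 1"
  have "ln (2 * pi) \<ge> 0" using pi_ge_two by (intro ln_ge_zero) auto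
  hence C: "C \<ge> 0" using d by (simp add: C_def)
  have lnB: "ln B' \<ge> 0" by (simp add: B'_def)
  have E': "E' > E" using E C lnB by (simp add: E'_def add_nonneg_pos)
  have "norm (chi s) \<ge> B" if s: "Re s \<le> - E'" "Im s \<ge> d" for s
  proof -
    define t where "t = Im s"
    have t: "t > 0" "t \<ge> d" using s d by (auto simp: t_def)
    have sC: "Complex (Re s) t = s" by (simp add: t_def)
    obtain x where x: "- E < x" "x < 1/2"
      "ln (norm (chi (Complex (- E) t))) = ln (norm (chi (Complex (1/2) t))) - (1/2 - (- E)) * Re (chi_ld (Complex x t))"
      using ln_norm_chi_MVT[of "- E" "1/2" t] E t by auto
    obtain y where y: "Re s < y" "y < - E"
      "ln (norm (chi s)) = ln (norm (chi (Complex (- E) t))) - (- E - Re s) * Re (chi_ld (Complex y t))"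
      using ln_norm_chi_MVT[of "Re s" "- E" t] E' s E t unfolding sC by auto
    have 1: "Re (chi_ld (Complex x t)) \<le> C"
    proof -
      have "1/2 \<le> norm (1 - Complex x t)" using complex_Re_le_cmod[of "1 - Complex x t"] x by simp
      hence "ln (1/2) \<le> ln (norm (1 - Complex x t))" by (intro ln_mono) auto
      moreover have "\<bar>Re (chi_ld (Complex x t)) + ln (norm (1 - Complex x t)) - ln (2 * pi)\<bar> \<le> 3 / t"
        using Re_chi_ld[of "Complex x t"] x t by simp
      moreover have "3 / t \<le> 3 / d" using t d by (intro divide_left_mono) auto
      ultimately show ?thesis by (simp add: C_def ln_div)
    qed
    have "1/2 - (- E) \<ge> 0" using E by simp
    hence 2: "(1/2 - (- E)) * Re (chi_ld (Complex x t)) \<le> (1/2 - (- E)) * C"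
      using 1 by (intro mult_left_mono)
    have 3: "- Re (chi_ld (Complex y t)) \<ge> 1" using E(2)[of "Complex y t"] y t by simp
    have "(- E - Re s) * (- Re (chi_ld (Complex y t))) \<ge> (- E - Re s) * 1"
      using 3 E' s by (intro mult_left_mono) auto
    hence "ln (norm (chi s)) \<ge> (- E - Re s) - (1/2 - (- E)) * C"
      using x(3) y(3) 2 norm_chi_critical[of "Complex (1/2) t"] t by simp
    moreover have "(- E - Re s) - (1/2 - (- E)) * C \<ge> ln B'" using s by (simp add: E'_def algebra_simps)
    ultimately have "exp (ln B') \<le> exp (ln (norm (chi s)))" by simp
    moreover have "chi s \<noteq> 0" using s E E' t by (intro chi_nonzero) (auto simp: t_def)
    moreover have "B' > 0" by (simp add: B'_def)
    ultimately have "B' \<le> norm (chi s)" by simp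
    thus ?thesis by (simp add: B'_def)
  qed
  thus ?thesis using that[of E'] E E' by auto
qed

section \<open>Derivatives of zeta away from the critical strip\<close>

lemma zeta_deriv_0: "zeta_deriv 0 = riemann_zeta"
  by (simp add: zeta_deriv_def)

lemma zeta_deriv_Suc: "zeta_deriv (Suc k) = deriv (zeta_deriv k)"
  by (simp add: zeta_deriv_def)

lemma holomorphic_on_zeta_deriv: "zeta_deriv k holomorphic_on (UNIV - {1})"
  unfolding zeta_deriv_def by (intro holomorphic_higher_deriv holomorphic_on_riemann_zeta) auto

text \<open>Cauchy's estimate on half the radius, since nothing is assumed on the boundary of the
  ball; hence the factor 2. The free value y serves functions that are close to 1.\<close>

lemma norm_deriv_le:
  assumes f: "f holomorphic_on ball z r" and r: "r > 0" and B: "\<And>w. w \<in> ball z r \<Longrightarrow> norm (f w - y) < B"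
  shows "norm (deriv f z) \<le> 2 * B / r"
proof -
  have "norm ((deriv ^^ 1) f z) \<le> fact 1 * B / (r / 2) ^ 1"
  proof (rule Cauchy_higher_deriv_bound)
    show "f holomorphic_on ball z (r/2)" using r by (intro holomorphic_on_subset[OF f]) auto
    show "continuous_on (cball z (r/2)) f"
      using r by (intro holomorphic_on_imp_continuous_on holomorphic_on_subset[OF f]) auto
    fix w assume "w \<in> ball z (r/2)"
    hence "w \<in> ball z r" using r by auto
    from B[OF this] show "f w \<in> ball y B" by (simp add: dist_norm norm_minus_commute)
  qed (use r in auto)
  thus ?thesis by (simp add: mult.commute)
qed

definition corner :: "real \<Rightarrow> real \<Rightarrow> complex set" where
  "corner E d = {s. Re s < - E} \<inter> {s. Im s > d}"

lemma corner: "open (corner E d)" "convex (corner E d)" "s \<in> corner E d \<longleftrightarrow> Re s < - E \<and> Im s > d"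
  unfolding corner_def
  by (auto intro!: open_Int convex_Int open_halfspace_Re_lt open_halfspace_Im_gt convex_halfspace_Re_lt convex_halfspace_Im_gt)

text \<open>Records the margin that each passage to a derivative by Cauchy's estimate costs.\<close>

lemma ball_subset_corner:
  assumes "s \<in> corner (E + r) (d + r)"
  shows "ball s r \<subseteq> corner E d"
proof
  fix w assume "w \<in> ball s r"
  hence "norm (w - s) < r" by (simp add: dist_norm norm_minus_commute)
  hence "\<bar>Re w - Re s\<bar> < r" "\<bar>Im w - Im s\<bar> < r"
    using abs_Re_le_cmod[of "w - s"] abs_Im_le_cmod[of "w - s"] by auto
  thus "w \<in> corner E d" using assms by (auto simp: corner)
qed

text \<open>For m >= 3 a factor m^(-2) is kept for convergence and the rest is at most 3^(2 - Re s).
  Written relative to 2^(-Re s), the tail is visibly smaller than the second term of the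
  series.\<close>

lemma riemann_zeta_tail:
  assumes s: "Re s \<ge> 2"
  shows "norm (riemann_zeta s - 1 - 2 powr (- s)) \<le> 9 * (2 / 3) powr (Re s) / 2 powr (Re s) * (\<Sum>n. real (Suc n) powr (-2))"
proof -
  define a where "a = (\<lambda>n. of_nat (Suc n) powr (- s) :: complex)"
  have sm: "summable a" unfolding a_def using s by (intro summable_dirichlet) auto
  have smr: "summable (\<lambda>n. real (Suc n) powr (-2))" by (rule summable_Suc_powr) auto
  have "riemann_zeta s = suminf a"
    using riemann_zeta_dirichlet[of s] s by (simp add: a_def powr_minus inverse_eq_divide del: of_nat_Suc)
  also have "suminf a = (\<Sum>n. a (n + 2)) + (\<Sum>n<2. a n)" by (rule suminf_split_initial_segment[OF sm])
  also have "(\<Sum>n<2. a n) = 1 + 2 powr (- s)" by (simp add: a_def eval_nat_numeral)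
  finally have "riemann_zeta s - 1 - 2 powr (- s) = (\<Sum>n. a (n + 2))" by simp
  also have "norm \<dots> \<le> (\<Sum>n. (9 * (2 / 3) powr (Re s) / 2 powr (Re s)) * real (Suc n) powr (-2))"
  proof (rule norm_suminf_le)
    show "summable (\<lambda>n. (9 * (2 / 3) powr (Re s) / 2 powr (Re s)) * real (Suc n) powr (-2))" by (intro summable_mult smr)
    fix n
    define m where "m = real (Suc (n + 2))"
    have m: "m \<ge> 3" "m \<ge> real (Suc n)" by (auto simp: m_def)
    have "norm (a (n + 2)) = m powr (- Re s)" unfolding a_def m_def by (subst norm_of_nat_powr) auto
    also have "\<dots> = m powr (2 - Re s) * m powr (-2)" by (simp flip: powr_add)
    also have "\<dots> \<le> 3 powr (2 - Re s) * real (Suc n) powr (-2)"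
      using m s by (intro mult_mono powr_mono2') auto
    also have "3 powr (2 - Re s) = 9 * (2 / 3) powr (Re s) / 2 powr (Re s)"
      by (simp add: powr_diff powr_divide)
    finally show "norm (a (n + 2)) \<le> (9 * (2 / 3) powr (Re s) / 2 powr (Re s)) * real (Suc n) powr (-2)" .
  qed
  also have "\<dots> = 9 * (2 / 3) powr (Re s) / 2 powr (Re s) * (\<Sum>n. real (Suc n) powr (-2))" by (rule suminf_mult[OF smr])
  finally show ?thesis .
qed

lemma two_thirds_powr_small:
  assumes "e > (0::real)"
  obtains E where "E \<ge> 2" "\<And>x. x \<ge> E \<Longrightarrow> C * (2/3) powr x < e"
proof -
  have "((\<lambda>x. C * (2/3) powr x) \<longlongrightarrow> 0) at_top" by real_asymp
  hence "eventually (\<lambda>x. C * (2/3) powr x < e) at_top" using assms order_tendstoD(2) by fastforce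
  then obtain E where "\<And>x. x \<ge> E \<Longrightarrow> C * (2/3) powr x < e" unfolding eventually_at_top_linorder by blast
  thus ?thesis using that[of "max E 2"] by auto
qed

lemma riemann_zeta_right:
  assumes e: "e > 0"
  obtains E where "E \<ge> 2" "\<And>s. Re s \<ge> E \<Longrightarrow> norm (2 powr s * (riemann_zeta s - 1) - 1) < e"
    "\<And>s. Re s \<ge> E \<Longrightarrow> norm (riemann_zeta s - 1) < e"
proof -
  define S where "S = (\<Sum>n. real (Suc n) powr (-2))"
  obtain E1 where E1: "E1 \<ge> 2" "\<And>x. x \<ge> E1 \<Longrightarrow> (9 * S) * (2/3) powr x < min e 1"
    using two_thirds_powr_small[of "min e 1" "9 * S"] e by auto
  obtain E2 where E2: "E2 \<ge> 2" "\<And>x. x \<ge> E2 \<Longrightarrow> 2 * (2/3) powr x < e"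
    using two_thirds_powr_small[of e 2] e by auto
  have A: "norm (2 powr s * (riemann_zeta s - 1) - 1) < min e 1" if s: "Re s \<ge> max E1 E2" for s
  proof -
    have p: "2 powr s * 2 powr (- s) = (1::complex)" by (simp flip: powr_add)
    have "2 powr s * (riemann_zeta s - 1) - 1 = 2 powr s * (riemann_zeta s - 1 - 2 powr (- s))"
      by (simp only: right_diff_distrib p)
    hence "norm (2 powr s * (riemann_zeta s - 1) - 1) = 2 powr Re s * norm (riemann_zeta s - 1 - 2 powr (- s))"
      using norm_powr_real_powr[of 2 s] by (simp add: norm_mult)
    also have "\<dots> \<le> 2 powr Re s * (9 * (2 / 3) powr (Re s) / 2 powr (Re s) * S)"
      unfolding S_def using s E1 by (intro mult_left_mono riemann_zeta_tail) auto
    also have "\<dots> = (9 * S) * (2/3) powr Re s" by simp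
    finally show ?thesis using E1(2)[of "Re s"] s by auto
  qed
  have B: "norm (riemann_zeta s - 1) < e" if s: "Re s \<ge> max E1 E2" for s
  proof -
    have "norm (2 powr s * (riemann_zeta s - 1)) \<le> norm (2 powr s * (riemann_zeta s - 1) - 1) + 1"
      using norm_triangle_ineq[of "2 powr s * (riemann_zeta s - 1) - 1" 1] by simp
    also have "\<dots> < 2" using A[OF s] by simp
    finally have "2 powr Re s * norm (riemann_zeta s - 1) < 2"
      using norm_powr_real_powr[of 2 s] by (simp add: norm_mult)
    hence "norm (riemann_zeta s - 1) < 2 / 2 powr Re s" by (simp add: field_simps)
    also have "\<dots> \<le> 2 * (2/3) powr Re s"
    proof -
      have "1 / 2 powr Re s = (1/2) powr Re s" by (simp add: powr_divide)
      also have "\<dots> \<le> (2/3) powr Re s" using s E1 by (intro powr_mono2) auto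
      finally show ?thesis by simp
    qed
    also have "\<dots> < e" using E2(2)[of "Re s"] s by auto
    finally show ?thesis .
  qed
  show ?thesis using that[of "max E1 E2"] A B E1 by auto
qed

text \<open>With L = chi'/chi and m = 1/L, differentiating chi L^k q gives chi L^(k+1) (q + q' m - k
  q m'). Far to the left L is large, so m is small; q' and m' are controlled by Cauchy's estimate
  and the new factor is again close to 1. The height d and the accuracy e are generalised because
  each derivative consumes part of both.\<close>

lemma zeta_deriv_left:
  assumes "d > 0" "e > 0"
  shows "\<exists>E\<ge>0. \<exists>q. q holomorphic_on corner E d \<and> 
    (\<forall>s\<in>corner E d. norm (q s - 1) < e \<and> chi_ld s \<noteq> 0 \<and> zeta_deriv k s = chi s * chi_ld s ^ k * q s)"
  using assms
proof (induction k arbitrary: d e)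
  case 0
  obtain E0 where E0: "E0 \<ge> 2" "\<And>s. Re s \<ge> E0 \<Longrightarrow> norm (riemann_zeta s - 1) < e"
    by (rule riemann_zeta_right[OF 0(2)]) (rule that)
  obtain E1 where E1: "E1 \<ge> 0" "\<And>s. Re s \<le> - E1 \<Longrightarrow> Im s \<ge> d \<Longrightarrow> - Re (chi_ld s) \<ge> 1"
    using chi_ld_large[OF 0(1)] by blast
  define E where "E = max E0 E1"
  have "(riemann_zeta \<circ> (\<lambda>s. 1 - s)) holomorphic_on corner E d"
    using E0 by (intro holomorphic_on_compose holomorphic_intros holomorphic_on_subset[OF holomorphic_on_riemann_zeta])
      (auto simp: corner E_def)
  moreover have "norm (riemann_zeta (1 - s) - 1) < e \<and> chi_ld s \<noteq> 0 \<and> zeta_deriv 0 s = chi s * chi_ld s ^ 0 * riemann_zeta (1 - s)"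
    if "s \<in> corner E d" for s
  proof -
    have s: "Re s < - E" "Im s > d" "E \<ge> E0" "E \<ge> E1" using that by (auto simp: corner E_def)
    have "Re (1 - s) \<ge> E0" "Re s \<le> - E1" "Re s < 0" using s E0(1) by simp_all
    thus ?thesis using E0(2)[of "1 - s"] E1(2)[of s] riemann_zeta_functional[of s] s(2) by (auto simp: zeta_deriv_0)
  qed
  ultimately show ?case using E0(1) unfolding o_def by (intro exI[of _ E] conjI exI[of _ "\<lambda>s. riemann_zeta (1 - s)"]) (auto simp: E_def)
next
  case (Suc k)
  define r where "r = min 1 (d / 2)"
  have r: "r > 0" "r \<le> d / 2" using Suc.prems by (auto simp: r_def)
  define e' where "e' = min (e / 4) 1"
  have e': "e' > 0" "e' \<le> e / 4" "e' \<le> 1" using Suc.prems by (auto simp: e'_def)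
  define K where "K = real k + 1"
  have K: "K \<ge> 1" "real k \<le> K" by (auto simp: K_def)
  \<comment> \<open>Bound for m: with it the term q' m is at most e/16 and the term k q m' at most
    e/8. Together with e/4 for q - 1 this stays below e.\<close>
  define h where "h = r * e / (32 * K)"
  have h: "h > 0" using r Suc.prems K by (simp add: h_def)
  have d2: "d / 2 > 0" using Suc.prems by simp
  obtain E0 q where E0: "E0 \<ge> 0" and qh: "q holomorphic_on corner E0 (d/2)"
    and q: "\<And>s. s \<in> corner E0 (d/2) \<Longrightarrow> norm (q s - 1) < e'"
       "\<And>s. s \<in> corner E0 (d/2) \<Longrightarrow> zeta_deriv k s = chi s * chi_ld s ^ k * q s"
    using Suc.IH[OF d2 e'(1)] by blast
  obtain E1 where E1: "E1 \<ge> 0" "\<And>s. Re s \<le> - E1 \<Longrightarrow> Im s \<ge> d / 2 \<Longrightarrow> - Re (chi_ld s) \<ge> 2 / h"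
    using chi_ld_large[OF d2] by blast
  define E where "E = max E0 E1"
  define m where "m = (\<lambda>s. 1 / chi_ld s)"
  define C where "C = corner E (d/2)"
  have C: "open C" unfolding C_def by (rule corner)
  have CE: "s \<in> corner E0 (d/2)" "Re s \<le> - E1" "Im s > d / 2" "s \<in> quadrant" if "s \<in> C" for s
    using that E0 d2 by (auto simp: C_def E_def corner quadrant)
  have ld: "norm (chi_ld s) \<ge> 2 / h" "chi_ld s \<noteq> 0" if "s \<in> C" for s
  proof -
    have "- Re (chi_ld s) \<ge> 2 / h" using E1(2) CE[OF that] by simp
    thus "norm (chi_ld s) \<ge> 2 / h" using abs_Re_le_cmod[of "chi_ld s"] by linarith
    moreover have "2 / h > 0" using h by simp
    ultimately show "chi_ld s \<noteq> 0" by auto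
  qed
  have ldh: "chi_ld holomorphic_on C" by (rule holomorphic_on_subset[OF holomorphic_on_chi_ld]) (use CE in auto)
  have qh': "q holomorphic_on C" by (rule holomorphic_on_subset[OF qh]) (use CE in auto)
  have mh: "m holomorphic_on C" unfolding m_def by (intro holomorphic_intros ldh ld)
  have mle: "norm (m s) < h" if "s \<in> C" for s
  proof -
    have "norm (m s) = 1 / norm (chi_ld s)" by (simp add: m_def norm_divide)
    also have "\<dots> \<le> 1 / (2 / h)" using ld[OF that] h by (intro divide_left_mono mult_pos_pos) auto
    also have "\<dots> < h" using h by simp
    finally show ?thesis .
  qed
  define Q where "Q = (\<lambda>s. q s + deriv q s * m s - of_nat k * q s * deriv m s)"
  have sub: "corner (E + r) d \<subseteq> corner (E + r) (d / 2 + r)" using r by (auto simp: corner)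
  have subC: "corner (E + r) d \<subseteq> C" using r d2 by (auto simp: corner C_def)
  have "Q holomorphic_on C" unfolding Q_def
    by (intro holomorphic_intros qh' mh holomorphic_deriv C)
  hence Qh: "Q holomorphic_on corner (E + r) d" by (rule holomorphic_on_subset[OF _ subC])
  have "norm (Q s - 1) < e \<and> chi_ld s \<noteq> 0 \<and> zeta_deriv (Suc k) s = chi s * chi_ld s ^ Suc k * Q s" if s: "s \<in> corner (E + r) d" for s
  proof (intro conjI)
    have bs: "ball s r \<subseteq> C" unfolding C_def using ball_subset_corner[of s E r "d/2"] s sub by auto
    have sC: "s \<in> C" using subC s by auto
    have dq: "norm (deriv q s) \<le> 2 * e' / r"
      by (rule norm_deriv_le[of _ _ _ 1]) (use bs r q CE in \<open>auto intro!: holomorphic_on_subset[OF qh']\<close>)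
    have dm: "norm (deriv m s) \<le> 2 * h / r"
      by (rule norm_deriv_le[of _ _ _ 0]) (use bs r mle in \<open>auto intro!: holomorphic_on_subset[OF mh]\<close>)
    have q1: "norm (q s - 1) < e'" using q CE[OF sC] by auto
    hence q2: "norm (q s) \<le> 2" using norm_triangle_ineq[of "q s - 1" 1] e' by simp
    have "norm (deriv q s * m s) \<le> (2 * e' / r) * h"
      unfolding norm_mult using dq mle[OF sC] e' r by (intro mult_mono) auto
    also have "\<dots> \<le> (2 * 1 / r) * h" using e' r h by (intro mult_right_mono divide_right_mono) auto
    also have "\<dots> = e / (16 * K)" using r by (simp add: h_def)
    also have "\<dots> \<le> e / 16" using Suc.prems K by (intro divide_left_mono) auto
    finally have t1: "norm (deriv q s * m s) \<le> e / 16" .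
    have "norm (of_nat k * q s * deriv m s) \<le> (real k * 2) * (2 * h / r)"
      unfolding norm_mult norm_of_nat using q2 dm by (intro mult_mono) auto
    also have "\<dots> = e * (real k / (8 * K))" using r by (simp add: h_def)
    also have "\<dots> \<le> e * (1 / 8)"
      using Suc.prems K by (intro mult_left_mono) (auto simp: divide_simps)
    finally have t2: "norm (of_nat k * q s * deriv m s) \<le> e / 8" by simp
    have Qe: "Q s - 1 = (q s - 1) + deriv q s * m s - of_nat k * q s * deriv m s" by (simp add: Q_def)
    have "norm (Q s - 1) \<le> norm (q s - 1) + norm (deriv q s * m s) + norm (of_nat k * q s * deriv m s)"
      unfolding Qe using norm_triangle_ineq4[of "(q s - 1) + deriv q s * m s" "of_nat k * q s * deriv m s"]
        norm_triangle_ineq[of "q s - 1" "deriv q s * m s"] by linarith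
    thus "norm (Q s - 1) < e" using q1 t1 t2 e' Suc.prems by linarith
    show ldnz: "chi_ld s \<noteq> 0" using ld sC by auto
    have D: "(f has_field_derivative deriv f s) (at s)" if "f holomorphic_on C" for f
      using holomorphic_derivI[OF that C sC] .
    have dchi: "(chi has_field_derivative chi s * chi_ld s) (at s)"
      using CE[OF sC] by (intro has_field_derivative_chi) (auto simp: quadrant)
    have dm': "deriv m s = - deriv chi_ld s / (chi_ld s)\<^sup>2"
      unfolding m_def by (rule DERIV_imp_deriv) (use D[OF ldh] ldnz in \<open>auto intro!: derivative_eq_intros simp: power2_eq_square\<close>)
    have "((\<lambda>s. chi s * chi_ld s ^ k * q s) has_field_derivative
      (chi s * chi_ld s * chi_ld s ^ k + (of_nat k * (deriv chi_ld s * chi_ld s ^ (k - Suc 0))) * chi s) * q s + deriv q s * (chi s * chi_ld s ^ k)) (at s)"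
      by (intro DERIV_mult DERIV_power dchi D ldh qh')
    moreover have "(chi s * chi_ld s * chi_ld s ^ k + (of_nat k * (deriv chi_ld s * chi_ld s ^ (k - Suc 0))) * chi s) * q s + deriv q s * (chi s * chi_ld s ^ k)
      = chi s * chi_ld s ^ Suc k * Q s"
    proof (cases k)
      case 0 thus ?thesis using ldnz by (simp add: Q_def m_def field_simps)
    next
      case (Suc j) thus ?thesis using ldnz unfolding Q_def unfolding dm' unfolding m_def
        by (simp add: field_simps power2_eq_square)
    qed
    ultimately have "((\<lambda>s. chi s * chi_ld s ^ k * q s) has_field_derivative chi s * chi_ld s ^ Suc k * Q s) (at s)" by simp
    hence "(zeta_deriv k has_field_derivative chi s * chi_ld s ^ Suc k * Q s) (at s)"
      by (rule has_field_derivative_transform_within_open[OF _ C sC]) (use q(2) CE in auto)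
    thus "zeta_deriv (Suc k) s = chi s * chi_ld s ^ Suc k * Q s"
      unfolding zeta_deriv_Suc by (rule DERIV_imp_deriv)
  qed
  thus ?case using Qh E0 r by (intro exI[of _ "E + r"]) (auto simp: E_def)
qed

definition halfp :: "real \<Rightarrow> complex set" where
  "halfp E = {s. Re s > E}"

lemma halfp: "open (halfp E)" "convex (halfp E)" "s \<in> halfp E \<longleftrightarrow> Re s > E"
  unfolding halfp_def by (auto intro!: open_halfspace_Re_gt convex_halfspace_Re_gt)

lemma ball_subset_halfp:
  assumes "s \<in> halfp (E + r)"
  shows "ball s r \<subseteq> halfp E"
proof
  fix w assume "w \<in> ball s r"
  hence "norm (w - s) < r" by (simp add: dist_norm norm_minus_commute)
  hence "\<bar>Re w - Re s\<bar> < r" using abs_Re_le_cmod[of "w - s"] by auto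
  thus "w \<in> halfp E" using assms by (auto simp: halfp)
qed

lemma has_field_derivative_two_powr:
  "((\<lambda>s. 2 powr (- s) :: complex) has_field_derivative - (of_real (ln 2) * 2 powr (- s))) (at s)"
proof -
  have "2 powr z = exp (z * of_real (ln 2))" for z :: complex
    using Ln_of_real[of 2] by (simp add: powr_def)
  thus ?thesis by (auto intro!: derivative_eq_intros)
qed

text \<open>Differentiation multiplies by - ln 2 and replaces u by u - u' / ln 2, where u' is small
  by Cauchy's estimate because u is close to 1. The constant term of the Dirichlet series survives
  only for k = 0.\<close>

lemma zeta_deriv_right:
  assumes "e > 0"
  shows "\<exists>E\<ge>2. \<exists>u. u holomorphic_on halfp E \<and> 
    (\<forall>s\<in>halfp E. norm (u s - 1) < e \<and> zeta_deriv k s - (if k = 0 then 1 else 0) = (- of_real (ln 2)) ^ k * 2 powr (- s) * u s)"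
  using assms
proof (induction k arbitrary: e)
  case 0
  obtain E where E: "E \<ge> 2" "\<And>s. Re s \<ge> E \<Longrightarrow> norm (2 powr s * (riemann_zeta s - 1) - 1) < e"
    by (rule riemann_zeta_right[OF 0]) (rule that)
  have "(\<lambda>s. 2 powr s * (riemann_zeta s - 1)) holomorphic_on halfp E"
    using E(1) by (intro holomorphic_intros holomorphic_on_subset[OF holomorphic_on_riemann_zeta]) (auto simp: halfp)
  moreover have "riemann_zeta s - 1 = 2 powr (- s) * (2 powr s * (riemann_zeta s - 1))" for s :: complex
  proof -
    have "2 powr (- s) * 2 powr s = (1::complex)" by (simp flip: powr_add)
    thus ?thesis by (simp flip: mult.assoc)
  qed
  ultimately show ?case using E
    by (intro exI[of _ E] conjI exI[of _ "\<lambda>s. 2 powr s * (riemann_zeta s - 1)"]) (auto simp: halfp zeta_deriv_0)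
next
  case (Suc k)
  define l where "l = complex_of_real (ln 2)"
  have l0: "ln 2 > (0::real)" by simp
  define e' where "e' = min (e / 2) (e * ln 2 / 8)"
  have e': "e' > 0" "e' \<le> e / 2" "e' \<le> e * ln 2 / 8" using Suc.prems by (auto simp: e'_def)
  obtain E u where E: "E \<ge> 2" and uh: "u holomorphic_on halfp E"
    and u: "\<And>s. s \<in> halfp E \<Longrightarrow> norm (u s - 1) < e'"
      "\<And>s. s \<in> halfp E \<Longrightarrow> zeta_deriv k s - (if k = 0 then 1 else 0) = (- l) ^ k * 2 powr (- s) * u s"
    using Suc.IH[OF e'(1)] unfolding l_def by blast
  define U where "U = (\<lambda>s. u s - deriv u s / l)"
  have "U holomorphic_on halfp E" unfolding U_def l_def
    using l0 by (intro holomorphic_intros uh holomorphic_deriv halfp) auto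
  hence Uh: "U holomorphic_on halfp (E + 1)" by (rule holomorphic_on_subset) (auto simp: halfp)
  have "norm (U s - 1) < e \<and> zeta_deriv (Suc k) s = (- l) ^ Suc k * 2 powr (- s) * U s" if s: "s \<in> halfp (E + 1)" for s
  proof
    have bs: "ball s 1 \<subseteq> halfp E" using ball_subset_halfp[OF s] .
    have sE: "s \<in> halfp E" using s by (auto simp: halfp)
    have du: "norm (deriv u s) \<le> 2 * e' / 1"
      by (rule norm_deriv_le[of _ _ _ 1]) (use bs u in \<open>auto intro!: holomorphic_on_subset[OF uh]\<close>)
    have "norm (deriv u s / l) = norm (deriv u s) / ln 2" unfolding l_def norm_divide using l0 by simp
    also have "\<dots> \<le> (2 * (e * ln 2 / 8)) / ln 2" using du e' l0 by (intro divide_right_mono) auto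
    also have "\<dots> = e / 4" using l0 by simp
    finally have "norm (deriv u s / l) \<le> e / 4" .
    moreover have "norm (U s - 1) \<le> norm (u s - 1) + norm (deriv u s / l)"
      using norm_triangle_ineq4[of "u s - 1" "deriv u s / l"] by (simp add: U_def algebra_simps)
    ultimately show "norm (U s - 1) < e" using u(1)[OF sE] e' Suc.prems by linarith
    have du': "(u has_field_derivative deriv u s) (at s)" using holomorphic_derivI[OF uh halfp(1) sE] .
    have "((\<lambda>s. (if k = 0 then 1 else 0) + ((- l) ^ k * 2 powr (- s)) * u s) has_field_derivative
        0 + (((- l) ^ k * (- (l * 2 powr (- s)))) * u s + deriv u s * ((- l) ^ k * 2 powr (- s)))) (at s)"
      unfolding l_def by (intro DERIV_add DERIV_mult DERIV_cmult DERIV_const du' has_field_derivative_two_powr)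
    also have "0 + (((- l) ^ k * (- (l * 2 powr (- s)))) * u s + deriv u s * ((- l) ^ k * 2 powr (- s))) = (- l) ^ Suc k * 2 powr (- s) * U s"
      using l0 by (simp add: U_def l_def field_simps)
    finally have "(zeta_deriv k has_field_derivative (- l) ^ Suc k * 2 powr (- s) * U s) (at s)"
      by (rule has_field_derivative_transform_within_open[OF _ halfp(1) sE]) (metis u(2) add.commute diff_add_cancel)
    thus "zeta_deriv (Suc k) s = (- l) ^ Suc k * 2 powr (- s) * U s"
      unfolding zeta_deriv_Suc by (rule DERIV_imp_deriv)
  qed
  thus ?case using Uh E unfolding l_def by (intro exI[of _ "E + 1"]) auto
qed

text \<open>Origin of \<open>n_ak\<close>: if the constant term, 1 - a for k = 0 and - a otherwise,
  vanishes, then the multiple of 2^(-s) leads and n = 2; otherwise the constant dominates and n =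
  1.\<close>

lemma zeta_deriv_minus_right:
  obtains E c v where "E \<ge> 2" "c \<noteq> 0" "v holomorphic_on halfp E"
    "\<And>s. s \<in> halfp E \<Longrightarrow> norm (v s - 1) < 1/2"
    "\<And>s. s \<in> halfp E \<Longrightarrow> zeta_deriv k s - a = c * of_nat (n_ak a k) powr (- s) * v s"
proof -
  define c0 where "c0 = (if k = 0 then 1 else 0) - a"
  obtain E u where E: "E \<ge> 2" and uh: "u holomorphic_on halfp E"
    and u: "\<And>s. s \<in> halfp E \<Longrightarrow> norm (u s - 1) < 1/2"
      "\<And>s. s \<in> halfp E \<Longrightarrow> zeta_deriv k s - (if k = 0 then 1 else 0) = (- of_real (ln 2)) ^ k * 2 powr (- s) * u s"
    using zeta_deriv_right[of "1/2" k] by auto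
  have eq: "zeta_deriv k s - a = c0 + (- of_real (ln 2)) ^ k * 2 powr (- s) * u s" if "s \<in> halfp E" for s
    using u(2)[OF that] by (simp add: c0_def algebra_simps)
  show ?thesis
  proof (cases "c0 = 0")
    case True
    hence "n_ak a k = 2" by (auto simp: c0_def n_ak_def split: if_splits)
    thus ?thesis using that[OF E _ uh u(1), of "(- of_real (ln 2)) ^ k"] eq True by simp
  next
    case False
    hence n: "n_ak a k = 1" by (auto simp: c0_def n_ak_def split: if_splits)
    define v where "v = (\<lambda>s. 1 + (- of_real (ln 2)) ^ k * 2 powr (- s) * u s / c0)"
    obtain E1 where E1: "E1 \<ge> 2" "\<And>x. x \<ge> E1 \<Longrightarrow> 2 * (2/3) powr x < norm c0 / 2"
      using two_thirds_powr_small[of "norm c0 / 2" 2] False by auto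
    define E2 where "E2 = max E E1"
    have vh: "v holomorphic_on halfp E2" unfolding v_def
      using False by (intro holomorphic_intros holomorphic_on_subset[OF uh]) (auto simp: halfp E2_def)
    have "norm (v s - 1) < 1/2" if s: "s \<in> halfp E2" for s
    proof -
      have sE: "s \<in> halfp E" "Re s \<ge> E1" "Re s \<ge> 2" using s E1 by (auto simp: halfp E2_def)
      have us: "norm (u s) \<le> 2" using u(1)[OF sE(1)] norm_triangle_ineq[of "u s - 1" 1] by simp
      have l2: "norm (- complex_of_real (ln 2)) \<le> 1" using ln_le_minus_one[of 2] by simp
      have "norm ((- of_real (ln 2)) ^ k * 2 powr (- s) * u s) \<le> 1 * (1/2) powr (Re s) * 2"
      proof -
        have "norm ((- complex_of_real (ln 2)) ^ k) \<le> 1" unfolding norm_power using l2 by (intro power_le_one) auto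
        moreover have "norm (2 powr (- s) :: complex) = (1/2) powr (Re s)"
          using norm_powr_real_powr[of 2 "- s"] by (simp add: powr_divide powr_minus_divide)
        ultimately show ?thesis unfolding norm_mult using us by (intro mult_mono) auto
      qed
      also have "\<dots> \<le> 2 * (2/3) powr (Re s)" using sE powr_mono2[of "Re s" "1/2" "2/3"] by simp
      also have "\<dots> < norm c0 / 2" by (rule E1(2)[OF sE(2)])
      finally show ?thesis using False by (simp add: v_def norm_divide divide_simps mult.commute)
    qed
    moreover have "zeta_deriv k s - a = c0 * of_nat (n_ak a k) powr (- s) * v s" if "s \<in> halfp E2" for s
      using eq[of s] that False by (simp add: n v_def algebra_simps halfp E2_def)
    ultimately show ?thesis using that[OF _ False vh] E by (auto simp: E2_def)
  qed
qed

text \<open>The value a is absorbed into w = 1 - a / D, which is close to 1 because |chi| is large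
  far to the left. Distance at most 1/2 from 1 keeps q and w off the cut of \<open>Ln\<close>, and a
  negative real part of \<open>chi_ld\<close> does the same for - \<open>chi_ld\<close>.\<close>

lemma zeta_deriv_minus_left:
  obtains E q w where "E \<ge> 0" "q holomorphic_on corner E (1/2)" "w holomorphic_on corner E (1/2)"
    "\<And>s. s \<in> corner E (1/2) \<Longrightarrow> norm (q s - 1) < 1/2"
    "\<And>s. s \<in> corner E (1/2) \<Longrightarrow> norm (w s - 1) \<le> 1/2"
    "\<And>s. s \<in> corner E (1/2) \<Longrightarrow> Re (chi_ld s) \<le> -1"
    "\<And>s. s \<in> corner E (1/2) \<Longrightarrow> zeta_deriv k s - a = chi s * chi_ld s ^ k * q s * w s"
proof -
  obtain E0 q where E0: "E0 \<ge> 0" and qh: "q holomorphic_on corner E0 (1/2)"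
    and q: "\<And>s. s \<in> corner E0 (1/2) \<Longrightarrow> norm (q s - 1) < 1/2"
      "\<And>s. s \<in> corner E0 (1/2) \<Longrightarrow> zeta_deriv k s = chi s * chi_ld s ^ k * q s"
    using zeta_deriv_left[of "1/2" "1/2" k] by auto
  obtain E1 where E1: "E1 \<ge> 0" "\<And>s. Re s \<le> - E1 \<Longrightarrow> Im s \<ge> 1/2 \<Longrightarrow> - Re (chi_ld s) \<ge> 1"
    using chi_ld_large[of "1/2" 1] by auto
  obtain E2 where E2: "E2 \<ge> 0" "\<And>s. Re s \<le> - E2 \<Longrightarrow> Im s \<ge> 1/2 \<Longrightarrow> norm (chi s) \<ge> 4 * norm a + 1"
    using chi_large[of "1/2" "4 * norm a + 1"] by auto
  define E where "E = max E0 (max E1 E2)"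
  define C where "C = corner E (1/2)"
  have CE: "s \<in> corner E0 (1/2)" "Re s \<le> - E1" "Re s \<le> - E2" "Im s \<ge> 1/2" "s \<in> quadrant" if "s \<in> C" for s
  proof -
    have s: "Re s < - E" "Im s > 1/2" "E \<ge> E0" "E \<ge> E1" "E \<ge> E2" using that by (auto simp: corner E_def C_def)
    show "s \<in> corner E0 (1/2)" "Re s \<le> - E1" "Re s \<le> - E2" "Im s \<ge> 1/2" "s \<in> quadrant"
      using s E0 by (simp_all add: corner quadrant)
  qed
  define D where "D = (\<lambda>s. chi s * chi_ld s ^ k * q s)"
  define w where "w = (\<lambda>s. 1 - a / D s)"
  have ld: "Re (chi_ld s) \<le> -1" if "s \<in> C" for s using E1(2)[of s] CE[OF that] by simp
  have Dge: "norm (D s) \<ge> 2 * norm a" "D s \<noteq> 0" if s: "s \<in> C" for s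
  proof -
    have "norm (q s) \<ge> 1/2" using q(1)[of s] CE[OF s] norm_triangle_ineq2[of 1 "1 - q s"] by (simp add: norm_minus_commute)
    moreover have "norm (chi_ld s ^ k) \<ge> 1" unfolding norm_power using ld[OF s] abs_Re_le_cmod[of "chi_ld s"] by (intro one_le_power) simp
    ultimately have "norm (chi s) * norm (chi_ld s ^ k) * norm (q s) \<ge> (4 * norm a + 1) * 1 * (1/2)"
      using E2(2)[of s] CE[OF s] by (intro mult_mono) auto
    hence *: "norm (D s) \<ge> 2 * norm a + 1/2" by (simp add: D_def norm_mult)
    thus "norm (D s) \<ge> 2 * norm a" by simp
    have "norm (D s) > 0" using * norm_ge_zero[of a] by linarith
    thus "D s \<noteq> 0" by simp
  qed
  have qh': "q holomorphic_on C" using CE by (intro holomorphic_on_subset[OF qh]) auto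
  have Dh: "D holomorphic_on C" unfolding D_def
    by (intro holomorphic_intros qh' holomorphic_on_subset[OF holomorphic_on_chi] holomorphic_on_subset[OF holomorphic_on_chi_ld])
      (use CE in \<open>auto simp: quadrant\<close>)
  have wh: "w holomorphic_on C" unfolding w_def by (intro holomorphic_intros Dh Dge)
  have w: "norm (w s - 1) \<le> 1/2" if "s \<in> C" for s
    using Dge[OF that] by (simp add: w_def norm_divide divide_simps)
  have "zeta_deriv k s - a = chi s * chi_ld s ^ k * q s * w s" if "s \<in> C" for s
    using q(2)[of s] CE[OF that] Dge[OF that] unfolding D_def[symmetric] w_def
    by (simp add: field_simps D_def)
  thus ?thesis using that[of E q w] E0 qh' wh w q(1) ld CE by (auto simp: C_def E_def)
qed

text \<open>To the right of -1/2 this is \<open>zeta_half_bound\<close>. Further left the functional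
  equation multiplies the bound at 1 - s by the one for chi, whose exponent 1/2 - Re s is at most
  B.\<close>

lemma riemann_zeta_growth:
  obtains C M :: real where "C > 0" "M \<ge> 0" "\<And>s. Re s \<ge> - A \<Longrightarrow> Im s \<ge> 1 \<Longrightarrow> norm (riemann_zeta s) \<le> C * (1 + norm s) powr M"
proof -
  obtain C where C: "C > 0" "\<And>s. Re s \<ge> - 1/2 \<Longrightarrow> norm (zeta_half s) \<le> C * (1 + norm s) ^ 3"
    using zeta_half_bound by blast
  define B where "B = max A 0 + 1/2"
  define M where "M = 3 + B"
  define K where "K = exp 3 powr B * 2 powr M * C"
  have B: "B \<ge> 1/2" by (simp add: B_def)
  have K: "K > 0" using C by (simp add: K_def)
  have right: "norm (riemann_zeta s) \<le> C * (1 + norm s) ^ 3" if s: "Re s \<ge> - 1/2" "\<bar>Im s\<bar> \<ge> 1" for s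
  proof -
    have "norm (s - 1) \<ge> 1" using abs_Im_le_cmod[of "s - 1"] s by simp
    moreover have "norm (riemann_zeta s) = norm (zeta_half s) / norm (s - 1)"
    proof -
      have "s \<noteq> 1" using s(2) by auto
      thus ?thesis using riemann_zeta_half[of s] s by (simp add: norm_divide)
    qed
    moreover have "norm (zeta_half s) / norm (s - 1) \<le> norm (zeta_half s) / 1"
      using \<open>norm (s - 1) \<ge> 1\<close> by (intro divide_left_mono) auto
    ultimately show ?thesis using C(2)[OF s(1)] by linarith
  qed
  have "norm (riemann_zeta s) \<le> (C + K) * (1 + norm s) powr M" if s: "Re s \<ge> - A" "Im s \<ge> 1" for s
  proof (cases "Re s \<ge> - 1/2")
    case True
    have "norm (riemann_zeta s) \<le> C * (1 + norm s) ^ 3" using right True s by simp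
    also have "(1 + norm s) ^ 3 = (1 + norm s) powr 3" by (simp add: add_pos_nonneg)
    also have "C * \<dots> \<le> (C + K) * (1 + norm s) powr M"
      using C K B by (intro mult_mono powr_mono) (auto simp: M_def)
    finally show ?thesis .
  next
    case False
    have n1: "norm (1 - s) \<le> 1 + norm s" using norm_triangle_ineq4[of 1 s] by simp
    have n2: "norm (1 - s) \<ge> 1" using abs_Im_le_cmod[of "1 - s"] s by simp
    have e3: "(1::real) \<le> exp 3" by simp
    have "exp 3 * norm (1 - s) \<ge> 1 * 1" using n2 e3 by (intro mult_mono) auto
    have "norm (chi s) \<le> (exp 3 * norm (1 - s)) powr (1/2 - Re s)"
      using False s by (intro norm_chi_le) auto
    also have "\<dots> \<le> (exp 3 * (1 + norm s)) powr (1/2 - Re s)"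
      using n1 False by (intro powr_mono2 mult_left_mono) auto
    also have "\<dots> \<le> (exp 3 * (1 + norm s)) powr B"
      using s e3 mult_mono[of 1 "exp 3" 1 "1 + norm s"] by (intro powr_mono) (auto simp: B_def)
    also have "\<dots> = exp 3 powr B * (1 + norm s) powr B" by (rule powr_mult)
    finally have c: "norm (chi s) \<le> exp 3 powr B * (1 + norm s) powr B" .
    have "norm (riemann_zeta (1 - s)) \<le> C * (1 + norm (1 - s)) ^ 3" using right[of "1 - s"] False s by simp
    also have "\<dots> \<le> C * (2 * (1 + norm s)) ^ 3"
    proof -
      have "1 + norm (1 - s) \<le> 2 * (1 + norm s)" using n1 norm_ge_zero[of s] by argo
      thus ?thesis using C by (intro mult_left_mono power_mono) auto
    qed
    also have "(2 * (1 + norm s)) ^ 3 = (2 * (1 + norm s)) powr 3" by (simp add: add_pos_nonneg)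
    also have "\<dots> = 2 powr 3 * (1 + norm s) powr 3" by (rule powr_mult)
    also have "C * (2 powr 3 * (1 + norm s) powr 3) \<le> C * (2 powr M * (1 + norm s) powr 3)"
      using C B by (intro mult_left_mono mult_right_mono powr_mono) (auto simp: M_def)
    finally have z: "norm (riemann_zeta (1 - s)) \<le> C * (2 powr M * (1 + norm s) powr 3)" .
    have "norm (riemann_zeta s) = norm (chi s) * norm (riemann_zeta (1 - s))"
      using riemann_zeta_functional[of s] False by (simp add: norm_mult)
    also have "\<dots> \<le> (exp 3 powr B * (1 + norm s) powr B) * (C * (2 powr M * (1 + norm s) powr 3))"
      using c z by (intro mult_mono) auto
    also have "\<dots> = K * (1 + norm s) powr M"
      by (simp add: K_def M_def powr_add)
    also have "\<dots> \<le> (C + K) * (1 + norm s) powr M" using C by (intro mult_right_mono) auto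
    finally show ?thesis .
  qed
  thus ?thesis using that[of "C + K" M] C K B by (auto simp: M_def)
qed

text \<open>Cauchy's estimate on unit discs, which is why the growth of zeta is taken one unit
  further to the left. Im s >= 3 keeps these discs away from the pole.\<close>

lemma zeta_deriv_growth:
  obtains C M :: real where "C > 0" "M \<ge> 0" "\<And>s. Re s \<ge> - A \<Longrightarrow> Im s \<ge> 3 \<Longrightarrow> norm (zeta_deriv k s - a) \<le> C * (1 + norm s) powr M"
proof -
  obtain C M where C: "C > 0" "M \<ge> 0" "\<And>s. Re s \<ge> - (A + 1) \<Longrightarrow> Im s \<ge> 1 \<Longrightarrow> norm (riemann_zeta s) \<le> C * (1 + norm s) powr M"
    using riemann_zeta_growth by blast
  define K where "K = fact k * (C * 2 powr M) * 2 + norm a"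
  have fk: "(fact k :: real) \<ge> 1" by (rule fact_ge_1)
  have K: "K > 0" using C fk by (simp add: K_def add_pos_nonneg)
  have "norm (zeta_deriv k s - a) \<le> K * (1 + norm s) powr M" if s: "Re s \<ge> - A" "Im s \<ge> 3" for s
  proof -
    define B where "B = C * 2 powr M * (1 + norm s) powr M"
    have "1 + norm s \<noteq> 0" using norm_ge_zero[of s] by linarith
    hence B: "B > 0" using C by (simp add: B_def)
    have bnd: "norm (riemann_zeta w) \<le> B" "w \<noteq> 1" if w: "w \<in> cball s 1" for w
    proof -
      have d: "norm (w - s) \<le> 1" using w by (simp add: dist_norm norm_minus_commute)
      hence re: "Re w \<ge> - (A + 1)" "Im w \<ge> 1"
        using s abs_Re_le_cmod[of "w - s"] abs_Im_le_cmod[of "w - s"] by auto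
      thus "w \<noteq> 1" by auto
      have "norm w \<le> norm s + 1" using norm_triangle_ineq[of "w - s" s] d by simp
      hence "1 + norm w \<le> 2 * (1 + norm s)" using norm_ge_zero[of s] by argo
      hence "(1 + norm w) powr M \<le> (2 * (1 + norm s)) powr M" using C by (intro powr_mono2) auto
      also have "\<dots> = 2 powr M * (1 + norm s) powr M" by (rule powr_mult)
      finally have "C * (1 + norm w) powr M \<le> B" using C by (simp add: B_def)
      thus "norm (riemann_zeta w) \<le> B" using C(3)[OF re] by linarith
    qed
    have zd: "norm (zeta_deriv k s) \<le> fact k * (2 * B)"
    proof (cases "k = 0")
      case True thus ?thesis using bnd(1)[of s] B by (simp add: zeta_deriv_0)
    next
      case False
      have ss: "cball s 1 \<subseteq> UNIV - {1}" "ball s 1 \<subseteq> UNIV - {1}"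
        using bnd(2) ball_subset_cball[of s 1] by blast+
      have "norm ((deriv ^^ k) riemann_zeta s) \<le> fact k * (2 * B) / 1 ^ k"
      proof (rule Cauchy_higher_deriv_bound[where y = 0])
        show "continuous_on (cball s 1) riemann_zeta"
          by (rule holomorphic_on_imp_continuous_on[OF holomorphic_on_subset[OF holomorphic_on_riemann_zeta ss(1)]])
        show "riemann_zeta holomorphic_on ball s 1"
          by (rule holomorphic_on_subset[OF holomorphic_on_riemann_zeta ss(2)])
        fix w assume "w \<in> ball s 1"
        thus "riemann_zeta w \<in> ball 0 (2 * B)" using bnd(1)[of w] B by auto
      qed (use False in auto)
      thus ?thesis by (simp add: zeta_deriv_def)
    qed
    have "norm (zeta_deriv k s - a) \<le> norm (zeta_deriv k s) + norm a" by (rule norm_triangle_ineq4)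
    also have "\<dots> \<le> fact k * (2 * B) + norm a * (1 + norm s) powr M"
    proof -
      have "1 \<le> (1 + norm s) powr M" using C by (intro ge_one_powr_ge_zero) auto
      hence "norm a * 1 \<le> norm a * (1 + norm s) powr M" by (intro mult_left_mono) auto
      thus ?thesis using zd by simp
    qed
    also have "\<dots> = K * (1 + norm s) powr M" by (simp add: K_def B_def algebra_simps)
    finally show ?thesis .
  qed
  thus ?thesis using that[OF K C(2)] by blast
qed

section \<open>Backlund's argument\<close>

text \<open>Every point of Z is divided out once, through a removable singularity; any further
  multiplicity remains in g, which is enough for counting distinct points.\<close>

lemma holomorphic_factor_zeros:
  assumes f: "f holomorphic_on S" and S: "open S" and Z: "finite Z" "Z \<subseteq> S" "\<And>z. z \<in> Z \<Longrightarrow> f z = 0"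
  obtains g where "g holomorphic_on S" "\<And>w. w \<in> S \<Longrightarrow> f w = g w * (\<Prod>z\<in>Z. w - z)"
proof -
  have "\<exists>g. g holomorphic_on S \<and> (\<forall>w\<in>S. f w = g w * (\<Prod>z\<in>Z. w - z))"
    using Z
  proof (induction Z rule: finite_induct)
    case empty
    thus ?case using f by auto
  next
    case (insert a Z)
    then obtain g where g: "g holomorphic_on S" "\<And>w. w \<in> S \<Longrightarrow> f w = g w * (\<Prod>z\<in>Z. w - z)" by auto
    have a: "a \<in> S" "f a = 0" using insert.prems by auto
    have "(\<Prod>z\<in>Z. a - z) \<noteq> 0" using insert.hyps by auto
    hence ga: "g a = 0" using g(2)[OF a(1)] a(2) by auto
    define h where "h = (\<lambda>z. if z = a then deriv g a else (g z - g a) / (z - a))"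
    have "h holomorphic_on S" unfolding h_def using a(1) S by (intro pole_lemma g) (simp add: interior_open)
    moreover have "f w = h w * (\<Prod>z\<in>insert a Z. w - z)" if "w \<in> S" for w
      using insert.hyps g(2)[OF that] ga a by (simp add: h_def)
    ultimately show ?case by blast
  qed
  thus ?thesis using that by blast
qed

text \<open>A Jensen type bound from the maximum modulus principle: on the circle of radius 3 r each
  linear factor is at least 2 r, at the centre at most r, so each zero gains a factor 2.\<close>

lemma two_power_card_zeros_le:
  assumes f: "f holomorphic_on S" and S: "open S" "cball c (3 * r) \<subseteq> S" and r: "r > 0"
    and B: "\<And>w. w \<in> cball c (3 * r) \<Longrightarrow> norm (f w) \<le> B"
    and Z: "finite Z" "Z \<subseteq> cball c r" "\<And>z. z \<in> Z \<Longrightarrow> f z = 0"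
  shows "norm (f c) * 2 ^ card Z \<le> B"
proof -
  have sub: "cball c r \<subseteq> cball c (3 * r)" using r by auto
  have ZS: "Z \<subseteq> S" using Z(2) sub S(2) by blast
  obtain g where g: "g holomorphic_on S" "\<And>w. w \<in> S \<Longrightarrow> f w = g w * (\<Prod>z\<in>Z. w - z)"
    using holomorphic_factor_zeros[OF f S(1) Z(1) ZS Z(3)] by blast
  have cS: "c \<in> S" using S(2) r by auto
  have "norm (g c) \<le> B / (2 * r) ^ card Z"
  proof (rule maximum_modulus_frontier[of g "cball c (3 * r)"])
    show "g holomorphic_on interior (cball c (3 * r))"
      using S(2) by (intro holomorphic_on_subset[OF g(1)]) (auto simp: less_imp_le)
    show "continuous_on (closure (cball c (3 * r))) g"
      using S(2) by (intro holomorphic_on_imp_continuous_on holomorphic_on_subset[OF g(1)]) auto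
    show "c \<in> cball c (3 * r)" using r by simp
    fix w assume "w \<in> frontier (cball c (3 * r))"
    hence w: "dist c w = 3 * r" using r by auto
    hence wS: "w \<in> S" "w \<in> cball c (3 * r)" using S(2) by auto
    have "(2 * r) ^ card Z = (\<Prod>z\<in>Z. 2 * r)" by simp
    also have "\<dots> \<le> (\<Prod>z\<in>Z. norm (w - z))"
    proof (rule prod_mono)
      fix z assume "z \<in> Z"
      hence "dist c z \<le> r" using Z(2) by auto
      hence "2 * r \<le> dist w z" using w dist_triangle[of c w z] by (simp add: dist_commute)
      thus "0 \<le> 2 * r \<and> 2 * r \<le> norm (w - z)" using r by (simp add: dist_norm)
    qed
    also have "\<dots> = norm (\<Prod>z\<in>Z. w - z)" by (rule prod_norm)
    finally have p: "(2 * r) ^ card Z \<le> norm (\<Prod>z\<in>Z. w - z)" .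
    have "norm (g w) * (2 * r) ^ card Z \<le> norm (g w) * norm (\<Prod>z\<in>Z. w - z)" using p by (intro mult_left_mono) auto
    also have "\<dots> = norm (f w)" using g(2)[OF wS(1)] by (simp add: norm_mult)
    also have "\<dots> \<le> B" by (rule B[OF wS(2)])
    finally show "norm (g w) \<le> B / (2 * r) ^ card Z" using r by (simp add: field_simps)
  qed auto
  moreover have "norm (\<Prod>z\<in>Z. c - z) \<le> r ^ card Z"
  proof -
    have "(\<Prod>z\<in>Z. norm (c - z)) \<le> (\<Prod>z\<in>Z. r)"
      using Z(2) by (intro prod_mono) (auto simp: dist_norm)
    thus ?thesis by (simp add: prod_norm)
  qed
  ultimately have "norm (f c) \<le> B / (2 * r) ^ card Z * r ^ card Z"
    unfolding g(2)[OF cS] norm_mult by (intro mult_mono) (auto intro: order_trans[OF norm_ge_zero])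
  also have "\<dots> = B / 2 ^ card Z" using r by (simp add: power_mult_distrib)
  finally show ?thesis by (simp add: field_simps)
qed

text \<open>By compactness some thickening of the segment still avoids the zeros of f. A thickened
  segment is convex, so a holomorphic logarithm exists on it.\<close>

lemma holomorphic_log_near_segment:
  assumes f: "f holomorphic_on S" "open S" and seg: "closed_segment a b \<subseteq> S" "\<And>z. z \<in> closed_segment a b \<Longrightarrow> f z \<noteq> 0"
  obtains U g where "open U" "convex U" "closed_segment a b \<subseteq> U" "\<And>z. z \<in> U \<Longrightarrow> exp (g z) = f z"
    "\<And>z. z \<in> U \<Longrightarrow> (g has_field_derivative deriv f z / f z) (at z)"
proof -
  define V where "V = S \<inter> f -` (- {0})"
  have V: "open V" unfolding V_def
    by (intro continuous_open_preimage holomorphic_on_imp_continuous_on f) auto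
  obtain e where e: "e > 0" "(\<Union>x\<in>closed_segment a b. ball x e) \<subseteq> V"
  proof -
    have "closed_segment a b \<subseteq> V" using seg by (auto simp: V_def)
    from compact_subset_open_imp_ball_epsilon_subset[OF compact_segment V this] that show ?thesis by metis
  qed
  define U where "U = (\<Union>x\<in>closed_segment a b. \<Union>y\<in>ball 0 e. {x + y})"
  have U1: "convex U" unfolding U_def by (intro convex_sums) auto
  have U2: "open U" unfolding U_def by (intro open_sums) auto
  have U3: "closed_segment a b \<subseteq> U" unfolding U_def using e(1) by force
  have U4: "U \<subseteq> V" unfolding U_def using e(2) by (fastforce simp: dist_norm)
  have aU: "a \<in> U" using U3 by auto
  have fU: "f holomorphic_on U" by (rule holomorphic_on_subset[OF f(1)]) (use U4 in \<open>auto simp: V_def\<close>)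
  have nz: "f x \<noteq> 0" if "x \<in> U" for x using that U4 by (auto simp: V_def)
  obtain g where g: "g holomorphic_on U" "\<And>x. x \<in> U \<Longrightarrow> exp (g x) = f x"
    using holomorphic_logarithm_exists[OF U1 U2 fU nz aU] by blast
  have "(g has_field_derivative deriv f z / f z) (at z)" if z: "z \<in> U" for z
  proof -
    have d: "(g has_field_derivative deriv g z) (at z)" using g(1) U2 z holomorphic_derivI by blast
    hence "((\<lambda>z. exp (g z)) has_field_derivative exp (g z) * deriv g z) (at z)" by (rule DERIV_fun_exp)
    hence "(f has_field_derivative exp (g z) * deriv g z) (at z)"
      by (rule has_field_derivative_transform_within_open[OF _ U2 z]) (use g(2) in auto)
    hence "deriv f z = f z * deriv g z" using g(2)[OF z] DERIV_imp_deriv by force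
    thus ?thesis using d nz[OF z] by simp
  qed
  thus ?thesis using that[OF U2 U1 U3 g(2)] by blast
qed

text \<open>Each time the argument of f varies by pi along the segment, the real part of f, normalised by
  its argument at c, vanishes there; by reflection in the horizontal line through c it is the
  restriction of a holomorphic function, whose zeros are counted with the previous bound.\<close>
lemma two_power_floor_arg_le:
  assumes f: "f holomorphic_on S" and S: "open S" "cball c (3 * r) \<subseteq> S" and r: "r > 0"
    and B: "\<And>w. w \<in> cball c (3 * r) \<Longrightarrow> norm (f w) \<le> B"
    and nz: "\<And>z. z \<in> closed_segment c (c - of_real r) \<Longrightarrow> f z \<noteq> 0"
  shows "norm (f c) * 2 ^ (nat \<lfloor>\<bar>Im (contour_integral (linepath c (c - of_real r)) (\<lambda>z. deriv f z / f z))\<bar> / pi\<rfloor>) \<le> B"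
proof -
  have seg: "closed_segment c (c - of_real r) \<subseteq> S"
  proof -
    have "closed_segment c (c - of_real r) \<subseteq> cball c (3 * r)"
      using r by (intro closed_segment_subset) (auto simp: dist_norm)
    thus ?thesis using S(2) by blast
  qed
  obtain U g where U: "open U" "convex U" "closed_segment c (c - of_real r) \<subseteq> U"
    and g: "\<And>z. z \<in> U \<Longrightarrow> exp (g z) = f z" "\<And>z. z \<in> U \<Longrightarrow> (g has_field_derivative deriv f z / f z) (at z)"
    using holomorphic_log_near_segment[OF f S(1) seg nz] by blast
  have inU: "c - of_real x \<in> U" if "x \<in> {0..r}" for x
  proof -
    have "c - of_real x = (1 - x / r) *\<^sub>R c + (x / r) *\<^sub>R (c - of_real r)"
    proof -
      have kr: "of_real (x / r) * of_real r = (of_real x :: complex)" using r by simp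
      have "c - k * R = (1 - k) * c + k * (c - R)" for k R by (simp add: algebra_simps)
      from this[of "of_real (x / r)" "of_real r"] show ?thesis unfolding kr
        by (simp only: scaleR_conv_of_real of_real_diff of_real_1)
    qed
    hence "c - of_real x \<in> closed_segment c (c - of_real r)"
      unfolding closed_segment_def using that r by (auto intro!: exI[of _ "x / r"])
    thus ?thesis using U by blast
  qed
  define D where "D = Im (contour_integral (linepath c (c - of_real r)) (\<lambda>z. deriv f z / f z))"
  have "((\<lambda>z. deriv f z / f z) has_contour_integral (g (c - of_real r) - g c)) (linepath c (c - of_real r))"
    using contour_integral_primitive[of U g "\<lambda>z. deriv f z / f z" "linepath c (c - of_real r)"] g(2) U(3)
    by (auto intro: has_field_derivative_at_within)
  hence D: "D = Im (g (c - of_real r) - g c)" unfolding D_def by (simp add: contour_integral_unique)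
  define \<phi> where "\<phi> = (\<lambda>x. \<bar>Im (g (c - of_real x) - g c)\<bar>)"
  have cont: "continuous_on {0..r} \<phi>"
  proof -
    have cg: "continuous_on U g" by (intro continuous_at_imp_continuous_on ballI DERIV_isCont[OF g(2)])
    have "continuous_on {0..r} (\<lambda>x. g (c - of_real x))"
      by (rule continuous_on_compose2[OF cg]) (use inU in \<open>auto intro!: continuous_intros\<close>)
    thus ?thesis unfolding \<phi>_def by (intro continuous_intros)
  qed
  have \<phi>0: "\<phi> 0 = 0" and \<phi>r: "\<phi> r = \<bar>D\<bar>" by (simp_all add: \<phi>_def D)
  define m where "m = nat \<lfloor>\<bar>D\<bar> / pi\<rfloor>"
  have mle: "real m * pi \<le> \<bar>D\<bar>"
  proof -
    have "\<lfloor>\<bar>D\<bar> / pi\<rfloor> \<ge> 0" by simp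
    hence "real m \<le> \<bar>D\<bar> / pi" unfolding m_def by simp
    thus ?thesis by (simp add: field_simps)
  qed
  \<comment> \<open>These are the positive zeros of the cosine. A variation of at least m pi passes
    m of them, so the intermediate value theorem yields m points.\<close>
  have "\<exists>x\<in>{0..r}. \<phi> x = pi / 2 + real j * pi" if j: "j < m" for j
  proof -
    have "real j + 1 \<le> real m" using j by simp
    hence "(real j + 1) * pi \<le> real m * pi" by (intro mult_right_mono) auto
    hence "real j * pi + pi \<le> \<bar>D\<bar>" using mle by (simp add: algebra_simps)
    hence "pi / 2 + real j * pi \<le> \<phi> r" unfolding \<phi>r using pi_gt_zero by linarith
    moreover have "\<phi> 0 \<le> pi / 2 + real j * pi" unfolding \<phi>0 by simp
    ultimately show ?thesis using IVT'[of \<phi> 0 "pi / 2 + real j * pi" r] cont r by auto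
  qed
  then obtain X where X: "\<And>j. j < m \<Longrightarrow> X j \<in> {0..r} \<and> \<phi> (X j) = pi / 2 + real j * pi" by metis
  have fc: "f c \<noteq> 0" using nz by auto
  define \<theta> where "\<theta> = cnj (f c) / norm (f c)"
  have n\<theta>: "norm \<theta> = 1" using fc by (simp add: \<theta>_def norm_divide)
  have \<theta>fc: "\<theta> * f c = of_real (norm (f c))"
    using fc by (simp add: \<theta>_def complex_norm_square[symmetric] mult.commute power2_eq_square field_simps flip: of_real_mult)
  \<comment> \<open>The translate of S to the origin, cut down to a set symmetric under conjugation,
    where f and its reflection are both available.\<close>
  define S' where "S' = (\<lambda>w. w + c) -` S \<inter> cnj -` ((\<lambda>w. w + c) -` S)"
  have S'o: "open S'" unfolding S'_def using S(1)
    by (intro open_Int open_vimage continuous_intros)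
  define G where "G = (\<lambda>w. (\<theta> * f (w + c) + cnj (\<theta> * f (cnj w + c))) / 2)"
  have Gh: "G holomorphic_on S'"
  proof -
    have h1: "(\<lambda>w. \<theta> * f (w + c)) holomorphic_on ((\<lambda>w. w + c) -` S)"
      by (intro holomorphic_intros holomorphic_on_compose[unfolded o_def, of "\<lambda>w. w + c" _ f] holomorphic_on_subset[OF f]) auto
    have "(\<lambda>w. \<theta> * f (w + c)) holomorphic_on S'" by (rule holomorphic_on_subset[OF h1]) (auto simp: S'_def)
    moreover have "(\<lambda>w. cnj (\<theta> * f (cnj w + c))) holomorphic_on S'"
      unfolding o_def[symmetric, of cnj "\<lambda>w. \<theta> * f (cnj w + c)"]
        o_def[symmetric, of "\<lambda>w. \<theta> * f (w + c)" cnj] o_assoc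
      by (rule holomorphic_on_compose_cnj_cnj[OF holomorphic_on_subset[OF h1] S'o]) (auto simp: S'_def)
    ultimately show ?thesis unfolding G_def by (intro holomorphic_on_divide holomorphic_on_add holomorphic_on_const) auto
  qed
  have Gre: "G (of_real x) = of_real (Re (\<theta> * f (c + of_real x)))" for x
    unfolding G_def complex_cnj_complex_of_real complex_add_cnj by (simp add: add.commute[of c])
  have sub: "cball 0 (3 * r) \<subseteq> S'"
  proof
    fix w :: complex assume "w \<in> cball 0 (3 * r)"
    hence w: "norm w \<le> 3 * r" by simp
    have "w + c \<in> cball c (3 * r)" "cnj w + c \<in> cball c (3 * r)" using w by (auto simp: dist_norm)
    thus "w \<in> S'" using S(2) by (auto simp: S'_def)
  qed
  have GB: "norm (G w) \<le> B" if "w \<in> cball 0 (3 * r)" for w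
  proof -
    have w: "norm w \<le> 3 * r" using that by simp
    have "w + c \<in> cball c (3 * r)" "cnj w + c \<in> cball c (3 * r)" using w by (auto simp: dist_norm)
    hence "norm (\<theta> * f (w + c)) \<le> B" "norm (cnj (\<theta> * f (cnj w + c))) \<le> B"
      using B n\<theta> by (simp_all add: norm_mult)
    hence "norm (\<theta> * f (w + c) + cnj (\<theta> * f (cnj w + c))) \<le> 2 * B"
      using norm_triangle_ineq[of "\<theta> * f (w + c)" "cnj (\<theta> * f (cnj w + c))"] by linarith
    thus ?thesis by (simp add: G_def norm_divide)
  qed
  define Z where "Z = (\<lambda>j. complex_of_real (- X j)) ` {..<m}"
  have inj: "inj_on (\<lambda>j. complex_of_real (- X j)) {..<m}"
  proof (rule inj_onI)
    fix i j assume ij: "i \<in> {..<m}" "j \<in> {..<m}" "complex_of_real (- X i) = complex_of_real (- X j)"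
    hence "X i = X j" by (simp only: of_real_eq_iff neg_equal_iff_equal)
    hence "pi / 2 + real i * pi = pi / 2 + real j * pi" using X ij by (metis lessThan_iff)
    thus "i = j" by simp
  qed
  have cardZ: "card Z = m" unfolding Z_def by (simp only: card_image[OF inj] card_lessThan)
  have "norm (G 0) * 2 ^ card Z \<le> B"
  proof (rule two_power_card_zeros_le[OF Gh S'o sub r GB])
    show "finite Z" by (simp add: Z_def)
    show "Z \<subseteq> cball 0 r" unfolding Z_def using X by auto
    fix z assume "z \<in> Z"
    then obtain j where j: "j < m" "z = of_real (- X j)" by (auto simp: Z_def)
    define l where "l = g (c - of_real (X j)) - g c"
    have "f (c - of_real (X j)) = exp (g (c - of_real (X j)))" "f c = exp (g c)"
      using g(1) inU X[OF j(1)] inU[of 0] r by auto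
    hence "f (c - of_real (X j)) = f c * exp l" by (simp add: l_def exp_diff)
    hence "\<theta> * f (c - of_real (X j)) = of_real (norm (f c)) * exp l" by (simp add: \<theta>fc flip: mult.assoc)
    hence "Re (\<theta> * f (c - of_real (X j))) = norm (f c) * (exp (Re l) * cos (Im l))" by (simp add: Re_exp)
    moreover have "cos (Im l) = 0"
    proof -
      have "\<bar>Im l\<bar> = pi / 2 + real j * pi" using X[OF j(1)] by (simp add: \<phi>_def l_def)
      hence "cos \<bar>Im l\<bar> = 0" by (simp add: cos_add)
      thus ?thesis by simp
    qed
    ultimately have "Re (\<theta> * f (c + of_real (- X j))) = 0" by simp
    thus "G z = 0" unfolding j(2) Gre by simp
  qed
  moreover have "G 0 = of_real (norm (f c))" using Gre[of 0] \<theta>fc by simp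
  ultimately show ?thesis unfolding cardZ m_def D_def by simp
qed

section \<open>Counting a-points\<close>

text \<open>The constant C stands outside the exponential so that no logarithm of a constant factor
  or of a sign has to be chosen.\<close>

lemma contour_integral_log_deriv:
  assumes U: "open U" "path_image \<gamma> \<subseteq> U" "valid_path \<gamma>"
    and g: "\<And>z. z \<in> U \<Longrightarrow> (g has_field_derivative g' z) (at z)"
    and F: "\<And>z. z \<in> U \<Longrightarrow> F z = C * exp (g z)" and C: "C \<noteq> 0"
  shows "((\<lambda>z. deriv F z / F z) has_contour_integral (g (pathfinish \<gamma>) - g (pathstart \<gamma>))) \<gamma>"
proof -
  have "deriv F z / F z = g' z" if z: "z \<in> U" for z
  proof -
    have "((\<lambda>z. C * exp (g z)) has_field_derivative C * (exp (g z) * g' z)) (at z)"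
      by (intro DERIV_cmult DERIV_fun_exp g z)
    hence "(F has_field_derivative C * (exp (g z) * g' z)) (at z)"
      by (rule has_field_derivative_transform_within_open[OF _ U(1) z]) (use F in auto)
    hence "deriv F z = C * (exp (g z) * g' z)" by (rule DERIV_imp_deriv)
    thus ?thesis using F[OF z] C by simp
  qed
  hence *: "(g has_field_derivative deriv F z / F z) (at z within U)" if "z \<in> U" for z
    using g[OF that] that by (auto intro: has_field_derivative_at_within)
  show ?thesis by (rule contour_integral_primitive[OF * U(3,2)])
qed

lemma Re_pos_of_near_1:
  assumes "norm (z - 1) \<le> 1/2"
  shows "Re z > 0" "z \<noteq> 0" "z \<notin> \<real>\<^sub>\<le>\<^sub>0"
proof -
  have "\<bar>Re (z - 1)\<bar> \<le> 1/2" using abs_Re_le_cmod[of "z - 1"] assms by linarith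
  hence "1 - Re z \<le> 1/2" using abs_ge_minus_self[of "Re (z - 1)"] by simp
  thus "Re z > 0" by simp
  thus "z \<noteq> 0" "z \<notin> \<real>\<^sub>\<le>\<^sub>0" by (auto simp: complex_nonpos_Reals_iff)
qed

lemma abs_Im_Ln_le: "z \<noteq> 0 \<Longrightarrow> \<bar>Im (Ln z)\<bar> \<le> pi"
  using mpi_less_Im_Ln[of z] Im_Ln_le_pi[of z] by auto

section \<open>Variation of the argument along the edges of the rectangle\<close>

lemma deriv_bound_imp_ln_growth:
  fixes D :: "real \<Rightarrow> real"
  assumes D: "\<And>t. t \<ge> b \<Longrightarrow> (D has_real_derivative D' t) (at t)" and b: "b > 0"
    and D': "\<And>t. t \<ge> b \<Longrightarrow> \<bar>D' t\<bar> \<le> K / t" and T: "T \<ge> b"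
  shows "\<bar>D T - D b\<bar> \<le> K * (ln T - ln b)"
proof -
  have "K * ln b - D b \<le> K * ln T - D T"
  proof (rule DERIV_nonneg_imp_nondecreasing[OF T])
    fix t assume t: "b \<le> t" "t \<le> T"
    have "((\<lambda>t. K * ln t - D t) has_real_derivative K * (1 / t) - D' t) (at t)"
      using t b D by (auto intro!: derivative_eq_intros)
    moreover have "K * (1 / t) - D' t \<ge> 0" using D'[OF t(1)] by simp
    ultimately show "\<exists>y. ((\<lambda>t. K * ln t - D t) has_real_derivative y) (at t) \<and> 0 \<le> y" by blast
  qed
  moreover have "K * ln b + D b \<le> K * ln T + D T"
  proof (rule DERIV_nonneg_imp_nondecreasing[OF T])
    fix t assume t: "b \<le> t" "t \<le> T"
    have "((\<lambda>t. K * ln t + D t) has_real_derivative K * (1 / t) + D' t) (at t)"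
      using t b D by (auto intro!: derivative_eq_intros)
    moreover have "K * (1 / t) + D' t \<ge> 0" using D'[OF t(1)] by simp
    ultimately show "\<exists>y. ((\<lambda>t. K * ln t + D t) has_real_derivative y) (at t) \<and> 0 \<le> y" by blast
  qed
  ultimately show ?thesis by (simp add: algebra_simps abs_le_iff)
qed

text \<open>Along a vertical line the derivative of the argument of chi is Re(chi'/chi) = - ln(t /
  (2 pi)) + O(1/t), and integrating the error gives the logarithm. In 4 + X, the 3 is the Stirling
  error and 1 + X pays for replacing ln |1 - s| by ln t.\<close>

lemma Im_log_chi_vertical:
  assumes X: "X \<ge> 1" and b: "b > 0"
    and g: "\<And>s. s \<in> quadrant \<Longrightarrow> (g has_field_derivative chi_ld s) (at s)"
    and T: "T \<ge> b"
  shows "\<bar>Im (g (Complex (- X) T)) - Im (g (Complex (- X) b)) + (T * (ln (T / (2 * pi)) - 1)) - (b * (ln (b / (2 * pi)) - 1))\<bar> \<le> (4 + X) * (ln T - ln b)"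
proof -
  define D where "D = (\<lambda>t. Im (g (Complex (- X) t)) + t * (ln (t / (2 * pi)) - 1))"
  have "\<bar>D T - D b\<bar> \<le> (4 + X) * (ln T - ln b)"
  proof (rule deriv_bound_imp_ln_growth[OF _ b _ T])
    fix t assume t: "t \<ge> b"
    hence t0: "t > 0" using b by simp
    have "((\<lambda>t. Complex (- X) t) has_vector_derivative \<i>) (at t)"
      unfolding Complex_eq by (auto intro!: derivative_eq_intros)
    hence "((\<lambda>t. g (Complex (- X) t)) has_vector_derivative \<i> * chi_ld (Complex (- X) t)) (at t)"
      using field_vector_diff_chain_at[of "\<lambda>t. Complex (- X) t" \<i> t g "chi_ld (Complex (- X) t)"] g[of "Complex (- X) t"] X t0
      by (simp add: quadrant o_def)
    hence "((\<lambda>t. Im (g (Complex (- X) t))) has_vector_derivative Im (\<i> * chi_ld (Complex (- X) t))) (at t)"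
      by (rule bounded_linear.has_vector_derivative[OF bounded_linear_Im])
    hence d1: "((\<lambda>t. Im (g (Complex (- X) t))) has_real_derivative Re (chi_ld (Complex (- X) t))) (at t)"
      by (simp add: has_real_derivative_iff_has_vector_derivative)
    have d2: "((\<lambda>t. t * (ln (t / (2 * pi)) - 1)) has_real_derivative ln (t / (2 * pi))) (at t)"
      using t0 by (auto intro!: derivative_eq_intros)
    show "(D has_real_derivative Re (chi_ld (Complex (- X) t)) + ln (t / (2 * pi))) (at t)"
      unfolding D_def by (intro DERIV_add d1 d2)
    define N where "N = norm (1 - Complex (- X) t)"
    have N1: "N \<ge> t" using abs_Im_le_cmod[of "1 - Complex (- X) t"] t0 by (simp add: N_def)
    have N2: "N \<le> t + (1 + X)" using cmod_le[of "1 - Complex (- X) t"] X t0 by (simp add: N_def)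
    have "ln (N / t) \<le> N / t - 1" using N1 t0 by (intro ln_le_minus_one) auto
    also have "N / t \<le> (t + (1 + X)) / t" using N2 t0 by (intro divide_right_mono) auto
    also have "(t + (1 + X)) / t - 1 = (1 + X) / t" using t0 by (simp add: add_divide_distrib)
    finally have a: "ln N - ln t \<le> (1 + X) / t" using N1 t0 by (simp add: ln_div)
    have a0: "ln t \<le> ln N" using N1 t0 by simp
    have "\<bar>Re (chi_ld (Complex (- X) t)) + ln N - ln (2 * pi)\<bar> \<le> 3 / t"
      using Re_chi_ld[of "Complex (- X) t"] X t0 by (simp add: N_def)
    moreover have "ln (t / (2 * pi)) = ln t - ln (2 * pi)" using t0 by (simp add: ln_div)
    moreover have "3 / t + (1 + X) / t = (4 + X) / t" by (simp add: add_divide_distrib[symmetric])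
    ultimately show "\<bar>Re (chi_ld (Complex (- X) t)) + ln (t / (2 * pi))\<bar> \<le> (4 + X) / t"
      using a a0 by linarith
  qed
  thus ?thesis by (simp add: D_def algebra_simps)
qed

definition zeta_count :: "nat \<Rightarrow> complex \<Rightarrow> real \<Rightarrow> nat" where
  "zeta_count k a T = (\<Sum>p | zeta_deriv k p = a \<and> 1 < Im p \<and> Im p \<le> T. a_point_mult k a p)"

text \<open>One abscissa X serves all purposes: beyond it there are no a-points above height 1/2,
  both vertical edges lie where the factorisations hold, and the difference to a is bounded below on
  the right edge, as Backlund's argument needs at its centre. The left edge is oriented downwards,
  as in a counterclockwise rectangle.\<close>

lemma rectangle_setup:
  obtains X where "X \<ge> 3" "\<And>s. Im s > 1/2 \<Longrightarrow> \<bar>Re s\<bar> \<ge> X \<Longrightarrow> zeta_deriv k s \<noteq> a"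
    "\<exists>C. \<forall>b T. 1/2 < b \<and> b \<le> T \<longrightarrow> (\<lambda>z. deriv (\<lambda>s. zeta_deriv k s - a) z / (zeta_deriv k z - a)) contour_integrable_on (linepath (Complex X b) (Complex X T)) \<and>
       \<bar>Im (contour_integral (linepath (Complex X b) (Complex X T)) (\<lambda>z. deriv (\<lambda>s. zeta_deriv k s - a) z / (zeta_deriv k z - a))) + (T - b) * ln (real (n_ak a k))\<bar> \<le> C"
    "\<exists>C. \<forall>b T. 1/2 < b \<and> b \<le> T \<longrightarrow> (\<lambda>z. deriv (\<lambda>s. zeta_deriv k s - a) z / (zeta_deriv k z - a)) contour_integrable_on (linepath (Complex (- X) T) (Complex (- X) b)) \<and>
       \<bar>Im (contour_integral (linepath (Complex (- X) T) (Complex (- X) b)) (\<lambda>z. deriv (\<lambda>s. zeta_deriv k s - a) z / (zeta_deriv k z - a)))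
          - (T * (ln (T / (2 * pi)) - 1) - b * (ln (b / (2 * pi)) - 1))\<bar> \<le> C + (4 + X) * (ln T - ln b)"
    "\<exists>e>0. \<forall>t. norm (zeta_deriv k (Complex X t) - a) \<ge> e"
proof -
  define F where "F = (\<lambda>s. zeta_deriv k s - a)"
  define n where "n = n_ak a k"
  have n: "n > 0" by (simp add: n_def n_ak_def)
  obtain ER c v where R: "ER \<ge> 2" "c \<noteq> 0" "v holomorphic_on halfp ER"
    "\<And>s. s \<in> halfp ER \<Longrightarrow> norm (v s - 1) < 1/2"
    "\<And>s. s \<in> halfp ER \<Longrightarrow> zeta_deriv k s - a = c * of_nat (n_ak a k) powr (- s) * v s"
    by (rule zeta_deriv_minus_right[of k a]) (rule that)
  note R = R(1-4) R(5)[folded n_def]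
  have R5: "F s = c * of_nat n powr (- s) * v s" if "s \<in> halfp ER" for s using R(5)[OF that] by (simp add: F_def)
  obtain EL q w where L: "EL \<ge> 0" "q holomorphic_on corner EL (1/2)" "w holomorphic_on corner EL (1/2)"
    "\<And>s. s \<in> corner EL (1/2) \<Longrightarrow> norm (q s - 1) < 1/2"
    "\<And>s. s \<in> corner EL (1/2) \<Longrightarrow> norm (w s - 1) \<le> 1/2"
    "\<And>s. s \<in> corner EL (1/2) \<Longrightarrow> Re (chi_ld s) \<le> -1"
    "\<And>s. s \<in> corner EL (1/2) \<Longrightarrow> zeta_deriv k s - a = chi s * chi_ld s ^ k * q s * w s"
    by (rule zeta_deriv_minus_left[of k a]) (rule that)
  have L7: "F s = chi s * chi_ld s ^ k * q s * w s" if "s \<in> corner EL (1/2)" for s using L(7)[OF that] by (simp add: F_def)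
  define X where "X = max ER EL + 3"
  have X: "X \<ge> 3" "X > ER" "X > EL" using R(1) L(1) by (auto simp: X_def)
  have v: "Re (v s) > 0" "v s \<noteq> 0" "v s \<notin> \<real>\<^sub>\<le>\<^sub>0" if "s \<in> halfp ER" for s
    using Re_pos_of_near_1[of "v s"] R(4)[OF that] by auto
  have q: "Re (q s) > 0" "q s \<noteq> 0" "q s \<notin> \<real>\<^sub>\<le>\<^sub>0" if "s \<in> corner EL (1/2)" for s
    using Re_pos_of_near_1[of "q s"] L(4)[OF that] by auto
  have w: "Re (w s) > 0" "w s \<noteq> 0" "w s \<notin> \<real>\<^sub>\<le>\<^sub>0" if "s \<in> corner EL (1/2)" for s
    using Re_pos_of_near_1[of "w s"] L(5)[OF that] by auto
  have ld: "chi_ld s \<noteq> 0" "- chi_ld s \<notin> \<real>\<^sub>\<le>\<^sub>0" if "s \<in> corner EL (1/2)" for s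
    using L(6)[OF that] by (auto simp: complex_nonpos_Reals_iff)
  have cq: "s \<in> quadrant" if "s \<in> corner EL (1/2)" for s using that L(1) by (auto simp: corner quadrant)
  have nz: "zeta_deriv k s \<noteq> a" if s: "Im s > 1/2" "\<bar>Re s\<bar> \<ge> X" for s
  proof -
    have "F s \<noteq> 0"
    proof (cases "Re s \<ge> X")
      case True
      hence "s \<in> halfp ER" using X by (simp add: halfp)
      thus ?thesis using R(2) R5[of s] v[of s] n by simp
    next
      case False
      hence "s \<in> corner EL (1/2)" using X s by (simp add: corner)
      thus ?thesis using L7[of s] q[of s] w[of s] ld[of s] chi_nonzero[of s] cq[of s] by (simp add: quadrant)
    qed
    thus ?thesis by (simp add: F_def)
  qed
  have Dh: "(f has_field_derivative deriv f z) (at z)" if "f holomorphic_on U" "open U" "z \<in> U" for f U and z :: complex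
    using holomorphic_derivI that by blast
  have right: "(\<lambda>z. deriv F z / F z) contour_integrable_on (linepath (Complex X b) (Complex X T)) \<and>
     \<bar>Im (contour_integral (linepath (Complex X b) (Complex X T)) (\<lambda>z. deriv F z / F z)) + (T - b) * ln (real n)\<bar> \<le> 2 * pi" if bT: "1/2 < b \<and> b \<le> T" for b T
  proof -
    define g where "g = (\<lambda>s. - s * of_real (ln (real n)) + Ln (v s))"
    have in_r: "path_image (linepath (Complex X b) (Complex X T)) \<subseteq> halfp ER"
      unfolding path_image_linepath by (intro closed_segment_subset halfp(2)) (use X in \<open>auto simp: halfp\<close>)
    have "((\<lambda>z. deriv F z / F z) has_contour_integral (g (pathfinish (linepath (Complex X b) (Complex X T))) - g (pathstart (linepath (Complex X b) (Complex X T))))) (linepath (Complex X b) (Complex X T))"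
    proof (rule contour_integral_log_deriv[OF halfp(1) in_r _ _ _ R(2)])
      fix z assume z: "z \<in> halfp ER"
      show "(g has_field_derivative - of_real (ln (real n)) + deriv v z / v z) (at z)"
        unfolding g_def using v[OF z] Dh[OF R(3) halfp(1) z]
        by (auto intro!: derivative_eq_intros simp: field_simps)
      have "of_nat n powr (- z) = exp (- z * of_real (ln (real n)))"
        using n Ln_of_nat[of n] by (simp add: powr_def)
      moreover have "exp (g z) = exp (- z * of_real (ln (real n))) * v z"
        unfolding g_def exp_add using v[OF z] by simp
      ultimately show "F z = c * exp (g z)" using R5[OF z] by (simp only: mult.assoc)
    qed auto
    hence I: "((\<lambda>z. deriv F z / F z) has_contour_integral (g (Complex X T) - g (Complex X b))) (linepath (Complex X b) (Complex X T))" by simp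
    have e: "Im (g (Complex X T) - g (Complex X b)) + (T - b) * ln (real n) = Im (Ln (v (Complex X T))) - Im (Ln (v (Complex X b)))"
      by (simp add: g_def algebra_simps)
    have "Complex X T \<in> halfp ER" "Complex X b \<in> halfp ER" using X by (auto simp: halfp)
    hence "\<bar>Im (Ln (v (Complex X T)))\<bar> \<le> pi" "\<bar>Im (Ln (v (Complex X b)))\<bar> \<le> pi" using v abs_Im_Ln_le by auto
    hence "\<bar>Im (g (Complex X T) - g (Complex X b)) + (T - b) * ln (real n)\<bar> \<le> 2 * pi" unfolding e by linarith
    thus ?thesis using I by (auto simp: contour_integrable_on_def contour_integral_unique)
  qed
  obtain lc where lc: "\<And>s. s \<in> quadrant \<Longrightarrow> exp (lc s) = chi s"
    "\<And>s. s \<in> quadrant \<Longrightarrow> (lc has_field_derivative chi_ld s) (at s)" by (rule chi_logarithm) (rule that)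
  define CL where "CL = 2 * pi * (real k + 2)"
  have left: "(\<lambda>z. deriv F z / F z) contour_integrable_on (linepath (Complex (- X) T) (Complex (- X) b)) \<and>
     \<bar>Im (contour_integral (linepath (Complex (- X) T) (Complex (- X) b)) (\<lambda>z. deriv F z / F z))
       - (T * (ln (T / (2 * pi)) - 1) - b * (ln (b / (2 * pi)) - 1))\<bar> \<le> CL + (4 + X) * (ln T - ln b)" if bT: "1/2 < b \<and> b \<le> T" for b T
  proof -
    define h where "h = (\<lambda>s. of_nat k * Ln (- chi_ld s) + Ln (q s) + Ln (w s))"
    define g where "g = (\<lambda>s. lc s + h s)"
    have in_l: "path_image (linepath (Complex (- X) T) (Complex (- X) b)) \<subseteq> corner EL (1/2)"
      unfolding path_image_linepath by (intro closed_segment_subset corner(2)) (use X bT in \<open>auto simp: corner\<close>)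
    \<comment> \<open>The principal logarithm is taken of - \<open>chi_ld\<close>, which has
      positive real part; the sign is restored by the constant (-1)^k.\<close>
    have m1: "(-1) ^ k \<noteq> (0::complex)" by simp
    have "((\<lambda>z. deriv F z / F z) has_contour_integral (g (pathfinish (linepath (Complex (- X) T) (Complex (- X) b))) - g (pathstart (linepath (Complex (- X) T) (Complex (- X) b))))) (linepath (Complex (- X) T) (Complex (- X) b))"
    proof (rule contour_integral_log_deriv[OF corner(1) in_l _ _ _ m1])
      fix z assume z: "z \<in> corner EL (1/2)"
      have d1: "(chi_ld has_field_derivative deriv chi_ld z) (at z)"
        using Dh[OF holomorphic_on_chi_ld quadrant(1) cq[OF z]] .
      have d2: "((\<lambda>s. Ln (- chi_ld s)) has_field_derivative inverse (- chi_ld z) * (- deriv chi_ld z)) (at z)"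
        by (rule DERIV_chain2[where f = Ln and g = "\<lambda>s. - chi_ld s", OF has_field_derivative_Ln[OF ld(2)[OF z]] DERIV_minus[OF d1]])
      have d3: "((\<lambda>s. Ln (q s)) has_field_derivative inverse (q z) * deriv q z) (at z)"
        by (rule DERIV_chain2[where f = Ln and g = q, OF has_field_derivative_Ln[OF q(3)[OF z]] Dh[OF L(2) corner(1) z]])
      have d4: "((\<lambda>s. Ln (w s)) has_field_derivative inverse (w z) * deriv w z) (at z)"
        by (rule DERIV_chain2[where f = Ln and g = w, OF has_field_derivative_Ln[OF w(3)[OF z]] Dh[OF L(3) corner(1) z]])
      show "(g has_field_derivative chi_ld z + (of_nat k * (inverse (- chi_ld z) * (- deriv chi_ld z)) + inverse (q z) * deriv q z + inverse (w z) * deriv w z)) (at z)"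
        unfolding g_def h_def by (intro DERIV_add DERIV_cmult lc(2) cq z d2 d3 d4)
      have "exp (of_nat k * Ln (- chi_ld z)) = (- chi_ld z) ^ k" using ld(1)[OF z] by (simp add: exp_of_nat_mult)
      moreover have "(-1) ^ k * (- chi_ld z) ^ k = chi_ld z ^ k" by (simp flip: power_mult_distrib)
      ultimately show "F z = (-1) ^ k * exp (g z)"
        using L7[OF z] q[OF z] w[OF z] lc(1)[OF cq[OF z]]
        by (simp add: g_def h_def exp_add)
    qed auto
    hence I: "((\<lambda>z. deriv F z / F z) has_contour_integral (g (Complex (- X) b) - g (Complex (- X) T))) (linepath (Complex (- X) T) (Complex (- X) b))" by simp
    have hb: "\<bar>Im (h s)\<bar> \<le> pi * (real k + 2)" if s: "s \<in> corner EL (1/2)" for s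
    proof -
      have "\<bar>Im (Ln (- chi_ld s))\<bar> \<le> pi" "\<bar>Im (Ln (q s))\<bar> \<le> pi" "\<bar>Im (Ln (w s))\<bar> \<le> pi"
        using abs_Im_Ln_le ld[OF s] q[OF s] w[OF s] by auto
      moreover from this(1) have "\<bar>real k * Im (Ln (- chi_ld s))\<bar> \<le> real k * pi"
        unfolding abs_mult by (intro mult_mono) auto
      moreover have "Im (h s) = real k * Im (Ln (- chi_ld s)) + Im (Ln (q s)) + Im (Ln (w s))" by (simp add: h_def)
      moreover have "pi * (real k + 2) = real k * pi + pi + pi" by (simp add: algebra_simps)
      ultimately show ?thesis by linarith
    qed
    have cs: "Complex (- X) b \<in> corner EL (1/2)" "Complex (- X) T \<in> corner EL (1/2)" using X bT by (auto simp: corner)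
    have "\<bar>Im (lc (Complex (- X) T)) - Im (lc (Complex (- X) b)) + (T * (ln (T / (2 * pi)) - 1)) - (b * (ln (b / (2 * pi)) - 1))\<bar> \<le> (4 + X) * (ln T - ln b)"
      using X bT by (intro Im_log_chi_vertical lc(2)) auto
    moreover have "Im (g (Complex (- X) b) - g (Complex (- X) T)) = Im (lc (Complex (- X) b)) - Im (lc (Complex (- X) T)) + Im (h (Complex (- X) b)) - Im (h (Complex (- X) T))"
      by (simp add: g_def)
    moreover have "CL = pi * (real k + 2) + pi * (real k + 2)" by (simp add: CL_def)
    ultimately have "\<bar>Im (g (Complex (- X) b) - g (Complex (- X) T))
       - (T * (ln (T / (2 * pi)) - 1) - b * (ln (b / (2 * pi)) - 1))\<bar> \<le> CL + (4 + X) * (ln T - ln b)"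
      using hb[OF cs(1)] hb[OF cs(2)] by linarith
    thus ?thesis using I by (auto simp: contour_integrable_on_def contour_integral_unique)
  qed
  have low: "norm (F (Complex X t)) \<ge> norm c * real n powr (- X) / 2" for t
  proof -
    have h: "Complex X t \<in> halfp ER" using X by (simp add: halfp)
    have "norm (v (Complex X t)) \<ge> 1/2" using R(4)[OF h] norm_triangle_ineq2[of 1 "1 - v (Complex X t)"] by (simp add: norm_minus_commute)
    hence "norm c * real n powr (- X) * norm (v (Complex X t)) \<ge> norm c * real n powr (- X) * (1/2)" by (intro mult_left_mono) auto
    moreover have "norm (F (Complex X t)) = norm c * real n powr (- X) * norm (v (Complex X t))"
      using R5[OF h] norm_of_nat_powr[OF n, of "- Complex X t"] by (simp add: norm_mult)
    ultimately show ?thesis by simp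
  qed
  have e0: "norm c * real n powr (- X) / 2 > 0" using R(2) n by simp
  show ?thesis
    using that[OF X(1) nz] right left low e0 unfolding F_def n_def by blast
qed

lemma ln_ge_one: "x \<ge> 3 \<Longrightarrow> ln (x::real) \<ge> 1"
proof -
  assume x: "x \<ge> 3"
  have "exp 1 \<le> x" using exp_le x by linarith
  thus ?thesis using x by (subst ln_ge_iff) auto
qed

text \<open>Finiteness of zeros on compact sets requires a nonconstant function. In the constant
  case the point z0 shows that the value a is not taken at all.\<close>

lemma finite_zeta_zeros_compact:
  assumes nz: "zeta_deriv k z0 \<noteq> a" "z0 \<noteq> 1" and K: "compact K" "1 \<notin> K"
  shows "finite {z\<in>K. zeta_deriv k z = a}"
proof (cases "(\<lambda>s. zeta_deriv k s - a) constant_on (UNIV - {1})")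
  case True
  then obtain y where y: "\<And>s. s \<in> UNIV - {1} \<Longrightarrow> zeta_deriv k s - a = y" unfolding constant_on_def by blast
  have "zeta_deriv k s \<noteq> a" if "s \<noteq> 1" for s
  proof -
    have "y \<noteq> 0" using y[of z0] nz by auto
    thus ?thesis using y[of s] that by auto
  qed
  hence "zeta_deriv k z \<noteq> a" if "z \<in> K" for z using K(2) that by metis
  hence "{z\<in>K. zeta_deriv k z = a} = {}" by blast
  thus ?thesis by (simp only: finite.emptyI)
next
  case False
  have "connected (- {1::complex})" by (rule connected_punctured_universe) simp
  hence conn: "connected (UNIV - {1::complex})" by (simp add: Compl_eq_Diff_UNIV)
  have "finite {z\<in>K. zeta_deriv k z - a = 0}"
    using K by (intro holomorphic_compact_finite_zeros[OF _ _ conn _ _ False] holomorphic_intros holomorphic_on_zeta_deriv) auto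
  thus ?thesis by simp
qed

text \<open>With centre X + i T and r = 2 X the segment of \<open>two_power_floor_arg_le\<close> is
  exactly the top edge. The function is at least e at the centre and at most a power of T on the
  disc of radius 6 X, so the number of half turns is O(log T).\<close>

lemma top_segment_bound:
  assumes X: "X \<ge> 3" and e: "e > 0" "\<And>t. norm (zeta_deriv k (Complex X t) - a) \<ge> e"
  obtains K T0 where "K \<ge> 0" "T0 \<ge> 3" 
    "\<And>T. T \<ge> T0 \<Longrightarrow> (\<forall>x. \<bar>x\<bar> \<le> X \<longrightarrow> zeta_deriv k (Complex x T) \<noteq> a) \<Longrightarrow>
      \<bar>Im (contour_integral (linepath (Complex X T) (Complex (- X) T)) (\<lambda>z. deriv (\<lambda>s. zeta_deriv k s - a) z / (zeta_deriv k z - a)))\<bar> \<le> K * ln T"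
proof -
  define F where "F = (\<lambda>s. zeta_deriv k s - a)"
  obtain C M where C: "C > 0" "M \<ge> 0" "\<And>s. Re s \<ge> - (7 * X) \<Longrightarrow> Im s \<ge> 3 \<Longrightarrow> norm (zeta_deriv k s - a) \<le> C * (1 + norm s) powr M"
    by (rule zeta_deriv_growth[of "7 * X" k a]) (rule that)
  define K where "K = pi * ((\<bar>ln (C / e)\<bar> + 2 * M) / ln 2 + 1)"
  \<comment> \<open>High enough for the disc of radius 6 X to stay above height 3 and for 1 + |s| <=
    2 T to hold on it.\<close>
  define T0 where "T0 = 7 * X + 3"
  have K: "K \<ge> 0" unfolding K_def using C by (intro mult_nonneg_nonneg add_nonneg_nonneg divide_nonneg_nonneg) auto
  have "\<bar>Im (contour_integral (linepath (Complex X T) (Complex (- X) T)) (\<lambda>z. deriv F z / F z))\<bar> \<le> K * ln T"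
    if T: "T \<ge> T0" and nz: "\<And>x. \<bar>x\<bar> \<le> X \<Longrightarrow> zeta_deriv k (Complex x T) \<noteq> a" for T
  proof -
    define c where "c = Complex X T"
    define r where "r = 2 * X"
    define B where "B = C * (T\<^sup>2) powr M"
    have r: "r > 0" using X by (simp add: r_def)
    have cr: "c - of_real r = Complex (- X) T" by (simp add: c_def r_def complex_eq_iff)
    have T3: "T \<ge> 3" using T X by (simp add: T0_def)
    have disc: "Re s \<ge> - (7 * X)" "Im s \<ge> 3" "1 + norm s \<le> T\<^sup>2" if "s \<in> cball c (3 * r)" for s
    proof -
      have d: "norm (s - c) \<le> 6 * X" using that by (simp add: dist_norm norm_minus_commute r_def)
      have "\<bar>Re s - X\<bar> \<le> 6 * X" "\<bar>Im s - T\<bar> \<le> 6 * X"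
        using abs_Re_le_cmod[of "s - c"] abs_Im_le_cmod[of "s - c"] d by (auto simp: c_def)
      thus "Re s \<ge> - (7 * X)" "Im s \<ge> 3" using T X by (auto simp: T0_def)
      have "norm s \<le> norm c + 6 * X" using norm_triangle_ineq[of "s - c" c] d by simp
      moreover have "norm c \<le> X + T" using cmod_le[of c] X T3 by (simp add: c_def)
      ultimately have "1 + norm s \<le> 2 * T" using T X unfolding T0_def by argo
      also have "\<dots> \<le> T * T" using T3 by (intro mult_right_mono) auto
      finally show "1 + norm s \<le> T\<^sup>2" by (simp add: power2_eq_square)
    qed
    have B: "norm (F w) \<le> B" if "w \<in> cball c (3 * r)" for w
    proof -
      have "norm (F w) \<le> C * (1 + norm w) powr M" unfolding F_def using disc[OF that] by (intro C(3))
      also have "\<dots> \<le> B" unfolding B_def using disc[OF that] C by (intro mult_left_mono powr_mono2) auto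
      finally show ?thesis .
    qed
    define D where "D = \<bar>Im (contour_integral (linepath c (c - of_real r)) (\<lambda>z. deriv F z / F z))\<bar>"
    define m where "m = nat \<lfloor>D / pi\<rfloor>"
    have "norm (F c) * 2 ^ m \<le> B" unfolding m_def D_def
    proof (rule two_power_floor_arg_le[where S = "UNIV - {1}"])
      show "F holomorphic_on UNIV - {1}" unfolding F_def by (intro holomorphic_intros holomorphic_on_zeta_deriv)
      show "cball c (3 * r) \<subseteq> UNIV - {1}" using disc(2)[of 1] by auto
      fix z assume "z \<in> closed_segment c (c - of_real r)"
      hence "Im z = T" "\<bar>Re z\<bar> \<le> X" unfolding cr c_def using X
        by (auto simp: closed_segment_same_Im closed_segment_eq_real_ivl r_def split: if_splits)
      thus "F z \<noteq> 0" using nz[of "Re z"] unfolding F_def by (metis complex_surj right_minus_eq)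
    qed (use r B in auto)
    moreover have "e * 2 ^ m \<le> norm (F c) * 2 ^ m" using e(2)[of T] by (intro mult_right_mono) (auto simp: F_def c_def)
    ultimately have "e * 2 ^ m \<le> B" by linarith
    hence "2 ^ m \<le> C / e * (T\<^sup>2) powr M" using e(1) by (simp add: B_def field_simps)
    hence "ln (2 ^ m) \<le> ln (C / e * (T\<^sup>2) powr M)" by (intro ln_mono) auto
    also have "\<dots> = ln (C / e) + M * (2 * ln T)"
      using C e T3 by (subst ln_mult) (auto simp: ln_powr ln_realpow)
    also have "ln (2 ^ m) = real m * ln 2" by (simp add: ln_realpow)
    finally have m1: "real m * ln 2 \<le> ln (C / e) + M * (2 * ln T)" .
    have lT: "ln T \<ge> 1" using T3 by (rule ln_ge_one)
    have "ln (C / e) \<le> \<bar>ln (C / e)\<bar> * 1" by simp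
    also have "\<dots> \<le> \<bar>ln (C / e)\<bar> * ln T" using lT by (intro mult_left_mono) auto
    finally have "real m * ln 2 \<le> (\<bar>ln (C / e)\<bar> + 2 * M) * ln T" using m1 by (simp add: algebra_simps)
    hence m2: "real m \<le> (\<bar>ln (C / e)\<bar> + 2 * M) / ln 2 * ln T" by (simp add: field_simps)
    have "\<lfloor>D / pi\<rfloor> \<ge> 0" by (simp add: D_def)
    hence "D / pi \<le> real m + 1" unfolding m_def by linarith
    also have "\<dots> \<le> (\<bar>ln (C / e)\<bar> + 2 * M) / ln 2 * ln T + ln T" using m2 lT by linarith
    finally have "D \<le> pi * ((\<bar>ln (C / e)\<bar> + 2 * M) / ln 2 * ln T + ln T)" by (simp add: field_simps)
    also have "\<dots> = K * ln T" by (simp add: K_def algebra_simps)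
    finally show ?thesis unfolding D_def cr unfolding c_def .
  qed
  thus ?thesis using that[OF K, of T0] X unfolding F_def by (auto simp: T0_def)
qed

section \<open>The argument principle and the asymptotic count\<close>

lemma argument_principle_rectangle:
  assumes X: "X > 0" and b: "1/2 < b" "b < T"
    and bd: "\<And>z. z \<in> path_image (rectpath (Complex (- X) b) (Complex X T)) \<Longrightarrow> zeta_deriv k z \<noteq> a"
  shows "contour_integral (rectpath (Complex (- X) b) (Complex X T)) (\<lambda>z. deriv (\<lambda>s. zeta_deriv k s - a) z / (zeta_deriv k z - a))
    = 2 * pi * \<i> * of_nat (\<Sum>p | zeta_deriv k p = a \<and> p \<in> box (Complex (- X) b) (Complex X T). a_point_mult k a p)"
proof -
  define F where "F = (\<lambda>s. zeta_deriv k s - a)"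
  define R where "R = rectpath (Complex (- X) b) (Complex X T)"
  \<comment> \<open>A slightly larger open rectangle; starting at height 1/2 it avoids the pole at
    1.\<close>
  define S where "S = box (Complex (- X - 1) (1/2)) (Complex (X + 1) (T + 1))"
  \<comment> \<open>The clause \<open>w \<in> {}\<close> is the empty set of poles, in the form in
    which the argument principle is stated.\<close>
  define pz where "pz = {w\<in>S. F w = 0 \<or> w \<in> {}}"
  have S: "open S" "convex S" unfolding S_def by (auto intro: convex_box)
  have S1: "1 \<notin> S" by (auto simp: S_def in_box_complex_iff)
  have Fh: "F holomorphic_on S" unfolding F_def using S1
    by (intro holomorphic_intros holomorphic_on_subset[OF holomorphic_on_zeta_deriv]) auto
  have le: "Re (Complex (- X) b) \<le> Re (Complex X T)" "Im (Complex (- X) b) \<le> Im (Complex X T)" using X b by auto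
  have cb: "cbox (Complex (- X) b) (Complex X T) \<subseteq> S" unfolding S_def using X b
    by (auto simp: in_box_complex_iff in_cbox_complex_iff)
  have pi_sub: "path_image R \<subseteq> cbox (Complex (- X) b) (Complex X T)"
    unfolding R_def by (rule path_image_rectpath_subset_cbox[OF le])
  have start: "Complex (- X) b \<in> path_image R" unfolding R_def using pathstart_in_path_image[of "rectpath (Complex (- X) b) (Complex X T)"] by simp
  have z0: "zeta_deriv k (Complex (- X) b) \<noteq> a" "Complex (- X) b \<noteq> 1" using bd[OF start[unfolded R_def]] b by (auto simp: complex_eq_iff)
  have fin: "finite pz"
  proof (rule finite_subset)
    show "pz \<subseteq> {z\<in>cbox (Complex (- X - 1) (1/2)) (Complex (X + 1) (T + 1)). zeta_deriv k z = a}"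
      by (auto simp: pz_def S_def F_def in_box_complex_iff in_cbox_complex_iff)
    show "finite {z\<in>cbox (Complex (- X - 1) (1/2)) (Complex (X + 1) (T + 1)). zeta_deriv k z = a}"
      by (rule finite_zeta_zeros_compact[OF z0]) (auto simp: in_cbox_complex_iff)
  qed
  have "contour_integral R (\<lambda>x. deriv F x * (\<lambda>_. 1) x / F x) = 2 * pi * \<i> * (\<Sum>p\<in>pz. winding_number R p * (\<lambda>_. 1) p * zorder F p)"
    unfolding pz_def
  proof (rule argument_principle)
    show "path_image R \<subseteq> S - {w \<in> S. F w = 0 \<or> w \<in> {}}"
      using pi_sub cb bd unfolding F_def R_def by auto
    show "\<forall>z. z \<notin> S \<longrightarrow> winding_number R z = 0"
      unfolding R_def using winding_number_rectpath_outside[OF le] subsetD[OF cb] by auto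
    show "finite {w \<in> S. F w = 0 \<or> w \<in> {}}" using fin unfolding pz_def .
    show "connected S" by (rule convex_connected[OF S(2)])
  qed (use S Fh in \<open>auto simp: R_def\<close>)
  also have "(\<Sum>p\<in>pz. winding_number R p * (\<lambda>_. 1) p * zorder F p) = (\<Sum>p\<in>pz. if p \<in> box (Complex (- X) b) (Complex X T) then of_nat (a_point_mult k a p) else 0)"
  proof (rule sum.cong[OF refl])
    fix p assume p: "p \<in> pz"
    hence pS: "p \<in> S" and Fp: "F p = 0" by (auto simp: pz_def)
    show "winding_number R p * (\<lambda>_. 1) p * zorder F p = (if p \<in> box (Complex (- X) b) (Complex X T) then of_nat (a_point_mult k a p) else 0)"
    proof (cases "p \<in> box (Complex (- X) b) (Complex X T)")
      case True
      have nc: "\<exists>w\<in>S. F w \<noteq> 0" using z0(1) subsetD[OF cb subsetD[OF pi_sub start]] by (auto simp: F_def)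
      have "zorder F p > 0"
        using zorder_exist_zero[OF Fh S(1) convex_connected[OF S(2)] pS nc] Fp by simp
      hence "of_nat (a_point_mult k a p) = (of_int (zorder F p) :: complex)"
        using Fp by (simp add: a_point_mult_def F_def[symmetric] of_nat_nat) (simp add: F_def)
      thus ?thesis using True winding_number_rectpath[OF True] by (simp add: R_def)
    next
      case False
      have "p \<notin> path_image R" using bd Fp unfolding F_def R_def by auto
      hence "p \<notin> cbox (Complex (- X) b) (Complex X T)"
        using False path_image_rectpath_cbox_minus_box[OF le] by (auto simp: R_def)
      thus ?thesis using False winding_number_rectpath_outside[OF le] by (simp add: R_def)
    qed
  qed
  also have "\<dots> = (\<Sum>p\<in>{p\<in>pz. p \<in> box (Complex (- X) b) (Complex X T)}. of_nat (a_point_mult k a p))"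
    by (rule sum.inter_filter[OF fin, symmetric])
  also have "{p\<in>pz. p \<in> box (Complex (- X) b) (Complex X T)} = {p. zeta_deriv k p = a \<and> p \<in> box (Complex (- X) b) (Complex X T)}"
    using subset_trans[OF box_subset_cbox cb] by (auto simp: pz_def F_def)
  finally show ?thesis by (simp add: F_def R_def)
qed

lemma zeta_zeros_finite_upto:
  "finite {p. zeta_deriv k p = a \<and> 1 < Im p \<and> Im p \<le> T}"
proof -
  obtain X where X: "X \<ge> 3" "\<And>s. Im s > 1/2 \<Longrightarrow> \<bar>Re s\<bar> \<ge> X \<Longrightarrow> zeta_deriv k s \<noteq> a"
    by (rule rectangle_setup[of k a]) (rule that)
  have z0: "zeta_deriv k (Complex X 1) \<noteq> a" "Complex X 1 \<noteq> 1" using X(2)[of "Complex X 1"] by (auto simp: complex_eq_iff)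
  show ?thesis
  proof (rule finite_subset)
    show "{p. zeta_deriv k p = a \<and> 1 < Im p \<and> Im p \<le> T} \<subseteq> {z\<in>cbox (Complex (- X) 1) (Complex X T). zeta_deriv k z = a}"
    proof safe
      fix p assume p: "a = zeta_deriv k p" "1 < Im p" "Im p \<le> T"
      hence "\<bar>Re p\<bar> < X" using X(2)[of p] by force
      thus "p \<in> cbox (Complex (- X) 1) (Complex X T)" using p by (auto simp: in_cbox_complex_iff)
    qed
    show "finite {z\<in>cbox (Complex (- X) 1) (Complex X T). zeta_deriv k z = a}"
      by (rule finite_zeta_zeros_compact[OF z0]) (auto simp: in_cbox_complex_iff)
  qed
qed

text \<open>By local finiteness there is a gap without a-points just above every height. It serves
  twice: to raise the lower edge slightly above 1 and to move the upper edge off an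
  ordinate.\<close>

lemma eventually_no_zeros_right:
  assumes "T \<ge> 1"
  shows "eventually (\<lambda>t. \<forall>p. zeta_deriv k p = a \<longrightarrow> T < Im p \<longrightarrow> t < Im p) (at_right T)"
proof -
  define Z where "Z = {p. zeta_deriv k p = a \<and> 1 < Im p \<and> Im p \<le> T + 1}"
  define Z' where "Z' = {p\<in>Z. T < Im p}"
  have "finite Z'" unfolding Z'_def Z_def
    by (rule finite_subset[OF _ zeta_zeros_finite_upto[of k a "T + 1"]]) auto
  hence "eventually (\<lambda>t. \<forall>p\<in>Z'. t < Im p) (at_right T)"
    by (rule eventually_ball_finite) (auto simp: Z'_def intro: order_tendstoD(2)[OF tendsto_ident_at])
  moreover have "eventually (\<lambda>t. t < T + 1) (at_right T)" by (rule order_tendstoD(2)[OF tendsto_ident_at]) simp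
  ultimately show ?thesis
  proof eventually_elim
    case (elim t)
    show ?case
    proof (intro allI impI)
      fix p assume p: "zeta_deriv k p = a" "T < Im p"
      show "t < Im p"
      proof (cases "Im p \<le> T + 1")
        case True
        thus ?thesis using elim p assms by (auto simp: Z'_def Z_def)
      qed (use elim in auto)
    qed
  qed
qed

lemma zeta_count_asymptotic:
  obtains K T0 where "K \<ge> 0" "T0 \<ge> 3"
    "\<And>T. T \<ge> T0 \<Longrightarrow> \<bar>2 * pi * real (zeta_count k a T) - T * (ln (T / (2 * pi * real (n_ak a k))) - 1)\<bar> \<le> K * ln T"
proof -
  define F where "F = (\<lambda>s. zeta_deriv k s - a)"
  define G where "G = (\<lambda>z. deriv (\<lambda>s. zeta_deriv k s - a) z / (zeta_deriv k z - a))"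
  define n where "n = real (n_ak a k)"
  have n: "n \<ge> 1" by (simp add: n_def n_ak_def)
  obtain X where X: "X \<ge> 3" "\<And>s. Im s > 1/2 \<Longrightarrow> \<bar>Re s\<bar> \<ge> X \<Longrightarrow> zeta_deriv k s \<noteq> a"
    and right: "\<exists>C. \<forall>b T. 1/2 < b \<and> b \<le> T \<longrightarrow> G contour_integrable_on (linepath (Complex X b) (Complex X T)) \<and>
       \<bar>Im (contour_integral (linepath (Complex X b) (Complex X T)) G) + (T - b) * ln n\<bar> \<le> C"
    and left: "\<exists>C. \<forall>b T. 1/2 < b \<and> b \<le> T \<longrightarrow> G contour_integrable_on (linepath (Complex (- X) T) (Complex (- X) b)) \<and>
       \<bar>Im (contour_integral (linepath (Complex (- X) T) (Complex (- X) b)) G)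
          - (T * (ln (T / (2 * pi)) - 1) - b * (ln (b / (2 * pi)) - 1))\<bar> \<le> C + (4 + X) * (ln T - ln b)"
    and low: "\<exists>e>0. \<forall>t. norm (zeta_deriv k (Complex X t) - a) \<ge> e"
    by (rule rectangle_setup[of k a]) (rule that[unfolded G_def n_def])
  obtain C1 where C1: "\<And>b T. 1/2 < b \<Longrightarrow> b \<le> T \<Longrightarrow> G contour_integrable_on (linepath (Complex X b) (Complex X T)) \<and>
       \<bar>Im (contour_integral (linepath (Complex X b) (Complex X T)) G) + (T - b) * ln n\<bar> \<le> C1" using right by blast
  obtain C2 where C2: "\<And>b T. 1/2 < b \<Longrightarrow> b \<le> T \<Longrightarrow> G contour_integrable_on (linepath (Complex (- X) T) (Complex (- X) b)) \<and>
       \<bar>Im (contour_integral (linepath (Complex (- X) T) (Complex (- X) b)) G)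
          - (T * (ln (T / (2 * pi)) - 1) - b * (ln (b / (2 * pi)) - 1))\<bar> \<le> C2 + (4 + X) * (ln T - ln b)" using left by blast
  obtain e where e: "e > 0" "\<And>t. norm (zeta_deriv k (Complex X t) - a) \<ge> e" using low by blast
  obtain K1 T1 where K1: "K1 \<ge> 0" "T1 \<ge> 3"
    "\<And>T. T \<ge> T1 \<Longrightarrow> (\<forall>x. \<bar>x\<bar> \<le> X \<longrightarrow> zeta_deriv k (Complex x T) \<noteq> a) \<Longrightarrow>
      \<bar>Im (contour_integral (linepath (Complex X T) (Complex (- X) T)) G)\<bar> \<le> K1 * ln T"
    by (rule top_segment_bound[OF X(1) e]) (rule that[unfolded G_def])
  \<comment> \<open>A-points of ordinate exactly 1 are not counted but would lie on the edge, so the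
    lower edge is put at a height b that is above 1 and still below all counted a-points.\<close>
  have "eventually (\<lambda>b. (\<forall>p. zeta_deriv k p = a \<longrightarrow> 1 < Im p \<longrightarrow> b < Im p) \<and> b < 2 \<and> 1 < b) (at_right (1::real))"
    by (intro eventually_conj eventually_no_zeros_right order_tendstoD(2)[OF tendsto_ident_at] eventually_at_right_less) auto
  from eventually_happens'[OF trivial_limit_at_right_real this]
  obtain b where b: "\<And>p. zeta_deriv k p = a \<Longrightarrow> 1 < Im p \<Longrightarrow> b < Im p" "b < 2" "1 < b"
    by auto
  have lnb: "ln b \<ge> 0" using b by simp
  \<comment> \<open>The bottom edge does not move with T, so its contribution is a constant that
    needs no estimate.\<close>
  define I0 where "I0 = \<bar>Im (contour_integral (linepath (Complex (- X) b) (Complex X b)) G)\<bar>"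
  define c where "c = b * ln n - b * (ln (b / (2 * pi)) - 1)"
  define K2 where "K2 = I0 + \<bar>C1\<bar> + \<bar>C2\<bar> + (4 + X) + K1 + \<bar>c\<bar>"
  have K2: "K2 \<ge> 0" using K1(1) X(1) by (simp add: K2_def I0_def)
  define M where "M = (\<lambda>T. T * (ln (T / (2 * pi * n)) - 1))"
  define V where "V = (UNIV - {1}) \<inter> F -` (- {0})"
  have Fh: "F holomorphic_on UNIV - {1}" unfolding F_def by (intro holomorphic_intros holomorphic_on_zeta_deriv)
  have V: "open V" unfolding V_def
    by (intro continuous_open_preimage holomorphic_on_imp_continuous_on Fh) auto
  have GF: "G = (\<lambda>z. deriv F z / F z)" by (simp add: G_def F_def)
  have Gh: "G holomorphic_on V"
  proof -
    have VS: "V \<subseteq> UNIV - {1}" by (auto simp: V_def)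
    have "open (UNIV - {1::complex})" by auto
    from holomorphic_on_subset[OF Fh VS] holomorphic_on_subset[OF holomorphic_deriv[OF Fh this] VS]
    have "F holomorphic_on V" "deriv F holomorphic_on V" .
    thus ?thesis unfolding GF by (intro holomorphic_on_divide) (auto simp: V_def)
  qed
  have main: "\<bar>2 * pi * real (zeta_count k a T) - M T\<bar> \<le> K2 * ln T"
    if T: "T \<ge> T1" and nz: "\<And>p. zeta_deriv k p = a \<Longrightarrow> Im p \<noteq> T" for T
  proof -
    have T3: "T \<ge> 3" using T K1(2) by simp
    have bT: "1/2 < b" "b < T" "b \<le> T" using b T3 by auto
    have lT: "ln T \<ge> 1" using T3 by (rule ln_ge_one)
    have nzseg: "zeta_deriv k p \<noteq> a" if "Im p \<ge> b" "Im p = b \<or> Im p = T \<or> \<bar>Re p\<bar> = X" for p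
    proof
      assume z: "zeta_deriv k p = a"
      have "b < Im p" using b(1)[OF z] that(1) b(3) by simp
      moreover have "Im p \<noteq> T" using nz[OF z] .
      moreover have "\<bar>Re p\<bar> \<noteq> X" using X(2)[of p] z that(1) bT by force
      ultimately show False using that(2) by auto
    qed
    have le: "Re (Complex (- X) b) \<le> Re (Complex X T)" "Im (Complex (- X) b) \<le> Im (Complex X T)" using X(1) bT by auto
    have img: "path_image (rectpath (Complex (- X) b) (Complex X T)) \<subseteq> V"
    proof
      fix z assume "z \<in> path_image (rectpath (Complex (- X) b) (Complex X T))"
      hence z: "Im z \<ge> b" "Im z = b \<or> Im z = T \<or> \<bar>Re z\<bar> = X"
        unfolding path_image_rectpath[OF le] using X(1) bT by auto
      have "z \<noteq> 1" using z(1) b(3) by auto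
      thus "z \<in> V" using nzseg[OF z] by (simp add: V_def F_def)
    qed
    have arg: "contour_integral (rectpath (Complex (- X) b) (Complex X T)) G
      = 2 * pi * \<i> * of_nat (\<Sum>p | zeta_deriv k p = a \<and> p \<in> box (Complex (- X) b) (Complex X T). a_point_mult k a p)"
      unfolding G_def
    proof (rule argument_principle_rectangle[OF _ bT(1,2)])
      show "zeta_deriv k z \<noteq> a" if "z \<in> path_image (rectpath (Complex (- X) b) (Complex X T))" for z
        using subsetD[OF img that] by (simp add: V_def F_def)
    qed (use X(1) in simp)
    have sets: "{p. zeta_deriv k p = a \<and> p \<in> box (Complex (- X) b) (Complex X T)} = {p. zeta_deriv k p = a \<and> 1 < Im p \<and> Im p \<le> T}"
    proof (intro Collect_cong conj_cong refl iffI)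
      fix p assume z: "zeta_deriv k p = a"
      show "1 < Im p \<and> Im p \<le> T" if "p \<in> box (Complex (- X) b) (Complex X T)"
        using that b(3) by (auto simp: in_box_complex_iff)
      assume p: "1 < Im p \<and> Im p \<le> T"
      hence "b < Im p" "Im p < T" using b(1)[OF z] nz[OF z] by auto
      moreover have "\<bar>Re p\<bar> < X" using X(2)[of p] z p by force
      ultimately show "p \<in> box (Complex (- X) b) (Complex X T)" by (auto simp: in_box_complex_iff)
    qed
    define L1 where "L1 = linepath (Complex (- X) b) (Complex X b)"
    define L2 where "L2 = linepath (Complex X b) (Complex X T)"
    define L3 where "L3 = linepath (Complex X T) (Complex (- X) T)"
    define L4 where "L4 = linepath (Complex (- X) T) (Complex (- X) b)"
    have rp: "rectpath (Complex (- X) b) (Complex X T) = L1 +++ L2 +++ L3 +++ L4"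
      by (simp add: rectpath_def L1_def L2_def L3_def L4_def Let_def)
    have pis: "path_image L1 \<subseteq> V" "path_image L2 \<subseteq> V" "path_image L3 \<subseteq> V" "path_image L4 \<subseteq> V"
      using img unfolding rp by (auto simp: path_image_join L1_def L2_def L3_def L4_def)
    have vp: "valid_path L1" "valid_path L2" "valid_path L3" "valid_path L4" by (auto simp: L1_def L2_def L3_def L4_def)
    have ends: "pathfinish L1 = pathstart L2" "pathfinish L2 = pathstart L3" "pathfinish L3 = pathstart L4"
      by (auto simp: L1_def L2_def L3_def L4_def)
    have ci: "G contour_integrable_on L1" "G contour_integrable_on L2" "G contour_integrable_on L3" "G contour_integrable_on L4"
      using contour_integrable_holomorphic_simple[OF Gh V] vp pis by auto
    have "contour_integral (rectpath (Complex (- X) b) (Complex X T)) G = contour_integral L1 G + contour_integral L2 G + contour_integral L3 G + contour_integral L4 G"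
      unfolding rp using ci vp ends by (simp add: contour_integrable_joinI add.assoc)
    hence tot: "2 * pi * real (zeta_count k a T) = Im (contour_integral L1 G) + Im (contour_integral L2 G) + Im (contour_integral L3 G) + Im (contour_integral L4 G)"
      unfolding arg sets by (simp add: complex_eq_iff zeta_count_def)
    define P where "P = T * (ln (T / (2 * pi)) - 1)"
    define Q where "Q = b * (ln (b / (2 * pi)) - 1)"
    have l2: "\<bar>Im (contour_integral L2 G) + (T - b) * ln n\<bar> \<le> \<bar>C1\<bar>" using C1[OF bT(1,3)] by (auto simp: L2_def intro: order_trans[OF _ abs_ge_self])
    have "(4 + X) * (ln T - ln b) \<le> (4 + X) * ln T" using lnb X(1) by (intro mult_left_mono) auto
    moreover have "\<bar>Im (contour_integral L4 G) - (P - Q)\<bar> \<le> C2 + (4 + X) * (ln T - ln b)"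
      using C2[OF bT(1,3)] by (simp only: L4_def P_def Q_def)
    ultimately have l4: "\<bar>Im (contour_integral L4 G) - (P - Q)\<bar> \<le> \<bar>C2\<bar> + (4 + X) * ln T"
      using abs_ge_self[of C2] by linarith
    have l3: "\<bar>Im (contour_integral L3 G)\<bar> \<le> K1 * ln T"
      unfolding L3_def using bT by (intro K1(3) T allI impI nzseg) auto
    have l1: "\<bar>Im (contour_integral L1 G)\<bar> \<le> I0" by (simp add: L1_def I0_def)
    have MT: "M T = P - T * ln n"
    proof -
      have "ln (T / (2 * pi * n)) = ln (T / (2 * pi) / n)" by simp
      also have "\<dots> = ln (T / (2 * pi)) - ln n" using T3 n by (subst ln_div) auto
      finally have lnq: "ln (T / (2 * pi * n)) = ln (T / (2 * pi)) - ln n" .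
      show ?thesis unfolding M_def P_def lnq by (simp add: algebra_simps)
    qed
    have gen: "\<bar>u + v + x + y + z\<bar> \<le> \<bar>u\<bar> + \<bar>v\<bar> + \<bar>x\<bar> + \<bar>y\<bar> + \<bar>z\<bar>" for u v x y z :: real
      by (intro order_trans[OF abs_triangle_ineq] add_mono order_refl)
    have "2 * pi * real (zeta_count k a T) - M T = Im (contour_integral L1 G) + (Im (contour_integral L2 G) + (T - b) * ln n)
       + Im (contour_integral L3 G) + (Im (contour_integral L4 G) - (P - Q)) + c"
      unfolding tot MT c_def Q_def[symmetric] by (simp add: algebra_simps)
    also have "\<bar>\<dots>\<bar> \<le> I0 + \<bar>C1\<bar> + K1 * ln T + (\<bar>C2\<bar> + (4 + X) * ln T) + \<bar>c\<bar>"
      by (rule order_trans[OF gen]) (intro add_mono l1 l2 l3 l4 order_refl)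
    finally have *: "\<bar>2 * pi * real (zeta_count k a T) - M T\<bar> \<le> I0 + \<bar>C1\<bar> + K1 * ln T + (\<bar>C2\<bar> + (4 + X) * ln T) + \<bar>c\<bar>" .
    have "I0 * 1 \<le> I0 * ln T" "\<bar>C1\<bar> * 1 \<le> \<bar>C1\<bar> * ln T" "\<bar>C2\<bar> * 1 \<le> \<bar>C2\<bar> * ln T" "\<bar>c\<bar> * 1 \<le> \<bar>c\<bar> * ln T"
      using lT by (intro mult_left_mono; simp add: I0_def)+
    moreover have "K2 * ln T = I0 * ln T + \<bar>C1\<bar> * ln T + \<bar>C2\<bar> * ln T + (4 + X) * ln T + K1 * ln T + \<bar>c\<bar> * ln T"
      by (simp add: K2_def algebra_simps)
    ultimately show ?thesis using * by simp
  qed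
  \<comment> \<open>If T is an ordinate, a slightly larger t with the same count is used. The
    increase of ln by less than 1 doubles the constant, and the change of M by less than 1 adds
    another ln T.\<close>
  have "\<bar>2 * pi * real (zeta_count k a T) - M T\<bar> \<le> (2 * K2 + 1) * ln T" if T: "T \<ge> T1" for T
  proof -
    have T3: "T \<ge> 3" using T K1(2) by simp
    have lT: "ln T \<ge> 1" using T3 by (rule ln_ge_one)
    have npos: "2 * pi * n > 0" using n by simp
    have cM: "isCont M T" unfolding M_def using T3 npos by (intro continuous_intros) auto
    have "(M \<longlongrightarrow> M T) (at_right T)" by (rule tendsto_mono[OF at_le]) (use cM in \<open>auto simp: isCont_def\<close>)
    hence "eventually (\<lambda>t. dist (M t) (M T) < 1) (at_right T)" by (rule tendstoD) simp
    moreover have "(ln \<longlongrightarrow> ln T) (at_right T)" by (rule tendsto_ln[OF tendsto_ident_at]) (use T3 in simp)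
    hence "eventually (\<lambda>t. ln t < ln T + 1) (at_right T)" by (rule order_tendstoD(2)) simp
    moreover have "eventually (\<lambda>t. \<forall>p. zeta_deriv k p = a \<longrightarrow> T < Im p \<longrightarrow> t < Im p) (at_right T)"
      using T3 by (intro eventually_no_zeros_right) auto
    moreover have "eventually (\<lambda>t. T < t) (at_right T)" by (rule eventually_at_right_less)
    ultimately have "eventually (\<lambda>t. dist (M t) (M T) < 1 \<and> ln t < ln T + 1 \<and> (\<forall>p. zeta_deriv k p = a \<longrightarrow> T < Im p \<longrightarrow> t < Im p) \<and> T < t) (at_right T)"
      by eventually_elim auto
    from eventually_happens'[OF trivial_limit_at_right_real this]
    obtain t where t: "dist (M t) (M T) < 1" "ln t < ln T + 1" "\<And>p. zeta_deriv k p = a \<Longrightarrow> T < Im p \<Longrightarrow> t < Im p" "T < t"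
      by auto
    have nt: "Im p \<noteq> t" if "zeta_deriv k p = a" for p
    proof
      assume "Im p = t"
      thus False using t(3)[OF that] t(4) by simp
    qed
    have "T1 \<le> t" using t(4) T by simp
    from main[OF this nt] have m1: "\<bar>2 * pi * real (zeta_count k a t) - M t\<bar> \<le> K2 * ln t" .
    have cnt: "zeta_count k a t = zeta_count k a T"
    proof -
      have "{p. zeta_deriv k p = a \<and> 1 < Im p \<and> Im p \<le> t} = {p. zeta_deriv k p = a \<and> 1 < Im p \<and> Im p \<le> T}"
      proof (intro Collect_cong conj_cong refl)
        fix p assume "zeta_deriv k p = a"
        from t(3)[OF this] show "(Im p \<le> t) = (Im p \<le> T)" using t(4) by linarith
      qed
      thus ?thesis by (simp add: zeta_count_def)
    qed
    note m1[unfolded cnt]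
    moreover have "K2 * ln t \<le> K2 * (ln T + 1)" using t(2) K2 by (intro mult_left_mono) auto
    moreover have "K2 * 1 \<le> K2 * ln T" using lT K2 by (intro mult_left_mono) auto
    moreover have "\<bar>M t - M T\<bar> < 1" using t(1) by (simp add: dist_real_def)
    moreover have "(2 * K2 + 1) * ln T = K2 * ln T + K2 * ln T + ln T" "K2 * (ln T + 1) = K2 * ln T + K2" by (simp_all add: algebra_simps)
    ultimately show ?thesis using lT by linarith
  qed
  thus ?thesis using that[of "2 * K2 + 1" T1] K1(2) K2 unfolding M_def n_def by auto
qed

section \<open>Convex counting functions\<close>

lemma card_less_split:
  assumes "a \<le> (b::nat)"
  shows "card {n. n < b \<and> P n} = card {n. n < a \<and> P n} + card {n. a \<le> n \<and> n < b \<and> P n}"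
proof -
  have "{n. n < b \<and> P n} = {n. n < a \<and> P n} \<union> {n. a \<le> n \<and> n < b \<and> P n}" using assms by auto
  moreover have "finite {n. n < a \<and> P n}" by (rule finite_subset[of _ "{..<a}"]) auto
  moreover have "finite {n. a \<le> n \<and> n < b \<and> P n}" by (rule finite_subset[of _ "{..<b}"]) auto
  moreover have "{n. n < a \<and> P n} \<inter> {n. a \<le> n \<and> n < b \<and> P n} = {}" by auto
  ultimately show ?thesis by (simp only: card_Un_disjoint)
qed

text \<open>Convexity brackets the increments by chords that telescope: W(j + theta) - W(j) <= theta
  (W(j+1) - W(j)) <= W(j+1+theta) - W(j+1). The two sums differ by a shift of one index, which is
  negligible because W(m+1)/W(m) tends to 1.\<close>

lemma convex_counting_limit:
  fixes E :: "real \<Rightarrow> nat" and W r :: "real \<Rightarrow> real" and m0 :: nat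
  assumes th: "0 \<le> \<theta>" "\<theta> \<le> 1"
    and Emono: "\<And>u v. real m0 \<le> u \<Longrightarrow> u \<le> v \<Longrightarrow> E u \<le> E v"
    and EW: "\<And>u. u \<ge> real m0 \<Longrightarrow> \<bar>real (E u) - W u\<bar> \<le> r u"
    and rmono: "\<And>u v. real m0 \<le> u \<Longrightarrow> u \<le> v \<Longrightarrow> r u \<le> r v"
    and conv: "convex_on {real m0..} W"
    and rW: "(\<lambda>m. real m * r (real m) / W (real m)) \<longlonglongrightarrow> 0"
    and WW: "(\<lambda>m. W (real (Suc m)) / W (real m)) \<longlonglongrightarrow> 1"
    and Winf: "filterlim (\<lambda>m. W (real m)) at_top sequentially"
  shows "(\<lambda>m. (\<Sum>j=m0..<m. real (E (real j + \<theta>)) - real (E (real j))) / W (real m)) \<longlonglongrightarrow> \<theta>"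
proof -
  define S where "S = (\<lambda>m. (\<Sum>j=m0..<m. real (E (real j + \<theta>)) - real (E (real j))))"
  have up1: "W (real j + \<theta>) - W (real j) \<le> \<theta> * (W (real (Suc j)) - W (real j))" if "j \<ge> m0" for j
  proof -
    have "W ((1 - \<theta>) *\<^sub>R real j + \<theta> *\<^sub>R real (Suc j)) \<le> (1 - \<theta>) * W (real j) + \<theta> * W (real (Suc j))"
      using that th by (intro convex_onD[OF conv]) auto
    moreover have "(1 - \<theta>) *\<^sub>R real j + \<theta> *\<^sub>R real (Suc j) = real j + \<theta>" by (simp add: algebra_simps)
    ultimately show ?thesis by (simp add: algebra_simps)
  qed
  have lo1: "W (real (Suc j) + \<theta>) - W (real (Suc j)) \<ge> \<theta> * (W (real (Suc j)) - W (real j))" if "j \<ge> m0" for j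
  proof -
    \<comment> \<open>The ratio in which j + 1 divides the segment from j to j + 1 + theta.\<close>
    define k where "k = 1 / (1 + \<theta>)"
    have k: "(1 + \<theta>) * k = 1" "0 \<le> k" "k \<le> 1" using th by (auto simp: k_def)
    have "W ((1 - k) *\<^sub>R real j + k *\<^sub>R (real (Suc j) + \<theta>)) \<le> (1 - k) * W (real j) + k * W (real (Suc j) + \<theta>)"
      using that th k by (intro convex_onD[OF conv]) auto
    moreover have "(1 - k) *\<^sub>R real j + k *\<^sub>R (real (Suc j) + \<theta>) = real j + (1 + \<theta>) * k"
      by (simp add: algebra_simps)
    ultimately have "W (real (Suc j)) \<le> (1 - k) * W (real j) + k * W (real (Suc j) + \<theta>)"
      unfolding k(1) by (simp add: add.commute)
    hence "(1 + \<theta>) * W (real (Suc j)) \<le> (1 + \<theta>) * ((1 - k) * W (real j) + k * W (real (Suc j) + \<theta>))"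
      using th by (intro mult_left_mono) auto
    also have "\<dots> = (1 + \<theta>) * W (real j) - ((1 + \<theta>) * k) * W (real j) + ((1 + \<theta>) * k) * W (real (Suc j) + \<theta>)"
      by (simp add: algebra_simps)
    also have "\<dots> = \<theta> * W (real j) + W (real (Suc j) + \<theta>)" unfolding k(1) by (simp add: algebra_simps)
    finally show ?thesis by (simp add: algebra_simps)
  qed
  have err: "\<bar>(real (E (real j + \<theta>)) - real (E (real j))) - (W (real j + \<theta>) - W (real j))\<bar> \<le> 2 * r (real m)"
    if "j \<ge> m0" "j < m" for j m
  proof -
    have j: "real j + \<theta> \<le> real m" using that th by linarith
    have "\<bar>real (E (real j + \<theta>)) - W (real j + \<theta>)\<bar> \<le> r (real m)"
      using that th j by (intro order_trans[OF EW rmono]) auto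
    moreover have "\<bar>real (E (real j)) - W (real j)\<bar> \<le> r (real m)"
      using that by (intro order_trans[OF EW rmono]) auto
    ultimately show ?thesis by linarith
  qed
  have r0: "r (real m) \<ge> 0" if "m \<ge> m0" for m using EW[of "real m"] that by auto
  have upper: "S m \<le> \<theta> * (W (real m) - W (real m0)) + 2 * (real m * r (real m))" if m: "m \<ge> m0" for m
  proof -
    have "S m \<le> (\<Sum>j=m0..<m. \<theta> * (W (real (Suc j)) - W (real j)) + 2 * r (real m))"
      unfolding S_def
    proof (rule sum_mono)
      fix j assume "j \<in> {m0..<m}"
      thus "real (E (real j + \<theta>)) - real (E (real j)) \<le> \<theta> * (W (real (Suc j)) - W (real j)) + 2 * r (real m)"
        using up1[of j] err[of j m] by simp
    qed
    also have "\<dots> = \<theta> * (W (real m) - W (real m0)) + real (m - m0) * (2 * r (real m))"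
      using sum_Suc_diff'[of m0 m "\<lambda>j. W (real j)"] m by (simp add: sum.distrib sum_distrib_left[symmetric])
    also have "real (m - m0) * (2 * r (real m)) \<le> real m * (2 * r (real m))"
      using r0[OF m] by (intro mult_right_mono) auto
    finally show ?thesis by simp
  qed
  have lower: "S (Suc m) \<ge> \<theta> * (W (real m) - W (real m0)) - 2 * (real (Suc m) * r (real (Suc m)))" if m: "m \<ge> m0" for m
  proof -
    \<comment> \<open>The first interval has no predecessor to be compared with; its term is
      nonnegative since E is monotone, and is dropped.\<close>
    have "S (Suc m) = (real (E (real m0 + \<theta>)) - real (E (real m0))) + (\<Sum>j=m0..<m. real (E (real (Suc j) + \<theta>)) - real (E (real (Suc j))))"
      unfolding S_def using m by (subst sum.atLeast_Suc_lessThan) (auto simp only: sum.shift_bounds_Suc_ivl)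
    moreover have "real (E (real m0 + \<theta>)) - real (E (real m0)) \<ge> 0" using Emono[of "real m0" "real m0 + \<theta>"] th by simp
    moreover have "(\<Sum>j=m0..<m. \<theta> * (W (real (Suc j)) - W (real j)) - 2 * r (real (Suc m))) \<le> (\<Sum>j=m0..<m. real (E (real (Suc j) + \<theta>)) - real (E (real (Suc j))))"
    proof (rule sum_mono)
      fix j assume "j \<in> {m0..<m}"
      thus "\<theta> * (W (real (Suc j)) - W (real j)) - 2 * r (real (Suc m)) \<le> real (E (real (Suc j) + \<theta>)) - real (E (real (Suc j)))"
        using lo1[of j] err[of "Suc j" "Suc m"] by simp
    qed
    moreover have "(\<Sum>j=m0..<m. \<theta> * (W (real (Suc j)) - W (real j)) - 2 * r (real (Suc m))) = \<theta> * (W (real m) - W (real m0)) - real (m - m0) * (2 * r (real (Suc m)))"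
      using sum_Suc_diff'[of m0 m "\<lambda>j. W (real j)"] m by (simp add: sum_subtractf sum_distrib_left[symmetric])
    moreover have "real (m - m0) * (2 * r (real (Suc m))) \<le> real (Suc m) * (2 * r (real (Suc m)))"
      using r0[of "Suc m"] m by (intro mult_right_mono) auto
    ultimately show ?thesis by simp
  qed
  have "eventually (\<lambda>m. W (real m) > 0) sequentially"
    using filterlim_at_top_dense[THEN iffD1, OF Winf] by blast
  hence Wpos: "eventually (\<lambda>m. W (real (Suc m)) > 0) sequentially"
    by (rule eventually_sequentially_Suc[THEN iffD2])
  have inv0: "(\<lambda>m. 1 / W (real m)) \<longlonglongrightarrow> 0"
    using tendsto_divide_0[OF tendsto_const filterlim_at_top_imp_at_infinity[OF Winf]] .
  have lim_up: "(\<lambda>m. \<theta> * (1 - W (real m0) * (1 / W (real (Suc m)))) + 2 * (real (Suc m) * r (real (Suc m)) / W (real (Suc m)))) \<longlonglongrightarrow> \<theta> * (1 - W (real m0) * 0) + 2 * 0"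
    by (intro tendsto_intros LIMSEQ_Suc[OF inv0] LIMSEQ_Suc[OF rW])
  have WW': "(\<lambda>m. W (real m) / W (real (Suc m))) \<longlonglongrightarrow> 1"
    using tendsto_inverse[OF WW] by simp
  have lim_lo: "(\<lambda>m. \<theta> * (W (real m) / W (real (Suc m)) - W (real m0) * (1 / W (real (Suc m)))) - 2 * (real (Suc m) * r (real (Suc m)) / W (real (Suc m)))) \<longlonglongrightarrow> \<theta> * (1 - W (real m0) * 0) - 2 * 0"
    by (intro tendsto_intros LIMSEQ_Suc[OF inv0] LIMSEQ_Suc[OF rW] WW')
  have "(\<lambda>m. S (Suc m) / W (real (Suc m))) \<longlonglongrightarrow> \<theta>"
  proof (rule tendsto_sandwich)
    show "eventually (\<lambda>m. \<theta> * (W (real m) / W (real (Suc m)) - W (real m0) * (1 / W (real (Suc m)))) - 2 * (real (Suc m) * r (real (Suc m)) / W (real (Suc m))) \<le> S (Suc m) / W (real (Suc m))) sequentially"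
      using Wpos eventually_ge_at_top[of m0]
    proof eventually_elim
      case (elim m)
      have "\<theta> * (W (real m) / W (real (Suc m)) - W (real m0) * (1 / W (real (Suc m)))) - 2 * (real (Suc m) * r (real (Suc m)) / W (real (Suc m)))
        = (\<theta> * (W (real m) - W (real m0)) - 2 * (real (Suc m) * r (real (Suc m)))) / W (real (Suc m))"
        by (simp add: diff_divide_distrib right_diff_distrib del: of_nat_Suc)
      also have "\<dots> \<le> S (Suc m) / W (real (Suc m))"
        using lower[OF elim(2)] elim(1) by (intro divide_right_mono) auto
      finally show ?case .
    qed
    show "eventually (\<lambda>m. S (Suc m) / W (real (Suc m)) \<le> \<theta> * (1 - W (real m0) * (1 / W (real (Suc m)))) + 2 * (real (Suc m) * r (real (Suc m)) / W (real (Suc m)))) sequentially"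
      using Wpos eventually_ge_at_top[of m0]
    proof eventually_elim
      case (elim m)
      have "S (Suc m) / W (real (Suc m)) \<le> (\<theta> * (W (real (Suc m)) - W (real m0)) + 2 * (real (Suc m) * r (real (Suc m)))) / W (real (Suc m))"
        using upper[of "Suc m"] elim by (intro divide_right_mono) auto
      also have "\<dots> = \<theta> * (1 - W (real m0) * (1 / W (real (Suc m)))) + 2 * (real (Suc m) * r (real (Suc m)) / W (real (Suc m)))"
        using elim(1) by (simp add: add_divide_distrib diff_divide_distrib right_diff_distrib del: of_nat_Suc)
      finally show ?case .
    qed
    show "(\<lambda>m. \<theta> * (W (real m) / W (real (Suc m)) - W (real m0) * (1 / W (real (Suc m)))) - 2 * (real (Suc m) * r (real (Suc m)) / W (real (Suc m)))) \<longlonglongrightarrow> \<theta>"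
      using lim_lo by simp
    show "(\<lambda>m. \<theta> * (1 - W (real m0) * (1 / W (real (Suc m)))) + 2 * (real (Suc m) * r (real (Suc m)) / W (real (Suc m)))) \<longlonglongrightarrow> \<theta>"
      using lim_up by simp
  qed
  thus ?thesis unfolding S_def by (rule LIMSEQ_imp_Suc)
qed

text \<open>Along N = E(m) the count is the sum of \<open>convex_counting_limit\<close> for beta
  minus the one for alpha. A general N lies between E(m) and E(m+1); the count is monotone and
  E(m+1)/E(m) tends to 1, so the proportion is squeezed.\<close>

lemma convex_counting_proportion:
  fixes E :: "real \<Rightarrow> nat" and W r :: "real \<Rightarrow> real" and m0 :: nat
  assumes ab: "0 \<le> \<alpha>" "\<alpha> \<le> \<beta>" "\<beta> \<le> 1"
    and Emono: "\<And>u v. real m0 \<le> u \<Longrightarrow> u \<le> v \<Longrightarrow> E u \<le> E v"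
    and P: "\<And>m n. m \<ge> m0 \<Longrightarrow> E (real m) \<le> n \<Longrightarrow> n < E (real (Suc m)) \<Longrightarrow> P n \<longleftrightarrow> E (real m + \<alpha>) \<le> n \<and> n < E (real m + \<beta>)"
    and EW: "\<And>u. u \<ge> real m0 \<Longrightarrow> \<bar>real (E u) - W u\<bar> \<le> r u"
    and rmono: "\<And>u v. real m0 \<le> u \<Longrightarrow> u \<le> v \<Longrightarrow> r u \<le> r v"
    and conv: "convex_on {real m0..} W"
    and rW: "(\<lambda>m. real m * r (real m) / W (real m)) \<longlonglongrightarrow> 0"
    and WW: "(\<lambda>m. W (real (Suc m)) / W (real m)) \<longlonglongrightarrow> 1"
    and Winf: "filterlim (\<lambda>m. W (real m)) at_top sequentially"
  shows "(\<lambda>N. real (card {n. n < N \<and> P n}) / real N) \<longlonglongrightarrow> \<beta> - \<alpha>"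
proof -
  define C where "C = (\<lambda>N. card {n. n < N \<and> P n})"
  define S where "S = (\<lambda>\<theta> m. (\<Sum>j=m0..<m. real (E (real j + \<theta>)) - real (E (real j))))"
  have Slim: "(\<lambda>m. S \<theta> m / W (real m)) \<longlonglongrightarrow> \<theta>" if "0 \<le> \<theta>" "\<theta> \<le> 1" for \<theta>
    unfolding S_def by (rule convex_counting_limit[OF that Emono EW rmono conv rW WW Winf])
  have CE: "real (C (E (real m))) = real (C (E (real m0))) + S \<beta> m - S \<alpha> m" if "m \<ge> m0" for m
    using that
  proof (induction m rule: dec_induct)
    case base
    show ?case by (simp add: S_def)
  next
    case (step m)
    have o: "E (real m) \<le> E (real m + \<alpha>)" "E (real m + \<alpha>) \<le> E (real m + \<beta>)" "E (real m + \<beta>) \<le> E (real (Suc m))"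
      using step(1) ab by (auto intro!: Emono)
    have "{n. E (real m) \<le> n \<and> n < E (real (Suc m)) \<and> P n} = {E (real m + \<alpha>)..<E (real m + \<beta>)}"
      using P[OF step(1)] o by (auto simp del: of_nat_Suc)
    hence "card {n. E (real m) \<le> n \<and> n < E (real (Suc m)) \<and> P n} = E (real m + \<beta>) - E (real m + \<alpha>)" by simp
    moreover have "E (real m) \<le> E (real (Suc m))" using o by linarith
    ultimately have "C (E (real (Suc m))) = C (E (real m)) + (E (real m + \<beta>) - E (real m + \<alpha>))"
      unfolding C_def using card_less_split[of "E (real m)" "E (real (Suc m))" P] by simp
    hence "real (C (E (real (Suc m)))) = real (C (E (real m))) + (real (E (real m + \<beta>)) - real (E (real m + \<alpha>)))"
      using o by (simp add: of_nat_diff del: of_nat_Suc)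
    moreover have "S \<theta> (Suc m) = S \<theta> m + (real (E (real m + \<theta>)) - real (E (real m)))" for \<theta>
      unfolding S_def using step(1) by simp
    ultimately show ?case using step.IH by (simp del: of_nat_Suc)
  qed
  have inv0: "(\<lambda>m. 1 / W (real m)) \<longlonglongrightarrow> 0"
    using tendsto_divide_0[OF tendsto_const filterlim_at_top_imp_at_infinity[OF Winf]] .
  have Wpos: "eventually (\<lambda>m. W (real m) > 0) sequentially"
    using filterlim_at_top_dense[THEN iffD1, OF Winf] by blast
  have "(\<lambda>m. real (C (E (real m0))) * (1 / W (real m)) + S \<beta> m / W (real m) - S \<alpha> m / W (real m)) \<longlonglongrightarrow> real (C (E (real m0))) * 0 + \<beta> - \<alpha>"
    using ab by (intro tendsto_intros inv0 Slim) auto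
  moreover have "eventually (\<lambda>m. real (C (E (real m0))) * (1 / W (real m)) + S \<beta> m / W (real m) - S \<alpha> m / W (real m) = real (C (E (real m))) / W (real m)) sequentially"
    using eventually_ge_at_top[of m0]
  proof eventually_elim
    case (elim m)
    show ?case by (subst CE[OF elim]) (simp add: add_divide_distrib diff_divide_distrib)
  qed
  ultimately have C1: "(\<lambda>m. real (C (E (real m))) / W (real m)) \<longlonglongrightarrow> \<beta> - \<alpha>"
    using Lim_transform_eventually by fastforce
  have E1: "(\<lambda>m. real (E (real m)) / W (real m)) \<longlonglongrightarrow> 1"
  proof -
    have "(\<lambda>m. r (real m) / W (real m)) \<longlonglongrightarrow> 0"
    proof (rule tendsto_sandwich[OF _ _ tendsto_const rW])
      show "eventually (\<lambda>m. 0 \<le> r (real m) / W (real m)) sequentially"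
        using Wpos eventually_ge_at_top[of m0]
      proof eventually_elim
        case (elim m)
        have "r (real m) \<ge> 0" using EW[of "real m"] elim by auto
        thus ?case using elim by simp
      qed
      show "eventually (\<lambda>m. r (real m) / W (real m) \<le> real m * r (real m) / W (real m)) sequentially"
        using Wpos eventually_ge_at_top[of m0] eventually_ge_at_top[of 1]
      proof eventually_elim
        case (elim m)
        have "r (real m) \<ge> 0" using EW[of "real m"] elim by auto
        hence "1 * r (real m) \<le> real m * r (real m)" using elim by (intro mult_right_mono) auto
        thus ?case using elim by (intro divide_right_mono) auto
      qed
    qed
    hence "(\<lambda>m. (real (E (real m)) - W (real m)) / W (real m)) \<longlonglongrightarrow> 0"
    proof (rule Lim_null_comparison[rotated])
      show "eventually (\<lambda>m. norm ((real (E (real m)) - W (real m)) / W (real m)) \<le> r (real m) / W (real m)) sequentially"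
        using Wpos eventually_ge_at_top[of m0]
      proof eventually_elim
        case (elim m)
        have "\<bar>real (E (real m)) - W (real m)\<bar> \<le> r (real m)" using EW elim by simp
        hence "\<bar>real (E (real m)) - W (real m)\<bar> / W (real m) \<le> r (real m) / W (real m)"
          using elim by (intro divide_right_mono) auto
        thus ?case using elim by (simp add: abs_divide)
      qed
    qed
    hence "(\<lambda>m. (real (E (real m)) - W (real m)) / W (real m) + 1) \<longlonglongrightarrow> 0 + 1" by (intro tendsto_intros)
    moreover have "eventually (\<lambda>m. (real (E (real m)) - W (real m)) / W (real m) + 1 = real (E (real m)) / W (real m)) sequentially"
      using Wpos by eventually_elim (simp add: diff_divide_distrib)
    ultimately show ?thesis using Lim_transform_eventually by fastforce
  qed
  have Einf: "filterlim (\<lambda>m. real (E (real m))) at_top sequentially"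
  proof -
    have "filterlim (\<lambda>m. real (E (real m)) / W (real m) * W (real m)) at_top sequentially"
      by (rule filterlim_tendsto_pos_mult_at_top[OF E1 _ Winf]) simp
    moreover have "eventually (\<lambda>m. real (E (real m)) / W (real m) * W (real m) = real (E (real m))) sequentially"
      using Wpos by eventually_elim simp
    ultimately show ?thesis by (rule filterlim_mono_eventually[OF _ order_refl order_refl])
  qed
  have WW': "(\<lambda>m. W (real m) / W (real (Suc m))) \<longlonglongrightarrow> 1"
    using tendsto_inverse[OF WW] by simp
  have lo: "(\<lambda>m. real (C (E (real m))) / real (E (real (Suc m)))) \<longlonglongrightarrow> \<beta> - \<alpha>"
  proof -
    have "(\<lambda>m. (real (C (E (real m))) / W (real m)) * (W (real m) / W (real (Suc m))) / (real (E (real (Suc m))) / W (real (Suc m)))) \<longlonglongrightarrow> (\<beta> - \<alpha>) * 1 / 1"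
      by (intro tendsto_intros C1 WW' LIMSEQ_Suc[OF E1]) auto
    moreover have "eventually (\<lambda>m. W (real (Suc m)) > 0) sequentially" using Wpos by (rule eventually_sequentially_Suc[THEN iffD2])
    with Wpos have "eventually (\<lambda>m. (real (C (E (real m))) / W (real m)) * (W (real m) / W (real (Suc m))) / (real (E (real (Suc m))) / W (real (Suc m))) = real (C (E (real m))) / real (E (real (Suc m)))) sequentially"
      by eventually_elim (simp del: of_nat_Suc)
    ultimately show ?thesis using Lim_transform_eventually by fastforce
  qed
  have hi: "(\<lambda>m. real (C (E (real (Suc m)))) / real (E (real m))) \<longlonglongrightarrow> \<beta> - \<alpha>"
  proof -
    have "(\<lambda>m. (real (C (E (real (Suc m)))) / W (real (Suc m))) * (W (real (Suc m)) / W (real m)) / (real (E (real m)) / W (real m))) \<longlonglongrightarrow> (\<beta> - \<alpha>) * 1 / 1"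
      by (intro tendsto_intros LIMSEQ_Suc[OF C1] WW E1) auto
    moreover have "eventually (\<lambda>m. W (real (Suc m)) > 0) sequentially" using Wpos by (rule eventually_sequentially_Suc[THEN iffD2])
    with Wpos have "eventually (\<lambda>m. (real (C (E (real (Suc m)))) / W (real (Suc m))) * (W (real (Suc m)) / W (real m)) / (real (E (real m)) / W (real m)) = real (C (E (real (Suc m)))) / real (E (real m))) sequentially"
      by eventually_elim (simp del: of_nat_Suc)
    ultimately show ?thesis using Lim_transform_eventually by fastforce
  qed
  show ?thesis
  proof (rule LIMSEQ_I)
    fix e :: real assume e: "e > 0"
    have "eventually (\<lambda>m. \<beta> - \<alpha> - e < real (C (E (real m))) / real (E (real (Suc m)))) sequentially"
      using e by (intro order_tendstoD(1)[OF lo]) simp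
    moreover have "eventually (\<lambda>m. real (C (E (real (Suc m)))) / real (E (real m)) < \<beta> - \<alpha> + e) sequentially"
      using e by (intro order_tendstoD(2)[OF hi]) simp
    moreover have "eventually (\<lambda>m. real (E (real m)) > 0) sequentially"
      using filterlim_at_top_dense[THEN iffD1, OF Einf] by blast
    ultimately have "eventually (\<lambda>m. \<beta> - \<alpha> - e < real (C (E (real m))) / real (E (real (Suc m))) \<and> real (C (E (real (Suc m)))) / real (E (real m)) < \<beta> - \<alpha> + e \<and> real (E (real m)) > 0 \<and> m \<ge> m0) sequentially"
      using eventually_ge_at_top[of m0] by eventually_elim auto
    then obtain m1 where m1: "\<And>m. m \<ge> m1 \<Longrightarrow> \<beta> - \<alpha> - e < real (C (E (real m))) / real (E (real (Suc m))) \<and> real (C (E (real (Suc m)))) / real (E (real m)) < \<beta> - \<alpha> + e \<and> real (E (real m)) > 0 \<and> m \<ge> m0"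
      unfolding eventually_sequentially by blast
    show "\<exists>no. \<forall>N\<ge>no. norm (real (card {n. n < N \<and> P n}) / real N - (\<beta> - \<alpha>)) < e"
    proof (intro exI allI impI)
      fix N assume N: "N \<ge> E (real m1)"
      have "eventually (\<lambda>m. real (E (real m)) > real N) sequentially"
        using filterlim_at_top_dense[THEN iffD1, OF Einf] by blast
      then obtain m2 where m2: "\<And>m. m \<ge> m2 \<Longrightarrow> real (E (real m)) > real N" unfolding eventually_sequentially by blast
      define m where "m = Max {m. m \<ge> m1 \<and> E (real m) \<le> N}"
      have fin: "finite {m. m \<ge> m1 \<and> E (real m) \<le> N}"
      proof (rule finite_subset)
        show "{m. m \<ge> m1 \<and> E (real m) \<le> N} \<subseteq> {..<m2}"
        proof
          fix m assume "m \<in> {m. m \<ge> m1 \<and> E (real m) \<le> N}"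
          thus "m \<in> {..<m2}" using m2[of m] by (cases "m < m2") auto
        qed
      qed simp
      have ne: "{m. m \<ge> m1 \<and> E (real m) \<le> N} \<noteq> {}" using N by auto
      have m: "m \<ge> m1" "E (real m) \<le> N" using Max_in[OF fin ne] unfolding m_def by auto
      have mS: "N < E (real (Suc m))"
      proof (rule ccontr)
        assume "\<not> N < E (real (Suc m))"
        hence "Suc m \<in> {m. m \<ge> m1 \<and> E (real m) \<le> N}" using m(1) by (simp del: of_nat_Suc)
        hence "Suc m \<le> m" unfolding m_def using fin by (rule Max_ge[rotated])
        thus False by simp
      qed
      note mm = m1[OF m(1)]
      have Em: "E (real m) > 0" using mm by simp
      have Cmono: "C a \<le> C b" if "a \<le> b" for a b unfolding C_def using card_less_split[OF that, of P] by simp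
      have "real (C (E (real m))) / real (E (real (Suc m))) \<le> real (C N) / real N"
        using Cmono[OF m(2)] mS Em m(2) by (intro frac_le) auto
      moreover have "real (C N) / real N \<le> real (C (E (real (Suc m)))) / real (E (real m))"
        using Cmono[of N "E (real (Suc m))"] mS Em m(2) by (intro frac_le) auto
      ultimately have "\<bar>real (C N) / real N - (\<beta> - \<alpha>)\<bar> < e" using mm by linarith
      thus "norm (real (card {n. n < N \<and> P n}) / real N - (\<beta> - \<alpha>)) < e" by (simp add: C_def)
    qed
  qed
qed

section \<open>Enumerations of the a-points\<close>

text \<open>Minimal elements are removed one after another. An element never reached would bound h
  on the whole infinite range, against the finiteness of the sublevel sets.\<close>

lemma sorted_enumeration_exists:
  fixes S :: "'a set" and h :: "'a \<Rightarrow> real"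
  assumes inf: "infinite S" and fin: "\<And>T. finite {p\<in>S. h p \<le> T}"
  obtains y :: "nat \<Rightarrow> 'a" where "bij_betw y UNIV S" "mono (\<lambda>n. h (y n))"
proof -
  have min: "\<exists>p. p \<in> S' \<and> (\<forall>q\<in>S'. h p \<le> h q)" if S': "S' \<subseteq> S" "S' \<noteq> {}" for S'
  proof -
    obtain p0 where p0: "p0 \<in> S'" using S' by blast
    define A where "A = {p\<in>S'. h p \<le> h p0}"
    have A: "finite A" "A \<noteq> {}" using finite_subset[OF _ fin[of "h p0"], of A] S' p0 by (auto simp: A_def)
    obtain p where p: "p \<in> A" "\<And>q. q \<in> A \<Longrightarrow> h p \<le> h q"
      using ex_min_if_finite[of "h ` A"] A by (metis (no_types, lifting) finite_imageI image_iff image_is_empty not_le)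
    have "h p \<le> h q" if "q \<in> S'" for q
      using p that by (cases "h q \<le> h p0") (auto simp: A_def)
    thus ?thesis using p(1) by (auto simp: A_def)
  qed
  define pick where "pick = (\<lambda>S'. SOME p. p \<in> S' \<and> (\<forall>q\<in>S'. h p \<le> h q))"
  have pick: "pick S' \<in> S' \<and> (\<forall>q\<in>S'. h (pick S') \<le> h q)" if "S' \<subseteq> S" "S' \<noteq> {}" for S'
    unfolding pick_def by (rule someI_ex[OF min[OF that]])
  define B where "B = rec_nat {} (\<lambda>_ A. insert (pick (S - A)) A)"
  have B0: "B 0 = {}" and BS: "B (Suc n) = insert (pick (S - B n)) (B n)" for n by (simp_all add: B_def)
  define y where "y = (\<lambda>n. pick (S - B n))"
  have Bfin: "finite (B n)" for n by (induction n) (auto simp: B0 BS)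
  have ne: "S - B n \<noteq> {}" for n using Bfin[of n] inf by (metis Diff_eq_empty_iff finite_subset)
  have yin: "y n \<in> S - B n" and ymin: "\<And>q. q \<in> S - B n \<Longrightarrow> h (y n) \<le> h q" for n
    using pick[of "S - B n"] ne[of n] unfolding y_def by auto
  have By: "B n = y ` {..<n}" for n by (induction n) (auto simp: B0 BS y_def lessThan_Suc)
  have inj: "inj y"
  proof (rule linorder_injI)
    fix m n :: nat assume "m < n"
    hence "y m \<in> B n" by (auto simp: By)
    thus "y m \<noteq> y n" using yin[of n] by auto
  qed
  have mon: "mono (\<lambda>n. h (y n))"
  proof (rule mono_iff_le_Suc[THEN iffD2], rule allI)
    fix n
    show "h (y n) \<le> h (y (Suc n))" using yin[of "Suc n"] by (intro ymin) (auto simp: BS)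
  qed
  have "range y = S"
  proof
    show "range y \<subseteq> S" using yin by auto
    show "S \<subseteq> range y"
    proof
      fix p assume p: "p \<in> S"
      show "p \<in> range y"
      proof (rule ccontr)
        assume np: "p \<notin> range y"
        have "p \<in> S - B n" for n using p np by (auto simp: By)
        hence "range y \<subseteq> {q\<in>S. h q \<le> h p}" using yin ymin by auto
        hence "finite (range y)" using fin finite_subset by blast
        thus False using inj finite_imageD by blast
      qed
    qed
  qed
  thus ?thesis using that[of y] inj mon by (simp add: bij_betw_def)
qed

text \<open>The order at a zero is positive because the difference to a does not vanish identically:
  it is nonzero far to the right.\<close>

lemma a_point_mult_pos:
  assumes "zeta_deriv k p = a" "Im p > 1"
  shows "a_point_mult k a p > 0"
proof -
  obtain X where X: "X \<ge> 3" "\<And>s. Im s > 1/2 \<Longrightarrow> \<bar>Re s\<bar> \<ge> X \<Longrightarrow> zeta_deriv k s \<noteq> a"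
    by (rule rectangle_setup[of k a]) (rule that)
  define F where "F = (\<lambda>s. zeta_deriv k s - a)"
  have "connected (- {1::complex})" by (rule connected_punctured_universe) simp
  hence conn: "connected (UNIV - {1::complex})" by (simp add: Compl_eq_Diff_UNIV)
  have op: "open (UNIV - {1::complex})" by auto
  have Fh: "F holomorphic_on UNIV - {1}" unfolding F_def by (intro holomorphic_intros holomorphic_on_zeta_deriv)
  have p1: "p \<in> UNIV - {1}" using assms by auto
  have "F (Complex X 1) \<noteq> 0" "Complex X 1 \<in> UNIV - {1}"
    using X(1) X(2)[of "Complex X 1"] by (auto simp: F_def complex_eq_iff)
  hence nc: "\<exists>w\<in>UNIV - {1}. F w \<noteq> 0" by blast
  have "zorder F p > 0" using zorder_exist_zero[OF Fh op conn p1 nc] assms by (simp add: F_def)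
  thus ?thesis using assms by (simp add: a_point_mult_def F_def)
qed

lemma zeta_count_unbounded: "\<exists>T. zeta_count k a T > B"
proof -
  obtain K T0 where K: "K \<ge> 0" "T0 \<ge> 3"
    "\<And>T. T \<ge> T0 \<Longrightarrow> \<bar>2 * pi * real (zeta_count k a T) - T * (ln (T / (2 * pi * real (n_ak a k))) - 1)\<bar> \<le> K * ln T"
    by (rule zeta_count_asymptotic[of k a]) (rule that)
  define w where "w = 2 * pi * real (n_ak a k)"
  have w: "w > 0" by (simp add: w_def n_ak_def)
  have "filterlim (\<lambda>T. T * (ln (T / w) - 1) - K * ln T) at_top at_top" using w by real_asymp
  hence "eventually (\<lambda>T. T * (ln (T / w) - 1) - K * ln T > 2 * pi * real B) at_top"
    by (rule filterlim_at_top_dense[THEN iffD1, rule_format])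
  hence "eventually (\<lambda>T. T * (ln (T / w) - 1) - K * ln T > 2 * pi * real B \<and> T \<ge> T0) at_top"
    using eventually_ge_at_top[of T0] by eventually_elim auto
  from eventually_happens'[OF trivial_limit_at_top_linorder this]
  obtain T where T: "T * (ln (T / w) - 1) - K * ln T > 2 * pi * real B" "T \<ge> T0" by auto
  have "2 * pi * real (zeta_count k a T) \<ge> T * (ln (T / w) - 1) - K * ln T"
    using K(3)[OF T(2)] unfolding w_def[symmetric] by linarith
  hence "2 * pi * real (zeta_count k a T) > 2 * pi * real B" using T(1) by linarith
  thus ?thesis by (intro exI[of _ T]) simp
qed

text \<open>Multiplicity is realised by pairs (p, i) with i below the multiplicity of p. The
  asymptotic count shows that there are infinitely many pairs, so they can be indexed by all natural
  numbers.\<close>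

lemma a_points_enumeration_exists: "\<exists>x. enumerates_a_points k a x"
proof -
  define S where "S = (SIGMA p:{p. zeta_deriv k p = a \<and> 1 < Im p}. {..<a_point_mult k a p})"
  have eqT: "{q\<in>S. Im (fst q) \<le> T} = (SIGMA p:{p. zeta_deriv k p = a \<and> 1 < Im p \<and> Im p \<le> T}. {..<a_point_mult k a p})" for T
    by (auto simp: S_def)
  have fin: "finite {q\<in>S. Im (fst q) \<le> T}" for T
    unfolding eqT by (intro finite_SigmaI zeta_zeros_finite_upto) auto
  have card: "card {q\<in>S. Im (fst q) \<le> T} = zeta_count k a T" for T
    unfolding eqT zeta_count_def by (simp add: card_SigmaI zeta_zeros_finite_upto)
  have inf: "infinite S"
  proof
    assume fS: "finite S"
    obtain T where "zeta_count k a T > card S" using zeta_count_unbounded by blast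
    moreover have "zeta_count k a T \<le> card S" unfolding card[symmetric] using fS by (intro card_mono) auto
    ultimately show False by simp
  qed
  obtain y :: "nat \<Rightarrow> complex \<times> nat" where y: "bij_betw y UNIV S" "mono (\<lambda>n. Im (fst (y n)))"
    by (rule sorted_enumeration_exists[of S "\<lambda>q. Im (fst q)", OF inf fin]) (rule that)
  have rng: "range y = S" and inj: "inj y" using y(1) unfolding bij_betw_def by simp_all
  have inS: "y n \<in> S" for n using rng by blast
  have "card {n. fst (y n) = p} = a_point_mult k a p" if p: "1 < Im p" for p
  proof -
    have "y ` {n. fst (y n) = p} = {q\<in>S. fst q = p}"
      unfolding rng[symmetric] by auto
    moreover have "inj_on y {n. fst (y n) = p}" by (rule inj_on_subset[OF inj]) simp
    ultimately have "card {n. fst (y n) = p} = card {q\<in>S. fst q = p}" using card_image by metis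
    also have "{q\<in>S. fst q = p} = (if zeta_deriv k p = a then {p} \<times> {..<a_point_mult k a p} else {})"
    proof -
      have "{q\<in>Sigma A F. fst q = p} = (if p \<in> A then {p} \<times> F p else {})"
        for A :: "complex set" and F :: "complex \<Rightarrow> nat set" by auto
      thus ?thesis unfolding S_def using p by simp
    qed
    also have "card \<dots> = a_point_mult k a p" by (simp add: a_point_mult_def)
    finally show ?thesis .
  qed
  thus ?thesis unfolding enumerates_a_points_def
  proof (intro exI[of _ "\<lambda>n. fst (y n)"] conjI allI impI)
    fix n
    show "zeta_deriv k (fst (y n)) = a" "1 < Im (fst (y n))" using inS[of n] by (auto simp: S_def)
  qed (use y(2) in auto)
qed

lemma enumerates_a_points_count:
  assumes x: "enumerates_a_points k a x"
  shows "finite {n. Im (x n) \<le> T}" "card {n. Im (x n) \<le> T} = zeta_count k a T"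
proof -
  define Z where "Z = {p. zeta_deriv k p = a \<and> 1 < Im p \<and> Im p \<le> T}"
  have Z: "finite Z" unfolding Z_def by (rule zeta_zeros_finite_upto)
  have x1: "zeta_deriv k (x n) = a" "1 < Im (x n)" for n using x by (auto simp: enumerates_a_points_def)
  have x2: "card {n. x n = p} = a_point_mult k a p" if "1 < Im p" for p using x that by (auto simp: enumerates_a_points_def)
  have eq: "{n. Im (x n) \<le> T} = (\<Union>p\<in>Z. {n. x n = p})" using x1 by (auto simp: Z_def)
  have f: "finite {n. x n = p}" if "p \<in> Z" for p
  \<comment> \<open>An infinite fibre would have \<open>card\<close> equal to 0, so positive
    multiplicity forces it to be finite.\<close>
  proof (rule card_ge_0_finite)
    show "card {n. x n = p} > 0" using that x2[of p] a_point_mult_pos[of k p a] by (auto simp: Z_def)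
  qed
  show "finite {n. Im (x n) \<le> T}" unfolding eq using Z f by (rule finite_UN_I)
  have "card {n. Im (x n) \<le> T} = (\<Sum>p\<in>Z. card {n. x n = p})"
    unfolding eq using Z f by (intro card_UN_disjoint) auto
  also have "\<dots> = (\<Sum>p\<in>Z. a_point_mult k a p)" by (intro sum.cong refl x2) (auto simp: Z_def)
  finally show "card {n. Im (x n) \<le> T} = zeta_count k a T" by (simp add: zeta_count_def Z_def)
qed

section \<open>Slowly growing concave functions\<close>

text \<open>What remains of the conditions on f once the sign is normalised. \<open>anti\<close> is
  concavity, \<open>slow\<close> limits the number of unit intervals met up to height t, and
  \<open>inv_o\<close> makes the endpoints of neighbouring ones asymptotically equal.\<close>

locale slow_concave =
  fixes h h' :: "real \<Rightarrow> real" and c :: real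
  assumes c1: "c \<ge> 1"
    and deriv: "\<And>t. t > c \<Longrightarrow> (h has_real_derivative h' t) (at t)"
    and pos: "\<And>t. t > c \<Longrightarrow> h' t > 0"
    and anti: "\<And>s t. c < s \<Longrightarrow> s \<le> t \<Longrightarrow> h' t \<le> h' s"
    and slow: "((\<lambda>t. h t / t) \<longlongrightarrow> 0) at_top"
    and unbounded: "filterlim h at_top at_top"
    and inv_o: "((\<lambda>t. 1 / (t * h' t)) \<longlongrightarrow> 0) at_top"
begin

lemma mono: "c < s \<Longrightarrow> s < t \<Longrightarrow> h s < h t"
proof (rule DERIV_pos_imp_increasing[of s t h])
  show "\<exists>y. (h has_real_derivative y) (at x) \<and> 0 < y" if "c < s" "s \<le> x" "x \<le> t" for x
    using deriv[of x] pos[of x] that by auto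
qed auto

lemma mono_le_iff: "c < s \<Longrightarrow> c < t \<Longrightarrow> h s \<le> h t \<longleftrightarrow> s \<le> t"
  using mono[of s t] mono[of t s] by (cases s t rule: linorder_cases) auto

lemma mono_less_iff: "c < s \<Longrightarrow> c < t \<Longrightarrow> h s < h t \<longleftrightarrow> s < t"
  using mono_le_iff[of t s] by (auto simp: not_le[symmetric])

lemma inverse_exists: "u \<ge> h (c + 1) \<Longrightarrow> \<exists>t. t \<ge> c + 1 \<and> h t = u"
proof -
  assume u: "u \<ge> h (c + 1)"
  have "eventually (\<lambda>t. h t \<ge> u \<and> t \<ge> c + 1) at_top"
    using unbounded eventually_ge_at_top[of "c + 1"] by (auto simp: filterlim_at_top intro: eventually_conj)
  from eventually_happens'[OF trivial_limit_at_top_linorder this]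
  obtain t where t: "h t \<ge> u" "t \<ge> c + 1" by auto
  have "\<exists>x\<ge>c + 1. x \<le> t \<and> h x = u"
    using u t by (intro IVT') (auto intro!: continuous_at_imp_continuous_on DERIV_isCont deriv)
  thus ?thesis by blast
qed

definition g :: "real \<Rightarrow> real" where
  "g u = (SOME t. t \<ge> c + 1 \<and> h t = u)"

lemma g: "u \<ge> h (c + 1) \<Longrightarrow> g u \<ge> c + 1" "u \<ge> h (c + 1) \<Longrightarrow> h (g u) = u"
  using someI_ex[OF inverse_exists[of u]] unfolding g_def by auto

lemma g_le_iff:
  assumes "u \<ge> h (c + 1)" "t > c"
  shows "g u \<le> t \<longleftrightarrow> u \<le> h t" "g u < t \<longleftrightarrow> u < h t" "t \<le> g u \<longleftrightarrow> h t \<le> u" "t < g u \<longleftrightarrow> h t < u"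
  using mono_le_iff[of "g u" t] mono_le_iff[of t "g u"] mono_less_iff[of "g u" t] mono_less_iff[of t "g u"] g[OF assms(1)] assms(2) by auto

lemma g_mono: "u \<ge> h (c + 1) \<Longrightarrow> u \<le> v \<Longrightarrow> g u \<le> g v"
  using g_le_iff(1)[of u "g v"] g[of u] g[of v] by auto

lemma h_tangent:
  assumes "s > c" "t > c"
  shows "h t \<le> h s + h' s * (t - s)"
proof (cases s t rule: linorder_cases)
  case less
  have "\<exists>z. s < z \<and> z < t \<and> h t - h s = (t - s) * h' z"
    using less assms by (intro MVT2 deriv) auto
  then obtain z where z: "s < z" "z < t" "h t - h s = (t - s) * h' z" by blast
  have "(t - s) * h' z \<le> (t - s) * h' s" using z less assms by (intro mult_left_mono anti) auto
  thus ?thesis using z by (simp add: algebra_simps)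
next
  case greater
  have "\<exists>z. t < z \<and> z < s \<and> h s - h t = (s - t) * h' z"
    using greater assms by (intro MVT2 deriv) auto
  then obtain z where z: "t < z" "z < s" "h s - h t = (s - t) * h' z" by blast
  have "(s - t) * h' s \<le> (s - t) * h' z" using z greater assms by (intro mult_left_mono anti) auto
  thus ?thesis using z by (simp add: algebra_simps)
qed simp

lemma g_at_top: "filterlim g at_top at_top"
proof (subst filterlim_at_top, rule allI)
  fix Z :: real
  define Z' where "Z' = max Z (c + 1)"
  have "eventually (\<lambda>u. u \<ge> max (h Z') (h (c + 1))) at_top" by (rule eventually_ge_at_top)
  thus "eventually (\<lambda>u. Z \<le> g u) at_top"
  proof eventually_elim
    case (elim u)
    have "Z' \<le> g u" using elim by (subst g_le_iff(3)) (auto simp: Z'_def)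
    thus ?case by (simp add: Z'_def)
  qed
qed

text \<open>The inverse of an increasing concave function is convex: h lies below its tangent at t =
  (1 - l) g x + l g y, and averaging the two tangent inequalities cancels the slope.\<close>

lemma g_convex:
  assumes "x \<ge> h (c + 1)" "y \<ge> h (c + 1)" "0 \<le> l" "l \<le> 1"
  shows "g ((1 - l) * x + l * y) \<le> (1 - l) * g x + l * g y"
proof -
  define t where "t = (1 - l) * g x + l * g y"
  have "(1 - l) * (c + 1) + l * (c + 1) \<le> t" unfolding t_def
    using assms g(1) by (intro add_mono mult_left_mono) auto
  hence t: "t > c" by (simp add: algebra_simps)
  have xy: "(1 - l) * h (c + 1) + l * h (c + 1) \<le> (1 - l) * x + l * y"
    using assms by (intro add_mono mult_left_mono) auto
  hence u: "(1 - l) * x + l * y \<ge> h (c + 1)" by (simp add: algebra_simps)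
  have "x \<le> h t + h' t * (g x - t)" "y \<le> h t + h' t * (g y - t)"
    using h_tangent[OF t, of "g x"] h_tangent[OF t, of "g y"] g[OF assms(1)] g[OF assms(2)] by auto
  hence "(1 - l) * x + l * y \<le> (1 - l) * (h t + h' t * (g x - t)) + l * (h t + h' t * (g y - t))"
    using assms by (intro add_mono mult_left_mono) auto
  also have "\<dots> = h t + h' t * ((1 - l) * g x + l * g y - t)" by (simp add: algebra_simps)
  also have "\<dots> = h t" by (simp add: t_def)
  finally show ?thesis using g_le_iff(1)[OF u t] by (simp add: t_def)
qed

end

text \<open>Leading term of the count of a-points when w = 2 pi n.\<close>

definition main_term :: "real \<Rightarrow> real \<Rightarrow> real" where
  "main_term w t = t * (ln (t / w) - 1) / (2 * pi)"

lemma main_term_deriv: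
  assumes "w > 0" "t > 0"
  shows "(main_term w has_real_derivative ln (t / w) / (2 * pi)) (at t)"
proof -
  have "((\<lambda>t. t * (ln (t / w) - 1)) has_real_derivative ln (t / w)) (at t)"
    using assms by (auto intro!: derivative_eq_intros)
  thus ?thesis unfolding main_term_def[abs_def] by (rule DERIV_cdivide)
qed

lemma main_term_tangent:
  assumes w: "w > 0" and s: "s > 0" "t > 0"
  shows "main_term w s + ln (s / w) / (2 * pi) * (t - s) \<le> main_term w t"
proof (cases s t rule: linorder_cases)
  case less
  have "\<exists>z. s < z \<and> z < t \<and> main_term w t - main_term w s = (t - s) * (ln (z / w) / (2 * pi))"
    using less s w by (intro MVT2 main_term_deriv) auto
  then obtain z where z: "s < z" "z < t" "main_term w t - main_term w s = (t - s) * (ln (z / w) / (2 * pi))" by blast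
  have "ln (s / w) \<le> ln (z / w)" using z s w by (intro ln_mono divide_right_mono) auto
  hence "(t - s) * (ln (s / w) / (2 * pi)) \<le> (t - s) * (ln (z / w) / (2 * pi))"
    using less by (intro mult_left_mono divide_right_mono) auto
  thus ?thesis using z by (simp add: mult.commute)
next
  case greater
  have "\<exists>z. t < z \<and> z < s \<and> main_term w s - main_term w t = (s - t) * (ln (z / w) / (2 * pi))"
    using greater s w by (intro MVT2 main_term_deriv) auto
  then obtain z where z: "t < z" "z < s" "main_term w s - main_term w t = (s - t) * (ln (z / w) / (2 * pi))" by blast
  have "ln (z / w) \<le> ln (s / w)" using z s w by (intro ln_mono divide_right_mono) auto
  hence "(s - t) * (ln (z / w) / (2 * pi)) \<le> (s - t) * (ln (s / w) / (2 * pi))"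
    using greater by (intro mult_left_mono divide_right_mono) auto
  moreover have "k * (t - s) = - ((s - t) * k)" for k :: real by (simp add: algebra_simps)
  note this[of "ln (s / w) / (2 * pi)"]
  ultimately show ?thesis using z by linarith
qed simp

context slow_concave
begin

text \<open>A convex function of the convex g is convex where it is nondecreasing. The tangent slope
  of \<open>main_term w\<close> at s is nonnegative once s >= w, which c >= w secures.\<close>

lemma main_term_g_convex:
  assumes w: "w > 0" "c \<ge> w" and u0: "u0 \<ge> h (c + 1)"
  shows "convex_on {u0..} (\<lambda>u. main_term w (g u))"
proof (rule convex_onI)
  fix l x y :: real assume l: "0 < l" "l < 1" and xy: "x \<in> {u0..}" "y \<in> {u0..}"
  have x: "x \<ge> h (c + 1)" "y \<ge> h (c + 1)" using xy u0 by auto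
  define s where "s = g ((1 - l) * x + l * y)"
  have "(1 - l) * h (c + 1) + l * h (c + 1) \<le> (1 - l) * x + l * y"
    using x l by (intro add_mono mult_left_mono) auto
  hence u: "(1 - l) * x + l * y \<ge> h (c + 1)" by (simp add: algebra_simps)
  have s: "s \<ge> c + 1" "s > 0" "s / w \<ge> 1" using g(1)[OF u] c1 w by (auto simp: s_def)
  have gx: "g x > 0" "g y > 0" using g(1)[OF x(1)] g(1)[OF x(2)] c1 by auto
  have sle: "s \<le> (1 - l) * g x + l * g y" unfolding s_def using l by (intro g_convex x) auto
  define k where "k = ln (s / w) / (2 * pi)"
  have k: "k \<ge> 0" using s by (simp add: k_def)
  have "main_term w s \<le> main_term w s + k * ((1 - l) * g x + l * g y - s)"
    using k sle by simp
  also have "\<dots> = (1 - l) * (main_term w s + k * (g x - s)) + l * (main_term w s + k * (g y - s))"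
    by (simp add: algebra_simps)
  also have "\<dots> \<le> (1 - l) * main_term w (g x) + l * main_term w (g y)"
    unfolding k_def using l w s gx by (intro add_mono mult_left_mono main_term_tangent) auto
  finally show "main_term w (g ((1 - l) *\<^sub>R x + l *\<^sub>R y)) \<le> (1 - l) * main_term w (g x) + l * main_term w (g y)"
    by (simp add: s_def)
qed simp

end

context slow_concave
begin

lemma eventually_g: "eventually (\<lambda>u. u \<ge> h (c + 1) \<and> g u \<ge> Z \<and> g u \<ge> c + 1 \<and> h (g u) = u) at_top"
proof -
  have "eventually (\<lambda>u. g u \<ge> Z) at_top" using g_at_top by (simp add: filterlim_at_top)
  thus ?thesis using eventually_ge_at_top[of "h (c + 1)"] by eventually_elim (auto simp: g)
qed

text \<open>Put t = g u, so u = h t. As \<open>main_term w t\<close> is asymptotic to t ln t / (2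
  pi), the quotient is a bounded multiple of h t / t.\<close>

lemma error_limit:
  assumes w: "w > 0"
  shows "((\<lambda>u. u * (K * ln (g u)) / main_term w (g u)) \<longlongrightarrow> 0) at_top"
proof -
  have "((\<lambda>t. t * ln t / (t * (ln (t / w) - 1))) \<longlongrightarrow> 1) at_top" using w by real_asymp
  moreover have eq: "K * (a / (b / (2 * pi))) = K * (2 * pi) * (a / b)" for a b :: real by simp
  ultimately
  have "((\<lambda>t. K * (t * ln t / main_term w t)) \<longlongrightarrow> K * (2 * pi)) at_top"
    unfolding main_term_def eq using tendsto_mult[OF tendsto_const, of _ 1 _ "K * (2 * pi)"] by simp
  from tendsto_mult[OF slow this]
  have "((\<lambda>t. h t / t * (K * (t * ln t / main_term w t))) \<longlongrightarrow> 0) at_top" by simp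
  from filterlim_compose[OF this g_at_top]
  have "((\<lambda>u. h (g u) / g u * (K * (g u * ln (g u) / main_term w (g u)))) \<longlongrightarrow> 0) at_top" .
  moreover have "eventually (\<lambda>u. h (g u) / g u * (K * (g u * ln (g u) / main_term w (g u))) = u * (K * ln (g u)) / main_term w (g u)) at_top"
    using eventually_g[of 1] by eventually_elim auto
  ultimately show ?thesis by (rule Lim_transform_eventually)
qed

text \<open>By the tangent at t = g(u + 1), one unit of h costs at most 1/h'(t) in the argument, so
  g u / t is at least 1 - 1/(t h'(t)).\<close>

lemma g_shift_ratio: "((\<lambda>u. g u / g (u + 1)) \<longlongrightarrow> 1) at_top"
proof -
  have sh: "filterlim (\<lambda>u::real. u + 1) at_top at_top" by real_asymp
  have "((\<lambda>u. 1 / (g (u + 1) * h' (g (u + 1)))) \<longlongrightarrow> 0) at_top"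
    by (rule filterlim_compose[OF filterlim_compose[OF inv_o g_at_top] sh])
  from tendsto_diff[OF tendsto_const this, of 1]
  have lo: "((\<lambda>u. 1 - 1 / (g (u + 1) * h' (g (u + 1)))) \<longlongrightarrow> 1) at_top" by simp
  show ?thesis
  proof (rule tendsto_sandwich[OF _ _ lo tendsto_const])
    show "eventually (\<lambda>u. g u / g (u + 1) \<le> 1) at_top"
      using eventually_g[of 1]
    proof eventually_elim
      case (elim u)
      hence "g u \<le> g (u + 1)" by (intro g_mono) auto
      thus ?case using elim by (simp add: divide_simps)
    qed
    show "eventually (\<lambda>u. 1 - 1 / (g (u + 1) * h' (g (u + 1))) \<le> g u / g (u + 1)) at_top"
      using eventually_g[of 1]
    proof eventually_elim
      case (elim u)
      define s where "s = g u" 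
      define t where "t = g (u + 1)"
      have t: "t \<ge> c + 1" "h t = u + 1" using elim g[of "u + 1"] by (auto simp: t_def)
      have s: "s \<ge> c + 1" "h s = u" using elim by (auto simp: s_def)
      have t0: "t > 0" "h' t > 0" using t c1 pos[of t] by auto
      have "h s \<le> h t + h' t * (s - t)" using s t by (intro h_tangent) auto
      hence "t * h' t - 1 \<le> s * h' t" using s t by (simp add: algebra_simps)
      hence "(t * h' t - 1) / (t * h' t) \<le> s * h' t / (t * h' t)" using t0 by (intro divide_right_mono) auto
      moreover have "(t * h' t - 1) / (t * h' t) = 1 - 1 / (t * h' t)" using t0 by (simp add: diff_divide_distrib)
      moreover have "s * h' t / (t * h' t) = s / t" using t0 by simp
      ultimately show ?case unfolding s_def t_def by simp
    qed
  qed
qed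

lemma main_term_shift_ratio:
  assumes w: "w > 0"
  shows "((\<lambda>u. main_term w (g (u + 1)) / main_term w (g u)) \<longlongrightarrow> 1) at_top"
proof -
  have r: "((\<lambda>u. g (u + 1) / g u) \<longlongrightarrow> 1) at_top" using tendsto_inverse[OF g_shift_ratio] by simp
  have ln0: "((\<lambda>u. ln (g (u + 1) / g u)) \<longlongrightarrow> 0) at_top" using tendsto_ln[OF r] by simp
  have "((\<lambda>t. 1 / (ln (t / w) - 1)) \<longlongrightarrow> 0) at_top" using w by real_asymp
  from filterlim_compose[OF this g_at_top]
  have inv: "((\<lambda>u. 1 / (ln (g u / w) - 1)) \<longlongrightarrow> 0) at_top" .
  have "((\<lambda>u. g (u + 1) / g u * (1 + ln (g (u + 1) / g u) * (1 / (ln (g u / w) - 1)))) \<longlongrightarrow> 1 * (1 + 0 * 0)) at_top"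
    by (intro tendsto_intros r ln0 inv)
  moreover have "eventually (\<lambda>u. g (u + 1) / g u * (1 + ln (g (u + 1) / g u) * (1 / (ln (g u / w) - 1))) = main_term w (g (u + 1)) / main_term w (g u)) at_top"
    using eventually_g[of "w * exp 2"]
  proof eventually_elim
    case (elim u)
    define s where "s = g u" 
    define t where "t = g (u + 1)"
    have st: "s > 0" "t > 0" using elim g(1)[of "u + 1"] c1 by (auto simp: s_def t_def)
    \<comment> \<open>From w exp 2 on, the factor ln(s / w) - 1 is at least 1 and may be divided
      by.\<close>
    have "exp 2 \<le> s / w" using elim w by (simp add: s_def field_simps)
    hence "ln (exp 2) \<le> ln (s / w)" using st w by (subst ln_le_cancel_iff) auto
    hence l: "ln (s / w) - 1 > 0" by simp
    define L where "L = ln (s / w) - 1"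
    have "ln (t / w) - 1 = L + ln (t / s)" using st w by (simp add: L_def ln_div)
    hence "main_term w t / main_term w s = t * (L + ln (t / s)) / (s * L)"
      by (simp add: main_term_def L_def)
    also have "\<dots> = t / s * (1 + ln (t / s) * (1 / L))" using l st by (simp add: L_def[symmetric] field_simps)
    finally show ?case unfolding L_def s_def t_def by simp
  qed
  ultimately show ?thesis using Lim_transform_eventually by fastforce
qed

text \<open>The count A is left abstract because increasing f requires counting ordinates below t,
  decreasing f those up to and including t.\<close>

lemma counting_proportion:
  fixes A :: "real \<Rightarrow> nat"
  assumes ab: "0 \<le> \<alpha>" "\<alpha> \<le> \<beta>" "\<beta> \<le> 1" and w: "w > 0" "c \<ge> w" and K: "K \<ge> 0"
    and Amono: "\<And>s t. s \<le> t \<Longrightarrow> A s \<le> A t"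
    and AV: "\<And>t. t \<ge> T0 \<Longrightarrow> \<bar>real (A t) - main_term w t\<bar> \<le> K * ln t"
    and P: "\<And>m n. real m \<ge> h (c + 1) \<Longrightarrow> A (g (real m)) \<le> n \<Longrightarrow> n < A (g (real (Suc m))) \<Longrightarrow>
      P n \<longleftrightarrow> A (g (real m + \<alpha>)) \<le> n \<and> n < A (g (real m + \<beta>))"
  shows "(\<lambda>N. real (card {n. n < N \<and> P n}) / real N) \<longlonglongrightarrow> \<beta> - \<alpha>"
proof -
  obtain m0 :: nat where "max (h (c + 1)) (h (max T0 (c + 1))) \<le> real m0" using real_arch_simple by blast
  hence m0: "h (c + 1) \<le> real m0" "h (max T0 (c + 1)) \<le> real m0" by auto
  have gm: "g u \<ge> c + 1" "g u \<ge> T0" if "u \<ge> real m0" for u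
    using g(1)[of u] g_le_iff(3)[of u "max T0 (c + 1)"] that m0 by auto
  note seq = filterlim_compose[OF _ filterlim_real_sequentially]
  show ?thesis
  proof (rule convex_counting_proportion[where E = "\<lambda>u. A (g u)" and W = "\<lambda>u. main_term w (g u)"
        and r = "\<lambda>u. K * ln (g u)" and ?m0.0 = m0, OF ab])
    fix u v :: real assume uv: "real m0 \<le> u" "u \<le> v"
    have gg: "g u \<le> g v" using uv m0 by (intro g_mono) auto
    thus "A (g u) \<le> A (g v)" by (rule Amono)
    show "K * ln (g u) \<le> K * ln (g v)" using gg gm[OF uv(1)] c1 K by (intro mult_left_mono ln_mono) auto
  next
    fix u :: real assume "real m0 \<le> u"
    thus "\<bar>real (A (g u)) - main_term w (g u)\<bar> \<le> K * ln (g u)" by (intro AV gm)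
  next
    fix m n assume "m \<ge> m0" "A (g (real m)) \<le> n" "n < A (g (real (Suc m)))"
    thus "P n \<longleftrightarrow> A (g (real m + \<alpha>)) \<le> n \<and> n < A (g (real m + \<beta>))" using m0 by (intro P) auto
  next
    show "convex_on {real m0..} (\<lambda>u. main_term w (g u))" using m0 by (intro main_term_g_convex w) auto
    show "(\<lambda>m. real m * (K * ln (g (real m))) / main_term w (g (real m))) \<longlonglongrightarrow> 0"
      by (rule seq[OF error_limit[OF w(1)]])
    have "(\<lambda>m. main_term w (g (real m + 1)) / main_term w (g (real m))) \<longlonglongrightarrow> 1"
      by (rule seq[OF main_term_shift_ratio[OF w(1)]])
    thus "(\<lambda>m. main_term w (g (real (Suc m))) / main_term w (g (real m))) \<longlonglongrightarrow> 1" by (simp add: add.commute)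
    have "filterlim (main_term w) at_top at_top" unfolding main_term_def[abs_def] using w by real_asymp
    from seq[OF filterlim_compose[OF this g_at_top]]
    show "filterlim (\<lambda>m. main_term w (g (real m))) at_top sequentially" .
  qed
qed

end

text \<open>A finite downward closed set of naturals is an initial segment. This turns comparisons
  of an index with a count into comparisons of ordinates.\<close>

lemma less_card_iff:
  fixes P :: "nat \<Rightarrow> bool"
  assumes "finite {n. P n}" "\<And>m n. m \<le> n \<Longrightarrow> P n \<Longrightarrow> P m"
  shows "n < card {n. P n} \<longleftrightarrow> P n"
proof
  assume "P n"
  hence "{..n} \<subseteq> {n. P n}" using assms(2) by auto
  hence "card {..n} \<le> card {n. P n}" by (rule card_mono[OF assms(1)])
  thus "n < card {n. P n}" by simp
next
  assume n: "n < card {n. P n}"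
  show "P n"
  proof (rule ccontr)
    assume "\<not> P n"
    hence "{n. P n} \<subseteq> {..<n}" using assms(2) by (auto simp: not_le[symmetric])
    hence "card {n. P n} \<le> card {..<n}" by (intro card_mono) auto
    thus False using n by simp
  qed
qed

context slow_concave
begin

context
  fixes \<gamma> :: "nat \<Rightarrow> real" and w K T0 :: real
  assumes w: "w > 0" "c \<ge> w" and K: "K \<ge> 0" and T0: "T0 \<ge> 1"
    and \<gamma>: "mono \<gamma>" "\<And>t. finite {n. \<gamma> n \<le> t}"
    and count: "\<And>t. t \<ge> T0 \<Longrightarrow> \<bar>real (card {n. \<gamma> n \<le> t}) - main_term w t\<bar> \<le> K * ln t"
begin

lemma finite_less: "finite {n. \<gamma> n < t}" by (rule finite_subset[OF _ \<gamma>(2)[of t]]) auto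

lemma less_count_le: "n < card {n. \<gamma> n \<le> t} \<longleftrightarrow> \<gamma> n \<le> t"
proof (rule less_card_iff[OF \<gamma>(2)])
  fix m n assume "m \<le> n" "\<gamma> n \<le> t"
  thus "\<gamma> m \<le> t" using monoD[OF \<gamma>(1), of m n] by linarith
qed

lemma less_count_less: "n < card {n. \<gamma> n < t} \<longleftrightarrow> \<gamma> n < t"
proof (rule less_card_iff[OF finite_less])
  fix m n assume "m \<le> n" "\<gamma> n < t"
  thus "\<gamma> m < t" using monoD[OF \<gamma>(1), of m n] by linarith
qed

text \<open>Left limit of the estimate for the other count. The strict count is the one that fits
  intervals closed on the left.\<close>

lemma count_less:
  assumes t: "t \<ge> T0 + 1"
  shows "\<bar>real (card {n. \<gamma> n < t}) - main_term w t\<bar> \<le> K * ln t"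
proof -
  have "real (card {n. \<gamma> n < t}) \<le> real (card {n. \<gamma> n \<le> t})"
    by (intro of_nat_mono card_mono \<gamma>(2)) auto
  moreover have "main_term w t - K * ln t \<le> real (card {n. \<gamma> n < t})"
  proof (rule tendsto_upperbound)
    have "isCont (main_term w) t" using main_term_deriv[of w t] t T0 w DERIV_isCont by auto
    hence "((main_term w) \<longlongrightarrow> main_term w t) (at_left t)"
      by (intro tendsto_within_subset[OF isContD]) auto
    moreover have "((\<lambda>s. ln s) \<longlongrightarrow> ln t) (at_left t)" using t T0 by (intro tendsto_intros) auto
    ultimately show "((\<lambda>s. main_term w s - K * ln s) \<longlongrightarrow> main_term w t - K * ln t) (at_left t)"
      by (rule tendsto_diff[OF _ tendsto_mult[OF tendsto_const]])
    have "eventually (\<lambda>s. s \<in> {T0<..<t}) (at_left t)" using t by (intro eventually_at_left_real) auto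
    thus "eventually (\<lambda>s. main_term w s - K * ln s \<le> real (card {n. \<gamma> n < t})) (at_left t)"
    proof eventually_elim
      case (elim s)
      have "card {n. \<gamma> n \<le> s} \<le> card {n. \<gamma> n < t}" using elim by (intro card_mono finite_less) auto
      thus ?case using count[of s] elim by simp
    qed
  qed simp
  ultimately show ?thesis using count[of t] t by simp
qed

lemma proportion_increasing:
  assumes ab: "0 \<le> \<alpha>" "\<alpha> \<le> \<beta>" "\<beta> \<le> 1"
  shows "(\<lambda>N. real (card {n. n < N \<and> frac (h (\<gamma> n)) \<in> {\<alpha>..<\<beta>}}) / real N) \<longlonglongrightarrow> \<beta> - \<alpha>"
proof (rule counting_proportion[where A = "\<lambda>t. card {n. \<gamma> n < t}", OF ab w K _ count_less])
  show "card {n. \<gamma> n < s} \<le> card {n. \<gamma> n < t}" if "s \<le> t" for s t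
    using that by (intro card_mono finite_less) auto
  fix m n
  assume m: "h (c + 1) \<le> real m" and n: "card {n. \<gamma> n < g (real m)} \<le> n" "n < card {n. \<gamma> n < g (real (Suc m))}"
  have "\<not> \<gamma> n < g (real m)" using leD[OF n(1)] unfolding less_count_less .
  hence n': "g (real m) \<le> \<gamma> n" "\<gamma> n < g (real (Suc m))" using n(2) unfolding less_count_less by simp_all
  have gn: "\<gamma> n > c" using g(1)[OF m] n' by simp
  have hn: "real m \<le> h (\<gamma> n)" "h (\<gamma> n) < real m + 1"
    using g_le_iff(1)[OF m gn] g_le_iff(4)[OF _ gn, of "real (Suc m)"] m n' by auto
  have "\<lfloor>h (\<gamma> n)\<rfloor> = int m" using hn by (intro floor_unique) auto
  hence fr: "frac (h (\<gamma> n)) = h (\<gamma> n) - real m" by (simp add: frac_def)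
  have "card {n. \<gamma> n < g (real m + \<alpha>)} \<le> n \<longleftrightarrow> real m + \<alpha> \<le> h (\<gamma> n)"
    using less_count_less[of n "g (real m + \<alpha>)"] g_le_iff(1)[OF _ gn, of "real m + \<alpha>"] ab m by auto
  moreover have "n < card {n. \<gamma> n < g (real m + \<beta>)} \<longleftrightarrow> h (\<gamma> n) < real m + \<beta>"
    using less_count_less[of n "g (real m + \<beta>)"] g_le_iff(4)[OF _ gn, of "real m + \<beta>"] ab m by auto
  ultimately show "frac (h (\<gamma> n)) \<in> {\<alpha>..<\<beta>} \<longleftrightarrow>
      card {n. \<gamma> n < g (real m + \<alpha>)} \<le> n \<and> n < card {n. \<gamma> n < g (real m + \<beta>)}"
    unfolding fr by auto
qed

text \<open>Negation reflects the unit intervals: for m < h <= m + 1 the fractional part of - h is m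
  + 1 - h. Thus [alpha, beta) becomes (1 - beta, 1 - alpha], open on the left, which is what the
  count including t fits.\<close>

lemma proportion_decreasing:
  assumes ab: "0 \<le> \<alpha>" "\<alpha> \<le> \<beta>" "\<beta> \<le> 1"
  shows "(\<lambda>N. real (card {n. n < N \<and> frac (- h (\<gamma> n)) \<in> {\<alpha>..<\<beta>}}) / real N) \<longlonglongrightarrow> \<beta> - \<alpha>"
proof -
  have ab': "0 \<le> 1 - \<beta>" "1 - \<beta> \<le> 1 - \<alpha>" "1 - \<alpha> \<le> 1" using ab by auto
  have "(\<lambda>N. real (card {n. n < N \<and> frac (- h (\<gamma> n)) \<in> {\<alpha>..<\<beta>}}) / real N) \<longlonglongrightarrow> (1 - \<alpha>) - (1 - \<beta>)"
  proof (rule counting_proportion[where A = "\<lambda>t. card {n. \<gamma> n \<le> t}", OF ab' w K _ count])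
    show "card {n. \<gamma> n \<le> s} \<le> card {n. \<gamma> n \<le> t}" if "s \<le> t" for s t
      using that by (intro card_mono \<gamma>(2)) auto
    fix m n
    assume m: "h (c + 1) \<le> real m" and n: "card {n. \<gamma> n \<le> g (real m)} \<le> n" "n < card {n. \<gamma> n \<le> g (real (Suc m))}"
    have "\<not> \<gamma> n \<le> g (real m)" using leD[OF n(1)] unfolding less_count_le .
    hence n': "g (real m) < \<gamma> n" "\<gamma> n \<le> g (real (Suc m))" using n(2) unfolding less_count_le by simp_all
    have gn: "\<gamma> n > c" using g(1)[OF m] n' by simp
    have hn: "real m < h (\<gamma> n)" "h (\<gamma> n) \<le> real m + 1"
      using g_le_iff(2)[OF m gn] g_le_iff(3)[OF _ gn, of "real (Suc m)"] m n' by auto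
    have "\<lfloor>- h (\<gamma> n)\<rfloor> = - int m - 1" using hn by (intro floor_unique) auto
    hence fr: "frac (- h (\<gamma> n)) = real m + 1 - h (\<gamma> n)" by (simp add: frac_def)
    have "card {n. \<gamma> n \<le> g (real m + (1 - \<beta>))} \<le> n \<longleftrightarrow> real m + (1 - \<beta>) < h (\<gamma> n)"
      using less_count_le[of n "g (real m + (1 - \<beta>))"] g_le_iff(2)[OF _ gn, of "real m + (1 - \<beta>)"] ab m by auto
    moreover have "n < card {n. \<gamma> n \<le> g (real m + (1 - \<alpha>))} \<longleftrightarrow> h (\<gamma> n) \<le> real m + (1 - \<alpha>)"
      using less_count_le[of n "g (real m + (1 - \<alpha>))"] g_le_iff(3)[OF _ gn, of "real m + (1 - \<alpha>)"] ab m by auto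
    ultimately show "frac (- h (\<gamma> n)) \<in> {\<alpha>..<\<beta>} \<longleftrightarrow>
        card {n. \<gamma> n \<le> g (real m + (1 - \<beta>))} \<le> n \<and> n < card {n. \<gamma> n \<le> g (real m + (1 - \<alpha>))}"
      unfolding fr by auto
  qed
  thus ?thesis by simp
qed

end

end

section \<open>Uniform distribution\<close>

lemma nonvanishing_constant_sign:
  fixes u :: "real \<Rightarrow> real"
  assumes cont: "\<And>t. t > c \<Longrightarrow> isCont u t" and nz: "\<And>t. t > c \<Longrightarrow> u t \<noteq> 0"
  obtains \<sigma> where "\<sigma> = 1 \<or> \<sigma> = -1" "\<And>t. t > c \<Longrightarrow> \<sigma> * u t > 0"
proof -
  define \<sigma> where "\<sigma> = sgn (u (c + 1))"
  have \<sigma>: "\<sigma> = 1 \<or> \<sigma> = -1" "\<sigma> * u (c + 1) > 0" using nz[of "c + 1"] by (auto simp: \<sigma>_def sgn_if)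
  have "\<sigma> * u t > 0" if t: "t > c" for t
  proof (rule ccontr)
    assume "\<not> \<sigma> * u t > 0"
    hence neg: "\<sigma> * u t \<le> 0" by simp
    have "connected ((\<lambda>t. \<sigma> * u t) ` {c<..})"
      by (intro connected_continuous_image continuous_intros continuous_at_imp_continuous_on ballI cont) auto
    moreover have "\<sigma> * u t \<in> (\<lambda>t. \<sigma> * u t) ` {c<..}" "\<sigma> * u (c + 1) \<in> (\<lambda>t. \<sigma> * u t) ` {c<..}" using t by auto
    ultimately have "0 \<in> (\<lambda>t. \<sigma> * u t) ` {c<..}" using neg \<sigma>(2) by (meson connected_contains_Icc subsetD atLeastAtMost_iff less_imp_le)
    thus False using nz \<sigma>(1) by auto
  qed
  with \<sigma>(1) show thesis by (rule that)
qed

text \<open>If |u| >= e from t1 on, the upper half [T/2, T] alone contributes about (e/2) T ln T to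
  the integral.\<close>

lemma weighted_mean_not_bounded_below:
  fixes u :: "real \<Rightarrow> real"
  assumes c: "c \<ge> 1" and int: "\<And>T. T \<ge> c \<Longrightarrow> (\<lambda>t. \<bar>u t\<bar> * ln t) integrable_on {c..T}"
    and small: "(\<lambda>T. integral {c..T} (\<lambda>t. \<bar>u t\<bar> * ln t)) \<in> o(\<lambda>T. T * ln T)"
    and e: "e > 0" and t1: "t1 \<ge> c" "\<And>t. t \<ge> t1 \<Longrightarrow> \<bar>u t\<bar> \<ge> e"
  shows False
proof -
  define I where "I = (\<lambda>T. integral {c..T} (\<lambda>t. \<bar>u t\<bar> * ln t))"
  have lim: "((\<lambda>T. I T / (T * ln T)) \<longlongrightarrow> 0) at_top" using smalloD_tendsto[OF small] by (simp add: I_def)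
  have lower: "e * ln (T / 2) * (T / 2) \<le> I T" if T: "T \<ge> 2 * t1" for T
  proof -
    have T': "T / 2 \<ge> t1" "T / 2 \<ge> 1" "T \<ge> c" using T t1 c by auto
    have sub: "{T/2..T} \<subseteq> {c..T}" using T' t1 by auto
    have int2: "(\<lambda>t. \<bar>u t\<bar> * ln t) integrable_on {T/2..T}" using int[OF T'(3)] sub by (rule integrable_subinterval_real)
    have "e * ln (T / 2) * (T / 2) = integral {T/2..T} (\<lambda>t. e * ln (T / 2))" using T' by simp
    also have "\<dots> \<le> integral {T/2..T} (\<lambda>t. \<bar>u t\<bar> * ln t)"
    proof (rule integral_le[OF _ int2])
      fix t assume t: "t \<in> {T/2..T}"
      show "e * ln (T / 2) \<le> \<bar>u t\<bar> * ln t" using t T' t1(2)[of t] e by (intro mult_mono ln_mono) auto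
    qed auto
    also have "\<dots> \<le> I T" unfolding I_def using int2 int[OF T'(3)] sub c by (intro integral_subset_le) auto
    finally show ?thesis .
  qed
  have "((\<lambda>T::real. ln (T / 2) * (T / 2) / (T * ln T)) \<longlongrightarrow> 1 / 2) at_top" by real_asymp
  from tendsto_mult[OF tendsto_const this, of e]
  have "((\<lambda>T. e * (ln (T / 2) * (T / 2) / (T * ln T))) \<longlongrightarrow> e * (1 / 2)) at_top" .
  moreover have "eventually (\<lambda>T. e * (ln (T / 2) * (T / 2) / (T * ln T)) \<le> I T / (T * ln T)) at_top"
    using eventually_ge_at_top[of "2 * t1"] eventually_gt_at_top[of 1]
  proof eventually_elim
    case (elim T)
    have "e * ln (T / 2) * (T / 2) / (T * ln T) \<le> I T / (T * ln T)" using lower[OF elim(1)] elim(2) by (intro divide_right_mono) auto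
    thus ?case by (simp only: times_divide_eq_right mult.assoc)
  qed
  ultimately have "e * (1 / 2) \<le> 0" by (intro tendsto_le[OF _ lim]) auto
  thus False using e by simp
qed

text \<open>The sign of the quotient with the cube fixes the sign of h''. If it were positive, h'
  would increase and stay away from 0, contrary to the bound on the weighted mean. So h' decreases,
  tends to 0 by the same bound, and h(t)/t tends to 0 by l'Hospital.\<close>

lemma slow_concave_intro:
  fixes f f' f'' :: "real \<Rightarrow> real"
  assumes c: "c \<ge> 1" "c \<ge> w" "w > 0"
    and d1: "\<And>t. t > c \<Longrightarrow> (f has_real_derivative f' t) (at t)"
    and d2: "\<And>t. t > c \<Longrightarrow> (f' has_real_derivative f'' t) (at t)"
    and nz: "\<And>t. t > c \<Longrightarrow> f' t \<noteq> 0"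
    and sgn: "(\<forall>t>c. f' t ^ 3 / (f'' t * ln (t / w)) > 0) \<or> (\<forall>t>c. f' t ^ 3 / (f'' t * ln (t / w)) < 0)"
    and inv: "(\<lambda>T. inverse (f' T)) \<in> o(\<lambda>T. T)"
    and int: "\<And>T. T \<ge> c \<Longrightarrow> (\<lambda>t. \<bar>f' t\<bar> * ln t) integrable_on {c..T}"
    and small: "(\<lambda>T. integral {c..T} (\<lambda>t. \<bar>f' t\<bar> * ln t)) \<in> o(\<lambda>T. T * ln T)"
  obtains \<sigma> where "\<sigma> = 1 \<or> \<sigma> = -1" "slow_concave (\<lambda>t. \<sigma> * f t) (\<lambda>t. \<sigma> * f' t) c"
proof -
  obtain \<sigma> where \<sigma>: "\<sigma> = 1 \<or> \<sigma> = -1" "\<And>t. t > c \<Longrightarrow> \<sigma> * f' t > 0"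
    by (rule nonvanishing_constant_sign[of c f', OF DERIV_isCont[OF d2] nz]) (assumption, assumption, rule that)
  define h h' h'' where "h = (\<lambda>t. \<sigma> * f t)" and "h' = (\<lambda>t. \<sigma> * f' t)" and "h'' = (\<lambda>t. \<sigma> * f'' t)"
  have hd: "(h has_real_derivative h' t) (at t)" "(h' has_real_derivative h'' t) (at t)" if "t > c" for t
    unfolding h_def h'_def h''_def by (intro DERIV_cmult d1 d2 that)+
  have pos: "h' t > 0" if "t > c" for t using \<sigma>(2)[OF that] by (simp add: h'_def)
  have abs: "\<bar>f' t\<bar> = h' t" if "t > c" for t using \<sigma>(1) pos[OF that] by (auto simp: h'_def)
  have ratio: "f' t ^ 3 / (f'' t * ln (t / w)) = h' t ^ 3 / (h'' t * ln (t / w))" for t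
    using \<sigma>(1) by (auto simp: h'_def h''_def)
  have ln: "ln (t / w) > 0" if "t > c" for t using that c by (intro ln_gt_zero) (simp add: field_simps)
  have ratio_sgn: "h' t ^ 3 / (h'' t * ln (t / w)) > 0 \<longleftrightarrow> h'' t > 0" "h' t ^ 3 / (h'' t * ln (t / w)) < 0 \<longleftrightarrow> h'' t < 0" if "t > c" for t
    using pos[OF that] ln[OF that] by (auto simp: zero_less_divide_iff divide_less_0_iff zero_less_mult_iff mult_less_0_iff)
  have sgn': "(\<forall>t>c. h'' t > 0) \<or> (\<forall>t>c. h'' t < 0)"
    using sgn ratio_sgn unfolding ratio by blast
  have not_below: "\<exists>t\<ge>t1. h' t < e" if e: "e > 0" "t1 > c" for e t1
  proof (rule ccontr)
    assume "\<not> ?thesis"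
    hence "\<bar>f' t\<bar> \<ge> e" if "t \<ge> t1" for t using that e abs[of t] by force
    from weighted_mean_not_bounded_below[OF c(1) int small e(1) less_imp_le[OF e(2)] this] show False .
  qed
  have "\<not> (\<forall>t>c. h'' t > 0)"
  proof
    assume p: "\<forall>t>c. h'' t > 0"
    obtain t where t: "t \<ge> c + 1" "h' t < h' (c + 1)" using not_below[of "h' (c + 1)" "c + 1"] pos[of "c + 1"] by auto
    have "h' (c + 1) \<le> h' t"
    proof (rule DERIV_nonneg_imp_nondecreasing[OF t(1)])
      fix x assume "c + 1 \<le> x" "x \<le> t"
      hence x: "x > c" by simp
      show "\<exists>y. (h' has_real_derivative y) (at x) \<and> 0 \<le> y"
        by (rule exI[of _ "h'' x"], rule conjI[OF hd(2)[OF x]]) (use p x in force)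
    qed
    with t show False by simp
  qed
  with sgn' have neg: "\<And>t. t > c \<Longrightarrow> h'' t < 0" by blast
  have anti: "h' t \<le> h' s" if "c < s" "s \<le> t" for s t
  proof (rule DERIV_nonpos_imp_nonincreasing[OF that(2)])
    fix x assume "s \<le> x" "x \<le> t"
    hence x: "x > c" using that by simp
    show "\<exists>y. (h' has_real_derivative y) (at x) \<and> y \<le> 0"
      by (rule exI[of _ "h'' x"], rule conjI[OF hd(2)[OF x]]) (use neg[OF x] in simp)
  qed
  have h'0: "(h' \<longlongrightarrow> 0) at_top"
  proof (rule tendstoI)
    fix e :: real assume e: "e > 0"
    obtain t1 where t1: "t1 \<ge> c + 1" "h' t1 < e" using not_below[OF e, of "c + 1"] by auto
    show "eventually (\<lambda>t. dist (h' t) 0 < e) at_top"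
      using eventually_ge_at_top[of t1]
    proof eventually_elim
      case (elim t)
      thus ?case using t1 anti[of t1 t] pos[of t] by simp
    qed
  qed
  have ev: "eventually (\<lambda>t. t > c) at_top" by (rule eventually_gt_at_top)
  have slow: "((\<lambda>t. h t / t) \<longlongrightarrow> 0) at_top"
  proof (rule lhospital_at_top_at_top[where f' = h' and g' = "\<lambda>_. 1"])
    show "eventually (\<lambda>t. (h has_real_derivative h' t) (at t)) at_top" using ev by eventually_elim (rule hd)
    show "((\<lambda>t. h' t / 1) \<longlongrightarrow> 0) at_top" using h'0 by simp
  qed (auto intro!: filterlim_ident always_eventually)
  have "((\<lambda>t. inverse (f' t) / t) \<longlongrightarrow> 0) at_top" by (rule smalloD_tendsto[OF inv])
  from tendsto_mult[OF tendsto_const this, of \<sigma>]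
  have "((\<lambda>t. \<sigma> * (inverse (f' t) / t)) \<longlongrightarrow> 0) at_top" by simp
  moreover have "\<sigma> * (inverse (f' t) / t) = 1 / (t * h' t)" for t using \<sigma>(1) by (auto simp: h'_def field_simps)
  ultimately have inv_o: "((\<lambda>t. 1 / (t * h' t)) \<longlongrightarrow> 0) at_top" by simp
  have unbounded: "filterlim h at_top at_top"
  proof -
    have "eventually (\<lambda>t. 1 / (t * h' t) < 1) at_top" using inv_o by (rule order_tendstoD(2)) simp
    hence "eventually (\<lambda>t. t > c \<and> 1 / (t * h' t) < 1) at_top" using ev by eventually_elim auto
    then obtain t1 where t1: "\<And>t. t \<ge> t1 \<Longrightarrow> t > c \<and> 1 / (t * h' t) < 1" unfolding eventually_at_top_linorder by blast
    \<comment> \<open>Once t h'(t) > 1, h grows at least as fast as the logarithm, hence without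
      bound.\<close>
    have "h t1 - ln t1 + ln t \<le> h t" if t: "t \<ge> t1" for t
    proof -
      have "h t1 - ln t1 \<le> h t - ln t"
      proof (rule DERIV_nonneg_imp_nondecreasing[OF t])
        fix x assume x: "t1 \<le> x" "x \<le> t"
        have x': "x > c" "x > 0" "h' x > 0" "1 / (x * h' x) < 1" using t1[OF x(1)] c pos by auto
        hence "1 < x * h' x" by (simp add: divide_simps)
        hence "h' x - 1 / x \<ge> 0" using x' by (simp add: field_simps)
        moreover have "((\<lambda>t. h t - ln t) has_real_derivative h' x - 1 / x) (at x)"
          using x' by (auto intro!: derivative_eq_intros hd(1))
        ultimately show "\<exists>y. ((\<lambda>t. h t - ln t) has_real_derivative y) (at x) \<and> 0 \<le> y" by blast
      qed
      thus ?thesis by simp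
    qed
    hence "eventually (\<lambda>t. h t1 - ln t1 + ln t \<le> h t) at_top" unfolding eventually_at_top_linorder by blast
    moreover have "filterlim (\<lambda>t::real. h t1 - ln t1 + ln t) at_top at_top" by real_asymp
    ultimately show ?thesis by (rule filterlim_at_top_mono[rotated])
  qed
  have "slow_concave h h' c"
    by unfold_locales (fact c(1) hd(1) pos anti slow unbounded inv_o)+
  with \<sigma>(1) show thesis unfolding h_def h'_def by (rule that)
qed

text \<open>The existence clause prevents the statement about all enumerations from being vacuous.
  The integrability clause in the last condition matters because \<open>integral\<close> has the
  default value 0 on functions that are not integrable.\<close>

theorem theorem1p2:
  fixes k :: nat and a :: complex
  shows "\<exists>c0::real. \<forall>c \<ge> c0. \<forall>(f::real \<Rightarrow> real) f' f''.
    ( (\<forall>t. c < t \<longrightarrow> (f has_real_derivative f' t) (at t) \<and>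
                        (f' has_real_derivative f'' t) (at t)) \<and>
      continuous_on {c<..} f'' ) \<longrightarrow>
    ( (mono_on {c<..} (\<lambda>t. t * (f' t)\<^sup>2) \<or> antimono_on {c<..} (\<lambda>t. t * (f' t)\<^sup>2)) \<and>
      ((\<forall>t>c. t * (f' t)\<^sup>2 > 0) \<or> (\<forall>t>c. t * (f' t)\<^sup>2 < 0)) ) \<longrightarrow>
    ( let g = (\<lambda>t. (f' t) ^ 3 / (f'' t * ln (t / (2 * real (n_ak a k) * pi)))) in
      (mono_on {c<..} g \<or> antimono_on {c<..} g) \<and>
      ((\<forall>t>c. g t > 0) \<or> (\<forall>t>c. g t < 0)) ) \<longrightarrow>
    (\<lambda>T. inverse (f' T)) \<in> o(\<lambda>T. T) \<longrightarrow>
    (\<lambda>T. f'' T / (f' T) ^ 3) \<in> o(\<lambda>T. T) \<longrightarrow>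
    ( (\<forall>T\<ge>c. (\<lambda>t. \<bar>f' t\<bar> * ln t) integrable_on {c..T}) \<and>
      (\<lambda>T. integral {c..T} (\<lambda>t. \<bar>f' t\<bar> * ln t)) \<in> o(\<lambda>T. T * ln T) ) \<longrightarrow>
    (\<exists>x. enumerates_a_points k a x) \<and>
    (\<forall>x. enumerates_a_points k a x \<longrightarrow> unif_distrib_mod1 (\<lambda>n. f (Im (x n))))"
proof -
  define w where "w = 2 * real (n_ak a k) * pi"
  have w: "w > 0" by (simp add: w_def n_ak_def)
  obtain K T0 where K: "K \<ge> 0" "T0 \<ge> 3"
    "\<And>T. T \<ge> T0 \<Longrightarrow> \<bar>2 * pi * real (zeta_count k a T) - T * (ln (T / (2 * pi * real (n_ak a k))) - 1)\<bar> \<le> K * ln T"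
    by (rule zeta_count_asymptotic[of k a]) (rule that)
  have count: "\<bar>real (zeta_count k a T) - main_term w T\<bar> \<le> K / (2 * pi) * ln T" if "T \<ge> T0" for T
  proof -
    have ww: "w = 2 * pi * real (n_ak a k)" by (simp add: w_def)
    have eq: "real (zeta_count k a T) - main_term w T = (2 * pi * real (zeta_count k a T) - T * (ln (T / w) - 1)) / (2 * pi)"
      by (simp add: main_term_def diff_divide_distrib)
    have "\<bar>real (zeta_count k a T) - main_term w T\<bar> = \<bar>2 * pi * real (zeta_count k a T) - T * (ln (T / w) - 1)\<bar> / (2 * pi)"
      unfolding eq by (simp only: abs_divide) simp
    also have "\<dots> \<le> K * ln T / (2 * pi)" using K(3)[OF that] unfolding ww by (intro divide_right_mono) auto
    finally show ?thesis by simp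
  qed
  have K': "K / (2 * pi) \<ge> 0" "T0 \<ge> 1" using K by auto
  show ?thesis
  \<comment> \<open>For c >= w the logarithm of t / w is positive beyond c, so the third condition
    gives the sign of f' f''; for c >= 1 the weight ln t in the last condition is
    nonnegative.\<close>
  proof (intro exI[of _ "max w 1"] allI impI, goal_cases)
    case (1 c f f' f'')
    note H = 1
    have c: "c \<ge> 1" "c \<ge> w" using H(1) by auto
    have d1: "(f has_real_derivative f' t) (at t)" and d2: "(f' has_real_derivative f'' t) (at t)" if "t > c" for t
      using H(2) that by auto
    have "t * (f' t)\<^sup>2 \<noteq> 0" if "t > c" for t
      using conjunct2[OF H(3)] that by force
    hence nz: "f' t \<noteq> 0" if "t > c" for t using that by force
    have sgn: "(\<forall>t>c. f' t ^ 3 / (f'' t * ln (t / w)) > 0) \<or> (\<forall>t>c. f' t ^ 3 / (f'' t * ln (t / w)) < 0)"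
      using H(4) unfolding Let_def w_def by (rule conjunct2)
    have int: "(\<lambda>t. \<bar>f' t\<bar> * ln t) integrable_on {c..T}" if "T \<ge> c" for T using conjunct1[OF H(7)] that by blast
    obtain \<sigma> where \<sigma>: "\<sigma> = 1 \<or> \<sigma> = -1" and sc: "slow_concave (\<lambda>t. \<sigma> * f t) (\<lambda>t. \<sigma> * f' t) c"
      by (rule slow_concave_intro[OF c w d1 d2 nz sgn H(5) int conjunct2[OF H(7)]]) (assumption, assumption, assumption, assumption, rule that)
    show "(\<exists>x. enumerates_a_points k a x) \<and> (\<forall>x. enumerates_a_points k a x \<longrightarrow> unif_distrib_mod1 (\<lambda>n. f (Im (x n))))"
    proof (intro conjI allI impI)
      show "\<exists>x. enumerates_a_points k a x" by (rule a_points_enumeration_exists)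
      fix x assume x: "enumerates_a_points k a x"
      have m: "mono (\<lambda>n. Im (x n))" using x by (simp add: enumerates_a_points_def)
      have cnt: "\<bar>real (card {n. Im (x n) \<le> t}) - main_term w t\<bar> \<le> K / (2 * pi) * ln t" if "t \<ge> T0" for t
        unfolding enumerates_a_points_count(2)[OF x] by (rule count[OF that])
      note args = w c(2) K' m enumerates_a_points_count(1)[OF x] cnt
      show "unif_distrib_mod1 (\<lambda>n. f (Im (x n)))"
        unfolding unif_distrib_mod1_def
      proof (intro allI impI)
        fix \<alpha> \<beta> :: real assume "0 \<le> \<alpha> \<and> \<alpha> < \<beta> \<and> \<beta> \<le> 1"
        hence ab: "0 \<le> \<alpha>" "\<alpha> \<le> \<beta>" "\<beta> \<le> 1" by auto
        from \<sigma> show "(\<lambda>N. real (card {n. n < N \<and> frac (f (Im (x n))) \<in> {\<alpha>..<\<beta>}}) / real N) \<longlonglongrightarrow> \<beta> - \<alpha>"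
        proof
          assume "\<sigma> = 1"
          thus ?thesis using slow_concave.proportion_increasing[OF sc args ab] by simp
        next
          assume "\<sigma> = -1"
          thus ?thesis using slow_concave.proportion_decreasing[OF sc args ab] by simp
        qed
      qed
    qed
  qed
qed

end
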